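(* Let $S=(S(t))_{t\ge0}$ be a $C_0$-semigroup on a complex separable Hilbert space $X$, let $T>0$ and $I=[0,T]$, and fix a stochastic basis with Brownian motion $\beta$. For every predictable $g:[0,T]\times\Omega\to X$ such that $$\int_0^T\|g(t,\cdot)\|_{L^\infty(\Omega;X)}^2\,\mathrm dt<\infty,$$ the process $U_g(t)=\int_0^tS(t-s)g(s)\,\mathrm d\beta_s$, $t\in I$, has a continuous version. Moreover, for every $p\in[1,\infty)$ one has $$\Big\|\sup_{t\in I}\|U_g(t)\|\Big\|_{L^p(\Omega)}\le C_p\,M_I^2\Big(\int_0^T\|g(s,\cdot)\|_{L^\infty(\Omega;X)}^2\,\mathrm ds\Big)^{1/2},$$ where $C_p=\frac{2^{3/4}B_{\max\{p,4\}}}{2^{1/4}-1}$ and $M_I=\sup_{t\in I}\|S(t)\|_{\mathscr L(X)}$.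
   Context: A stochastic basis is a complete filtered probability space $(\Omega,\mathscr F,\mathbb P,(\mathscr F_t)_{t\ge0})$ carrying a real one-dimensional Brownian motion $\beta$ (with respect to the filtration). In the second display the continuous version of $U_g$ is used. For $q\in(0,\infty)$, $B_q$ denotes a constant for which the Burkholder–Davis–Gundy inequality $\big(\mathbb E\sup_{t\in J}\|\int_0^th(s)\,\mathrm d\beta_s\|^q\big)^{1/q}\le B_q\|h\|_{L^q(\Omega;L^2(J;H))}$ holds for all separable Hilbert spaces $H$, all intervals $J=[0,T']$ or $J=\mathbb R_+$, all stochastic bases and all predictable $h\in L^q(\Omega;L^2(J;H))$. *)

theory Defs
  imports "HOL-Probability.Probability"
begin

section \<open>Complex Hilbert spaces and semigroups\<close>

text \<open>The underlying real inner product of a complex inner product space is the real part of the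
  complex one (which is linear in its first argument), so that norm, topology and Bochner
  integration are those of the class \<^class>\<open>real_inner\<close>. Positive definiteness of \<open>cinner\<close>
  follows from that of \<open>inner\<close>, as \<open>cinner x x\<close> is real by Hermitian symmetry.\<close>

class complex_inner = real_inner +
  fixes scaleC :: "complex \<Rightarrow> 'a \<Rightarrow> 'a"
    and cinner :: "'a \<Rightarrow> 'a \<Rightarrow> complex"
  assumes scaleC_add_right: "scaleC c (x + y) = scaleC c x + scaleC c y"
    and scaleC_add_left: "scaleC (c + d) x = scaleC c x + scaleC d x"
    and scaleC_scaleC: "scaleC c (scaleC d x) = scaleC (c * d) x"
    and scaleR_eq_scaleC: "scaleR r x = scaleC (complex_of_real r) x"
    and cinner_commute: "cinner x y = cnj (cinner y x)"
    and cinner_add_left: "cinner (x + y) z = cinner x z + cinner y z"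
    and cinner_scaleC_left: "cinner (scaleC c x) y = c * cinner x y"
    and inner_eq_Re_cinner: "inner x y = Re (cinner x y)"

class chilbert_space = complex_inner + complete_space

subclass (in chilbert_space) banach ..

text \<open>Only the values \<open>S t\<close> with \<open>t \<ge> 0\<close> matter.\<close>

definition C0_semigroup :: "(real \<Rightarrow> 'a \<Rightarrow> 'a::chilbert_space) \<Rightarrow> bool" where
  "C0_semigroup S \<longleftrightarrow>
     (\<forall>t\<ge>0. bounded_linear (S t) \<and> (\<forall>c x. S t (scaleC c x) = scaleC c (S t x))) \<and>
     (\<forall>x. S 0 x = x) \<and>
     (\<forall>s\<ge>0. \<forall>t\<ge>0. \<forall>x. S (s + t) x = S s (S t x)) \<and>
     (\<forall>x. ((\<lambda>t. S t x) \<longlongrightarrow> x) (at_right 0))"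


section \<open>Norms with values in the extended nonnegative reals\<close>

text \<open>Real powers; only used with exponents \<open>a > 0\<close>.\<close>

definition enn_powr :: "ennreal \<Rightarrow> real \<Rightarrow> ennreal" where
  "enn_powr x a = (if x = \<infinity> then \<infinity> else ennreal (enn2real x powr a))"

definition Lp_norm :: "'w measure \<Rightarrow> real \<Rightarrow> ('w \<Rightarrow> ennreal) \<Rightarrow> ennreal" where
  "Lp_norm M p f = enn_powr (\<integral>\<^sup>+\<omega>. enn_powr (f \<omega>) p \<partial>M) (1 / p)"

definition L2_time_norm :: "real set \<Rightarrow> (real \<Rightarrow> 'h::real_normed_vector) \<Rightarrow> ennreal" where
  "L2_time_norm J f = enn_powr (\<integral>\<^sup>+s\<in>J. (ennreal (norm (f s)))\<^sup>2 \<partial>lborel) (1 / 2)"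


section \<open>Stochastic bases and predictable processes\<close>

text \<open>Time is \<open>[0, \<infinity>)\<close>: filtrations and processes are indexed by reals, and their values at negative
  times are irrelevant. Completeness of the filtered space means that \<open>M\<close> is complete and that
  every \<open>F t\<close> contains all null sets; right-continuity of the filtration is not required.\<close>

definition complete_filtered_prob_space :: "'w measure \<Rightarrow> (real \<Rightarrow> 'w measure) \<Rightarrow> bool" where
  "complete_filtered_prob_space M F \<longleftrightarrow>
     prob_space M \<and> complete_measure M \<and>
     (\<forall>t\<ge>0. subalgebra M (F t)) \<and>
     (\<forall>s t. 0 \<le> s \<and> s \<le> t \<longrightarrow> sets (F s) \<subseteq> sets (F t)) \<and>
     (\<forall>t\<ge>0. null_sets M \<subseteq> sets (F t))"

definition brownian_motion ::
    "'w measure \<Rightarrow> (real \<Rightarrow> 'w measure) \<Rightarrow> (real \<Rightarrow> 'w \<Rightarrow> real) \<Rightarrow> bool" where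
  "brownian_motion M F \<beta> \<longleftrightarrow>
     (\<forall>t\<ge>0. \<beta> t \<in> borel_measurable (F t)) \<and>
     (AE \<omega> in M. \<beta> 0 \<omega> = 0) \<and>
     (AE \<omega> in M. continuous_on {0..} (\<lambda>t. \<beta> t \<omega>)) \<and>
     (\<forall>s t. 0 \<le> s \<and> s < t \<longrightarrow>
        distributed M lborel (\<lambda>\<omega>. \<beta> t \<omega> - \<beta> s \<omega>) (\<lambda>x. ennreal (normal_density 0 (sqrt (t - s)) x)) \<and>
        prob_space.indep_set M
          (sets (vimage_algebra (space M) (\<lambda>\<omega>. \<beta> t \<omega> - \<beta> s \<omega>) borel)) (sets (F s)))"

definition stochastic_basis ::
    "'w measure \<Rightarrow> (real \<Rightarrow> 'w measure) \<Rightarrow> (real \<Rightarrow> 'w \<Rightarrow> real) \<Rightarrow> bool" where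
  "stochastic_basis M F \<beta> \<longleftrightarrow> complete_filtered_prob_space M F \<and> brownian_motion M F \<beta>"

text \<open>The predictable \<open>\<sigma>\<close>-algebra on \<open>J \<times> \<Omega>\<close>, where \<open>J\<close> is an interval containing \<open>0\<close> as
  its left end point.\<close>

definition predictable_algebra ::
    "'w measure \<Rightarrow> (real \<Rightarrow> 'w measure) \<Rightarrow> real set \<Rightarrow> (real \<times> 'w) measure" where
  "predictable_algebra M F J = sigma (J \<times> space M)
     ({{0} \<times> A | A. A \<in> sets (F 0)} \<union>
      {{s<..t} \<times> A | s t A. 0 \<le> s \<and> s \<le> t \<and> t \<in> J \<and> A \<in> sets (F s)})"

definition predictable ::
    "'w measure \<Rightarrow> (real \<Rightarrow> 'w measure) \<Rightarrow> real set \<Rightarrow> (real \<Rightarrow> 'w \<Rightarrow> 'h::topological_space) \<Rightarrow> bool" where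
  "predictable M F J h \<longleftrightarrow> (\<lambda>(t, \<omega>). h t \<omega>) \<in> borel_measurable (predictable_algebra M F J)"


section \<open>The stochastic integral\<close>

text \<open>A list of triples \<open>(a, b, \<xi>)\<close> encodes the elementary process given by the sum of the
  \<open>\<xi> 1\<^bsub>(a, b]\<^esub>\<close>; the intervals may overlap.\<close>

type_synonym ('w, 'h) elementary = "(real \<times> real \<times> ('w \<Rightarrow> 'h)) list"

definition elementary_process ::
    "'w measure \<Rightarrow> (real \<Rightarrow> 'w measure) \<Rightarrow> real set \<Rightarrow> ('w, 'h::real_normed_vector) elementary \<Rightarrow> bool" where
  "elementary_process M F J es \<longleftrightarrow>
     (\<forall>(a, b, \<xi>) \<in> set es. 0 \<le> a \<and> a \<le> b \<and> b \<in> J \<and>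
        \<xi> \<in> borel_measurable (F a) \<and> bounded (\<xi> ` space M))"

definition elementary_fun :: "('w, 'h::real_normed_vector) elementary \<Rightarrow> real \<Rightarrow> 'w \<Rightarrow> 'h" where
  "elementary_fun es t \<omega> = (\<Sum>(a, b, \<xi>)\<leftarrow>es. indicat_real {a<..b} t *\<^sub>R \<xi> \<omega>)"

definition elementary_integral ::
    "(real \<Rightarrow> 'w \<Rightarrow> real) \<Rightarrow> ('w, 'h::real_normed_vector) elementary \<Rightarrow> real \<Rightarrow> 'w \<Rightarrow> 'h" where
  "elementary_integral \<beta> es t \<omega> = (\<Sum>(a, b, \<xi>)\<leftarrow>es. (\<beta> (min b t) \<omega> - \<beta> (min a t) \<omega>) *\<^sub>R \<xi> \<omega>)"

text \<open>Convergence to \<open>0\<close> in probability.\<close>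

definition tendsto_0_in_prob :: "'w measure \<Rightarrow> (nat \<Rightarrow> 'w \<Rightarrow> ennreal) \<Rightarrow> bool" where
  "tendsto_0_in_prob M f \<longleftrightarrow>
     (\<forall>\<epsilon>>0. (\<lambda>n. emeasure M {\<omega> \<in> space M. f n \<omega> > \<epsilon>}) \<longlonglongrightarrow> 0)"

text \<open>\<open>Y\<close> is (a continuous version of) the It\^o integral process of \<open>h\<close>, for predictable \<open>h\<close> with
  paths almost surely in \<open>L\<^sup>2\<close> on bounded parts of \<open>J\<close>: the limit of integrals of
  elementary processes, in probability and uniformly on bounded time intervals. It is unique up to
  indistinguishability. As \<open>Y\<close> and the elementary integrals have almost surely continuous paths
  and \<open>M\<close> is complete, the suprema below are measurable.\<close>

definition has_stoch_integral ::
    "'w measure \<Rightarrow> (real \<Rightarrow> 'w measure) \<Rightarrow> (real \<Rightarrow> 'w \<Rightarrow> real) \<Rightarrow> real set \<Rightarrow>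
     (real \<Rightarrow> 'w \<Rightarrow> 'h::{real_normed_vector, second_countable_topology}) \<Rightarrow> (real \<Rightarrow> 'w \<Rightarrow> 'h) \<Rightarrow> bool" where
  "has_stoch_integral M F \<beta> J h Y \<longleftrightarrow>
     predictable M F J h \<and>
     (\<forall>t\<in>J. Y t \<in> borel_measurable (F t)) \<and>
     (AE \<omega> in M. continuous_on J (\<lambda>t. Y t \<omega>)) \<and>
     (\<exists>es. (\<forall>n. elementary_process M F J (es n)) \<and>
        (\<forall>t\<in>J.
           tendsto_0_in_prob M (\<lambda>n \<omega>. L2_time_norm {0..t} (\<lambda>s. elementary_fun (es n) s \<omega> - h s \<omega>)) \<and>
           tendsto_0_in_prob M (\<lambda>n \<omega>. SUP s\<in>{0..t}.
             ennreal (norm (elementary_integral \<beta> (es n) s \<omega> - Y s \<omega>)))))"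

definition stoch_integral ::
    "'w measure \<Rightarrow> (real \<Rightarrow> 'w measure) \<Rightarrow> (real \<Rightarrow> 'w \<Rightarrow> real) \<Rightarrow> real set \<Rightarrow>
     (real \<Rightarrow> 'w \<Rightarrow> 'h::{real_normed_vector, second_countable_topology}) \<Rightarrow> real \<Rightarrow> 'w \<Rightarrow> 'h" where
  "stoch_integral M F \<beta> J h = (SOME Y. has_stoch_integral M F \<beta> J h Y)"

text \<open>For every \<open>t\<close> the integrand is a different process on \<open>[0, t]\<close>.\<close>

definition stoch_convolution ::
    "'w measure \<Rightarrow> (real \<Rightarrow> 'w measure) \<Rightarrow> (real \<Rightarrow> 'w \<Rightarrow> real) \<Rightarrow> (real \<Rightarrow> 'h \<Rightarrow> 'h) \<Rightarrow>
     (real \<Rightarrow> 'w \<Rightarrow> 'h::{real_normed_vector, second_countable_topology}) \<Rightarrow> real \<Rightarrow> 'w \<Rightarrow> 'h" where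
  "stoch_convolution M F \<beta> S g t = stoch_integral M F \<beta> {0..t} (\<lambda>s \<omega>. S (t - s) (g s \<omega>)) t"

definition continuous_version ::
    "'w measure \<Rightarrow> real set \<Rightarrow> (real \<Rightarrow> 'w \<Rightarrow> 'h::topological_space) \<Rightarrow> (real \<Rightarrow> 'w \<Rightarrow> 'h) \<Rightarrow> bool" where
  "continuous_version M J U V \<longleftrightarrow>
     (\<forall>t\<in>J. V t \<in> borel_measurable M \<and> (AE \<omega> in M. V t \<omega> = U t \<omega>)) \<and>
     (\<forall>\<omega>\<in>space M. continuous_on J (\<lambda>t. V t \<omega>))"


section \<open>The separable Hilbert space of square summable sequences\<close>

typedef ell2 = "{x :: nat \<Rightarrow> real. summable (\<lambda>i. (x i)\<^sup>2)}"
  by (rule exI[of _ "\<lambda>_. 0"]) simp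

setup_lifting type_definition_ell2

lemma summable_mult_of_squares:
  fixes x y :: "nat \<Rightarrow> real"
  assumes "summable (\<lambda>i. (x i)\<^sup>2)" "summable (\<lambda>i. (y i)\<^sup>2)"
  shows "summable (\<lambda>i. x i * y i)"
proof (rule summable_comparison_test'[where N = 0])
  show "summable (\<lambda>i. (x i)\<^sup>2 + (y i)\<^sup>2)" using assms by (rule summable_add)
  fix n
  have "2 * \<bar>x n\<bar> * \<bar>y n\<bar> \<le> \<bar>x n\<bar>\<^sup>2 + \<bar>y n\<bar>\<^sup>2" by (rule sum_squares_bound)
  moreover have "0 \<le> \<bar>x n\<bar> * \<bar>y n\<bar>" by simp
  ultimately have "\<bar>x n\<bar> * \<bar>y n\<bar> \<le> \<bar>x n\<bar>\<^sup>2 + \<bar>y n\<bar>\<^sup>2" by linarith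
  then show "norm (x n * y n) \<le> (x n)\<^sup>2 + (y n)\<^sup>2" by (simp add: abs_mult)
qed

lemma summable_square_add:
  fixes x y :: "nat \<Rightarrow> real"
  assumes "summable (\<lambda>i. (x i)\<^sup>2)" "summable (\<lambda>i. (y i)\<^sup>2)"
  shows "summable (\<lambda>i. (x i + y i)\<^sup>2)"
proof -
  have "summable (\<lambda>i. (x i)\<^sup>2 + (y i)\<^sup>2 + 2 * (x i * y i))"
    using assms summable_mult_of_squares[OF assms] by (intro summable_add summable_mult)
  then show ?thesis by (simp add: power2_sum algebra_simps)
qed

instantiation ell2 :: real_vector
begin
lift_definition zero_ell2 :: ell2 is "\<lambda>_. 0" by simp
lift_definition plus_ell2 :: "ell2 \<Rightarrow> ell2 \<Rightarrow> ell2" is "\<lambda>x y i. x i + y i"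
  by (rule summable_square_add)
lift_definition uminus_ell2 :: "ell2 \<Rightarrow> ell2" is "\<lambda>x i. - x i" by simp
lift_definition minus_ell2 :: "ell2 \<Rightarrow> ell2 \<Rightarrow> ell2" is "\<lambda>x y i. x i - y i"
  subgoal for x y using summable_square_add[of x "\<lambda>i. - y i"] by simp done
lift_definition scaleR_ell2 :: "real \<Rightarrow> ell2 \<Rightarrow> ell2" is "\<lambda>r x i. r * x i"
  by (simp add: power_mult_distrib summable_mult)
instance
  by standard (transfer; simp add: fun_eq_iff algebra_simps)+
end

instantiation ell2 :: real_inner
begin
lift_definition inner_ell2 :: "ell2 \<Rightarrow> ell2 \<Rightarrow> real" is "\<lambda>x y. \<Sum>i. x i * y i" .
definition norm_ell2 :: "ell2 \<Rightarrow> real" where "norm_ell2 x = sqrt (inner x x)"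
definition dist_ell2 :: "ell2 \<Rightarrow> ell2 \<Rightarrow> real" where "dist_ell2 x y = norm (x - y)"
definition sgn_ell2 :: "ell2 \<Rightarrow> ell2" where "sgn_ell2 x = x /\<^sub>R norm x"
definition uniformity_ell2 :: "(ell2 \<times> ell2) filter" where
  "uniformity_ell2 = (INF e\<in>{0<..}. principal {(x, y). dist x y < e})"
definition open_ell2 :: "ell2 set \<Rightarrow> bool" where
  "open_ell2 U \<longleftrightarrow> (\<forall>x\<in>U. eventually (\<lambda>(x', y). x' = x \<longrightarrow> y \<in> U) uniformity)"
instance
proof
  fix x y z :: ell2 and r :: real
  show "inner x y = inner y x" by transfer (simp add: mult.commute)
  show "inner (x + y) z = inner x z + inner y z"
    by transfer (simp add: algebra_simps summable_mult_of_squares suminf_add)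
  show "inner (r *\<^sub>R x) y = r * inner x y"
    by transfer (simp add: mult.assoc summable_mult_of_squares suminf_mult)
  show "0 \<le> inner x x"
    by transfer (auto intro!: suminf_nonneg simp: power2_eq_square)
  show "inner x x = 0 \<longleftrightarrow> x = 0"
    by transfer (simp add: power2_eq_square[symmetric] suminf_eq_zero_iff fun_eq_iff)
qed (simp_all add: norm_ell2_def dist_ell2_def sgn_ell2_def uniformity_ell2_def open_ell2_def)
end

lemma norm_ell2_sq: "(norm x)\<^sup>2 = (\<Sum>i. (Rep_ell2 x i)\<^sup>2)" for x :: ell2
  by (simp add: power2_norm_eq_inner inner_ell2.rep_eq flip: power2_eq_square)

lemma summable_Rep_ell2: "summable (\<lambda>i. (Rep_ell2 x i)\<^sup>2)"
  using Rep_ell2[of x] by simp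

lemma sum_Rep_ell2_le: "(\<Sum>i<n. (Rep_ell2 x i)\<^sup>2) \<le> (norm x)\<^sup>2"
  unfolding norm_ell2_sq by (rule sum_le_suminf) (auto intro: summable_Rep_ell2)

lemma norm_ell2_le:
  assumes "\<And>n. (\<Sum>i<n. (Rep_ell2 x i)\<^sup>2) \<le> c\<^sup>2" "0 \<le> c"
  shows "norm x \<le> c"
proof -
  have "(norm x)\<^sup>2 \<le> c\<^sup>2"
    unfolding norm_ell2_sq using summable_Rep_ell2 assms(1) by (rule suminf_le_const)
  then show ?thesis using assms(2) by (rule power2_le_imp_le)
qed

lemma abs_Rep_ell2_le: "\<bar>Rep_ell2 x i\<bar> \<le> norm x"
proof -
  have "(Rep_ell2 x i)\<^sup>2 \<le> (\<Sum>j<Suc i. (Rep_ell2 x j)\<^sup>2)"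
    by (rule member_le_sum) auto
  also have "\<dots> \<le> (norm x)\<^sup>2" by (rule sum_Rep_ell2_le)
  finally have "\<bar>Rep_ell2 x i\<bar>\<^sup>2 \<le> (norm x)\<^sup>2" by simp
  then show ?thesis by (rule power2_le_imp_le) simp
qed

instance ell2 :: complete_space
proof
  fix X :: "nat \<Rightarrow> ell2" assume C: "Cauchy X"
  define x where "x i = lim (\<lambda>n. Rep_ell2 (X n) i)" for i
  have lim: "(\<lambda>n. Rep_ell2 (X n) i) \<longlonglongrightarrow> x i" for i
  proof -
    have "Cauchy (\<lambda>n. Rep_ell2 (X n) i)"
    proof (rule metric_CauchyI)
      fix e :: real assume "0 < e"
      then obtain N where N: "\<And>m n. m \<ge> N \<Longrightarrow> n \<ge> N \<Longrightarrow> dist (X m) (X n) < e"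
        using C unfolding Cauchy_def by blast
      have "dist (Rep_ell2 (X m) i) (Rep_ell2 (X n) i) < e" if "m \<ge> N" "n \<ge> N" for m n
        using abs_Rep_ell2_le[of "X m - X n" i] N[OF that]
        by (simp add: dist_real_def minus_ell2.rep_eq dist_norm)
      then show "\<exists>N. \<forall>m\<ge>N. \<forall>n\<ge>N. dist (Rep_ell2 (X m) i) (Rep_ell2 (X n) i) < e" by blast
    qed
    then show ?thesis unfolding x_def by (simp add: Cauchy_convergent_iff convergent_LIMSEQ_iff)
  qed
  have tail: "(\<Sum>i<k. (Rep_ell2 (X m) i - x i)\<^sup>2) \<le> e\<^sup>2"
    if N: "\<And>n. n \<ge> N \<Longrightarrow> dist (X m) (X n) < e" for m N k e
  proof (rule LIMSEQ_le_const2)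
    show "(\<lambda>n. \<Sum>i<k. (Rep_ell2 (X m) i - Rep_ell2 (X n) i)\<^sup>2) \<longlonglongrightarrow> (\<Sum>i<k. (Rep_ell2 (X m) i - x i)\<^sup>2)"
      by (intro tendsto_sum tendsto_power tendsto_diff tendsto_const lim)
    have "(\<Sum>i<k. (Rep_ell2 (X m) i - Rep_ell2 (X n) i)\<^sup>2) \<le> e\<^sup>2" if "n \<ge> N" for n
    proof -
      have "(\<Sum>i<k. (Rep_ell2 (X m) i - Rep_ell2 (X n) i)\<^sup>2) \<le> (norm (X m - X n))\<^sup>2"
        using sum_Rep_ell2_le[of "X m - X n" k] by (simp add: minus_ell2.rep_eq)
      also have "\<dots> \<le> e\<^sup>2" using N[OF that] by (intro power_mono) (auto simp: dist_norm)
      finally show ?thesis .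
    qed
    then show "\<exists>N. \<forall>n\<ge>N. (\<Sum>i<k. (Rep_ell2 (X m) i - Rep_ell2 (X n) i)\<^sup>2) \<le> e\<^sup>2" by blast
  qed
  have sq: "summable (\<lambda>i. (x i)\<^sup>2)"
  proof -
    obtain N where N: "\<And>m n. m \<ge> N \<Longrightarrow> n \<ge> N \<Longrightarrow> dist (X m) (X n) < 1"
      using C unfolding Cauchy_def by (metis zero_less_one)
    have "summable (\<lambda>i. (Rep_ell2 (X N) i - x i)\<^sup>2)"
      using tail[of N N 1] N by (intro summableI_nonneg_bounded[where x = 1]) auto
    from summable_square_add[OF summable_Rep_ell2[of "X N"], of "\<lambda>i. - (Rep_ell2 (X N) i - x i)"] this
    show ?thesis by (simp add: power2_commute)
  qed
  have R: "Rep_ell2 (Abs_ell2 x) = x" using sq by (simp add: Abs_ell2_inverse)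
  have "X \<longlonglongrightarrow> Abs_ell2 x"
  proof (rule metric_LIMSEQ_I)
    fix r :: real assume "0 < r"
    then obtain N where N: "\<And>m n. m \<ge> N \<Longrightarrow> n \<ge> N \<Longrightarrow> dist (X m) (X n) < r / 2"
      using C unfolding Cauchy_def by (metis half_gt_zero)
    have "dist (X m) (Abs_ell2 x) < r" if "m \<ge> N" for m
    proof -
      have "norm (X m - Abs_ell2 x) \<le> r / 2"
        using tail[of N m "r / 2"] N[OF that] \<open>0 < r\<close>
        by (intro norm_ell2_le) (auto simp: minus_ell2.rep_eq R)
      then show ?thesis using \<open>0 < r\<close> by (simp add: dist_norm)
    qed
    then show "\<exists>N. \<forall>n\<ge>N. dist (X n) (Abs_ell2 x) < r" by blast
  qed
  then show "convergent X" by (auto simp: convergent_def)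
qed

lemma countable_dense_imp_basis:
  fixes D :: "'a::metric_space set"
  assumes "countable D" "\<And>x e. 0 < e \<Longrightarrow> \<exists>d\<in>D. dist d x < e"
  shows "\<exists>B::'a set set. countable B \<and> open = generate_topology B"
proof -
  define B where "B = (\<lambda>(d, n). ball d (inverse (real (Suc n)))) ` (D \<times> (UNIV :: nat set))"
  have "topological_basis B"
  proof (rule topological_basisI)
    fix b assume "b \<in> B" then show "open b" by (auto simp: B_def)
  next
    fix U :: "'a set" and x assume "open U" "x \<in> U"
    then obtain e where e: "0 < e" "ball x e \<subseteq> U" by (meson open_contains_ball)
    obtain n where n: "inverse (real (Suc n)) < e / 2"
      using reals_Archimedean[of "e / 2"] e by auto
    obtain d where d: "d \<in> D" "dist d x < inverse (real (Suc n))"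
      using assms(2)[of "inverse (real (Suc n))" x] by auto
    have "ball d (inverse (real (Suc n))) \<subseteq> ball x e"
    proof
      fix y assume "y \<in> ball d (inverse (real (Suc n)))"
      then have "dist x y < inverse (real (Suc n)) + inverse (real (Suc n))"
        using d(2) by (intro order.strict_trans1[OF dist_triangle[of x y d]] add_strict_mono)
          (auto simp: dist_commute)
      then show "y \<in> ball x e" using n by simp
    qed
    then show "\<exists>b\<in>B. x \<in> b \<and> b \<subseteq> U"
      using d e by (intro bexI[of _ "ball d (inverse (real (Suc n)))"]) (auto simp: B_def)
  qed
  moreover have "countable B" unfolding B_def using assms(1) by blast
  ultimately show ?thesis
    using topological_basis_imp_subbasis by blast
qed

instance ell2 :: second_countable_topology
proof
  define D :: "ell2 set" where
    "D = (\<lambda>qs. Abs_ell2 (\<lambda>i. if i < length qs then of_rat (qs ! i) else 0)) ` UNIV"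
  have dense: "\<exists>d\<in>D. dist d x < e" if e: "0 < e" for x e
  proof -
    let ?x = "Rep_ell2 x"
    obtain n where n: "(\<Sum>i. (?x (i + n))\<^sup>2) < e\<^sup>2 / 4"
    proof -
      have "(\<lambda>n. \<Sum>i. (?x (i + n))\<^sup>2) \<longlonglongrightarrow> 0"
        using suminf_exist_split2[OF summable_Rep_ell2] .
      moreover have "0 < e\<^sup>2 / 4" using e by simp
      ultimately have "eventually (\<lambda>n. (\<Sum>i. (?x (i + n))\<^sup>2) < e\<^sup>2 / 4) sequentially"
        by (rule order_tendstoD)
      then show thesis using that by (auto simp: eventually_sequentially)
    qed
    define \<delta> where "\<delta> = e / (2 * sqrt (real (Suc n)))"
    have \<delta>: "0 < \<delta>" using e by (simp add: \<delta>_def)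
    have "\<exists>q. \<bar>of_rat q - ?x i\<bar> < \<delta>" for i
      using of_rat_dense[of "?x i - \<delta>" "?x i + \<delta>"] \<delta>
      by (metis (no_types, opaque_lifting) abs_diff_less_iff add_strict_increasing diff_less_eq less_add_same_cancel1 order_less_trans)
    then obtain q where q: "\<And>i. \<bar>of_rat (q i) - ?x i\<bar> < \<delta>" by metis
    define y :: "nat \<Rightarrow> real" where "y i = (if i < n then of_rat (q i) else 0)" for i
    have sy: "summable (\<lambda>i. (y i)\<^sup>2)"
      by (rule summable_finite[of "{..<n}"]) (auto simp: y_def)
    have yD: "Abs_ell2 y \<in> D"
      unfolding D_def by (rule image_eqI[where x = "map q [0..<n]"])
        (auto simp: y_def fun_eq_iff intro!: arg_cong[where f = Abs_ell2])
    have Ry: "Rep_ell2 (Abs_ell2 y - x) = (\<lambda>i. y i - ?x i)"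
      using sy by (simp add: minus_ell2.rep_eq Abs_ell2_inverse)
    have sm: "summable (\<lambda>i. (y i - ?x i)\<^sup>2)"
      using summable_Rep_ell2[of "Abs_ell2 y - x"] by (simp add: Ry)
    have "(norm (Abs_ell2 y - x))\<^sup>2 = (\<Sum>i. (y i - ?x i)\<^sup>2)"
      by (simp add: norm_ell2_sq Ry)
    also have "\<dots> = (\<Sum>i. (y (i + n) - ?x (i + n))\<^sup>2) + (\<Sum>i<n. (y i - ?x i)\<^sup>2)"
      by (rule suminf_split_initial_segment[OF sm])
    also have "(\<Sum>i. (y (i + n) - ?x (i + n))\<^sup>2) = (\<Sum>i. (?x (i + n))\<^sup>2)"
      by (simp add: y_def)
    also have "(\<Sum>i<n. (y i - ?x i)\<^sup>2) \<le> (\<Sum>i<n. \<delta>\<^sup>2)"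
    proof (rule sum_mono)
      fix i assume "i \<in> {..<n}"
      then have "\<bar>y i - ?x i\<bar> \<le> \<delta>" using q[of i] by (simp add: y_def)
      then show "(y i - ?x i)\<^sup>2 \<le> \<delta>\<^sup>2" using \<delta> by (simp add: abs_le_square_iff[symmetric])
    qed
    also have "(\<Sum>i<n. \<delta>\<^sup>2) = real n * \<delta>\<^sup>2" by simp
    also have "\<dots> \<le> real (Suc n) * \<delta>\<^sup>2" by (intro mult_right_mono) auto
    also have "\<dots> = e\<^sup>2 / 4" by (simp add: \<delta>_def power_divide power_mult_distrib field_simps)
    finally have "(norm (Abs_ell2 y - x))\<^sup>2 < e\<^sup>2"
      using n zero_less_power[OF e, of 2] by linarith
    then have "norm (Abs_ell2 y - x) < e" using e by (auto intro: power2_less_imp_less)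
    then show ?thesis using yD by (auto simp: dist_norm)
  qed
  have "countable D" unfolding D_def by (intro countable_image) simp
  then show "\<exists>B::ell2 set set. countable B \<and> open = generate_topology B"
    using dense by (rule countable_dense_imp_basis)
qed

text \<open>The next lemma shows that \<open>ell2\<close> is universal: every separable real Hilbert space, and every
  separable complex one with its underlying real structure, is isometrically isomorphic to a
  closed subspace of \<open>ell2\<close>.\<close>

lemma separable_embeds_ell2:
  "\<exists>f :: 'h::{real_inner, second_countable_topology} \<Rightarrow> ell2. linear f \<and> (\<forall>x. norm (f x) = norm x)"
proof -
  obtain D :: "'h set" where D: "countable D" "\<And>U. open U \<Longrightarrow> U \<noteq> {} \<Longrightarrow> \<exists>d\<in>D. d \<in> U"
    by (rule countable_dense_setE) blast
  have D_ne: "D \<noteq> {}" using D(2)[of UNIV] by auto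
  define d where "d = from_nat_into D"
  have d: "range d = D" unfolding d_def using D_ne D(1) by (rule range_from_nat_into)
  define P :: "(nat \<Rightarrow> 'h) \<Rightarrow> nat \<Rightarrow> 'h \<Rightarrow> 'h"
    where "P u n x = (\<Sum>i<n. (u i \<bullet> x) *\<^sub>R u i)" for u n x
  define us :: "nat \<Rightarrow> 'h list" where
    "us = rec_nat [] (\<lambda>n l. l @ [sgn (d n - P (\<lambda>i. l ! i) n (d n))])"
  define u where "u n = us (Suc n) ! n" for n
  have len: "length (us n) = n" for n by (induction n) (auto simp: us_def)
  have us_Suc: "us (Suc n) = us n @ [sgn (d n - P (\<lambda>i. us n ! i) n (d n))]" for n
    by (simp add: us_def)
  have us_u: "us n ! i = u i" if "i < n" for i n
    using that by (induction n) (auto simp: us_Suc nth_append len u_def less_Suc_eq)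
  have P_us: "P (\<lambda>i. us n ! i) n x = P u n x" for n x
    unfolding P_def by (intro sum.cong) (auto simp: us_u)
  have u: "u n = sgn (d n - P u n (d n))" for n
    unfolding u_def us_Suc P_us by (simp add: nth_append len)
  have nu: "u n = 0 \<or> u n \<bullet> u n = 1" for n
    by (subst (1 2 3) u) (simp add: norm_sgn sgn_zero_iff flip: power2_norm_eq_inner)
  have scl: "(u i \<bullet> u i) *\<^sub>R u i = u i" "(u i \<bullet> x) * (u i \<bullet> u i) = u i \<bullet> x" for i x
    using nu[of i] by auto
  have orth: "\<forall>i<n. \<forall>j<n. i \<noteq> j \<longrightarrow> u i \<bullet> u j = 0" for n
  proof (induction n)
    case (Suc n)
    have *: "u i \<bullet> u n = 0" if "i < n" for i
    proof -
      have "u i \<bullet> P u n (d n) = (\<Sum>j<n. (u j \<bullet> d n) * (u i \<bullet> u j))"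
        by (simp add: P_def inner_sum_right)
      also have "\<dots> = (\<Sum>j<n. if j = i then u i \<bullet> d n else 0)"
        using Suc that by (intro sum.cong) (auto simp: scl)
      also have "\<dots> = u i \<bullet> d n" using that by simp
      finally have "u i \<bullet> (d n - P u n (d n)) = 0" by (simp add: inner_diff_right)
      then show ?thesis by (subst (2) u) (simp add: sgn_div_norm)
    qed
    show ?case using Suc * by (auto simp: less_Suc_eq inner_commute)
  qed simp
  have orth': "u i \<bullet> u j = (if i = j then u i \<bullet> u i else 0)" for i j
    using orth[of "Suc (max i j)"] by (auto simp: less_Suc_eq_le)
  have uP: "u i \<bullet> P u n x = (if i < n then u i \<bullet> x else 0)" for i n x
  proof -
    have "(u j \<bullet> x) * (u i \<bullet> u j) = (if j = i then u i \<bullet> x else 0)" for j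
      using orth'[of i j] by (cases "j = i") (auto simp: scl)
    then have "u i \<bullet> P u n x = (\<Sum>j<n. if j = i then u i \<bullet> x else 0)"
      by (simp add: P_def inner_sum_right)
    then show ?thesis by simp
  qed
  have PP: "P u n x \<bullet> P u n x = (\<Sum>i<n. (u i \<bullet> x)\<^sup>2)" for n x
  proof -
    have "P u n x \<bullet> P u n x = (\<Sum>i<n. (u i \<bullet> x) * (u i \<bullet> P u n x))"
      by (subst (1) P_def) (simp add: inner_sum_left)
    then show ?thesis by (simp add: uP power2_eq_square)
  qed
  have xP: "x \<bullet> P u n x = (\<Sum>i<n. (u i \<bullet> x)\<^sup>2)" for n x
    unfolding P_def by (simp add: inner_sum_right power2_eq_square inner_commute)
  have bessel: "(\<Sum>i<n. (u i \<bullet> x)\<^sup>2) \<le> (norm x)\<^sup>2" for n x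
  proof -
    have "0 \<le> (x - P u n x) \<bullet> (x - P u n x)" by simp
    also have "\<dots> = (norm x)\<^sup>2 - (\<Sum>i<n. (u i \<bullet> x)\<^sup>2)"
      by (simp add: inner_diff_left inner_diff_right PP xP power2_norm_eq_inner
          inner_commute[of "P u n x" x])
    finally show ?thesis by simp
  qed
  have Pd: "P u (Suc n) (d n) = d n" for n
  proof -
    let ?v = "d n - P u n (d n)"
    have "u n \<bullet> d n = u n \<bullet> ?v" by (simp add: inner_diff_right uP)
    moreover have "(sgn v \<bullet> v) *\<^sub>R sgn v = v" for v :: 'h
      by (cases "v = 0")
        (simp_all add: sgn_div_norm field_simps power2_eq_square flip: power2_norm_eq_inner)
    ultimately have "(u n \<bullet> d n) *\<^sub>R u n = ?v" using u[of n] by simp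
    then show ?thesis by (simp add: P_def)
  qed
  have sm: "summable (\<lambda>i. (u i \<bullet> x)\<^sup>2)" for x
    using bessel by (intro summableI_nonneg_bounded[where x = "(norm x)\<^sup>2"]) auto
  define f where "f x = Abs_ell2 (\<lambda>i. u i \<bullet> x)" for x
  have Rf: "Rep_ell2 (f x) = (\<lambda>i. u i \<bullet> x)" for x
    using sm by (simp add: f_def Abs_ell2_inverse)
  have lin: "linear f"
    by (rule linearI) (simp_all add: Rep_ell2_inject[symmetric] Rf plus_ell2.rep_eq
        scaleR_ell2.rep_eq inner_add_right)
  have le: "norm (f x) \<le> norm x" for x
    by (rule norm_ell2_le) (auto simp: Rf bessel)
  have eq: "norm (f (d n)) = norm (d n)" for n
  proof (rule antisym[OF le])
    have "(norm (d n))\<^sup>2 = (\<Sum>i<Suc n. (u i \<bullet> d n)\<^sup>2)"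
      using PP[of "Suc n" "d n"] unfolding Pd by (simp add: power2_norm_eq_inner)
    also have "\<dots> \<le> (norm (f (d n)))\<^sup>2"
      using sum_Rep_ell2_le[of "f (d n)" "Suc n"] by (simp add: Rf)
    finally show "norm (d n) \<le> norm (f (d n))" by (rule power2_le_imp_le) simp
  qed
  have "norm x \<le> norm (f x)" for x
  proof (rule field_le_epsilon)
    fix e :: real assume "0 < e"
    then obtain n where n: "norm (x - d n) < e / 2"
      using D(2)[of "ball x (e / 2)"] d by (auto simp: dist_norm image_iff)
    have "norm x \<le> norm (d n) + norm (x - d n)"
      using norm_triangle_ineq[of "d n" "x - d n"] by simp
    also have "norm (d n) = norm (f x - f (x - d n))" by (simp add: eq linear_diff[OF lin])
    also have "\<dots> \<le> norm (f x) + norm (f (x - d n))" by (rule norm_triangle_ineq4)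
    also have "norm (f (x - d n)) \<le> norm (x - d n)" by (rule le)
    finally show "norm x \<le> norm (f x) + e" using n by linarith
  qed
  then show ?thesis using lin le by (intro exI[of _ f]) (auto intro: antisym)
qed


section \<open>Constants in the Burkholder--Davis--Gundy inequality\<close>

text \<open>The inequality for \<open>H\<close>-valued processes, with constant \<open>B\<close> and exponent \<open>q\<close>, over all
  stochastic bases with sample space of type \<open>'w\<close>.\<close>

definition BDG_inequality ::
    "'w itself \<Rightarrow> 'h::{real_inner, complete_space, second_countable_topology} itself \<Rightarrow>
     real \<Rightarrow> real \<Rightarrow> bool" where
  "BDG_inequality TYPE('w) TYPE('h) q B \<longleftrightarrow>
     (\<forall>(M :: 'w measure) F \<beta> J (h :: real \<Rightarrow> 'w \<Rightarrow> 'h) Y.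
        stochastic_basis M F \<beta> \<longrightarrow>
        J \<in> insert {0..} {{0..T'} | T'. 0 < T'} \<longrightarrow>
        predictable M F J h \<longrightarrow>
        Lp_norm M q (\<lambda>\<omega>. L2_time_norm J (\<lambda>s. h s \<omega>)) < \<infinity> \<longrightarrow>
        has_stoch_integral M F \<beta> J h Y \<longrightarrow>
        Lp_norm M q (\<lambda>\<omega>. SUP t\<in>J. ennreal (norm (Y t \<omega>)))
          \<le> ennreal B * Lp_norm M q (\<lambda>\<omega>. L2_time_norm J (\<lambda>s. h s \<omega>)))"

text \<open>By universality of \<open>ell2\<close>, the inequality for \<open>H = ell2\<close> is the one for all separable Hilbert
  spaces. Restricting the sample spaces to one type is harmless as well: if \<open>'w\<close> carries any
  stochastic basis, then it has at least the cardinality of the continuum, so that standard Borel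
  spaces, on which any pair of an integrand and a Brownian motion can be realised up to null sets,
  are available on \<open>'w\<close>.\<close>

definition BDG_constant :: "'w itself \<Rightarrow> real \<Rightarrow> real \<Rightarrow> bool" where
  "BDG_constant TYPE('w) q B \<longleftrightarrow> BDG_inequality TYPE('w) TYPE(ell2) q B"

end

theory Submission
  imports Defs
begin

text \<open>The convolution is estimated by chaining along dyadic points in a new clock. Let
  \<open>G t\<close> be the essential supremum of \<open>norm (g t)\<close> and let \<open>R\<close> exceed the integral of
  \<open>G\<^sup>2\<close>. Run time with the clock \<open>\<integral>\<^sub>0\<^sup>t (G\<^sup>2 + \<delta>) ds\<close>, where \<open>\<delta> > 0\<close> is chosen such that the total is
  \<open>R\<close>, and split it at level \<open>n\<close> into \<open>2\<^sup>n\<close> intervals \<open>[r, t]\<close> of length \<open>R / 2\<^sup>n\<close>. The increment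
  \<open>U t - S (t - r) (U r)\<close> is the stochastic integral of \<open>S (t - \<cdot>) g\<close> over \<open>[r, t]\<close>, so by the
  Burkholder--Davis--Gundy inequality its \<open>L\<^sup>q\<close> norm is at most \<open>B q * K * sqrt (R / 2\<^sup>n)\<close>, where \<open>K\<close>
  bounds the semigroup; for \<open>q \<ge> 4\<close> the maximum \<open>D n\<close> of the \<open>2\<^sup>n\<close> increments has norm at most
  \<open>B q * K * sqrt R * 2\<^bsup>-n/4\<^esup>\<close>, and this is summable.

  The processes \<open>V n t = S (t - r) (U r)\<close>, with \<open>r\<close> the last dyadic point of level \<open>n\<close> before \<open>t\<close>,
  satisfy \<open>norm (V (n + 1) t - V n t) \<le> K * D (n + 1)\<close>. They converge uniformly, and the limit is
  continuous because the jumps of \<open>V n\<close> have norm at most \<open>D n\<close>. Letting \<open>R\<close> decrease to the integral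
  of \<open>G\<^sup>2\<close> gives the inequality, even without the factor \<open>sqrt 2\<close> in the constant.

  The stochastic integrals exist since the Burkholder--Davis--Gundy inequality with exponent 2 extends
  the integral from elementary processes, which are dense, to square integrable predictable ones.\<close>

section \<open>Strongly continuous semigroups\<close>

text \<open>\<open>U\<close> is not given as one stochastic integral process: its integrand changes
  with \<open>t\<close>, so the Burkholder--Davis--Gundy inequality controls a single
  \<open>U t\<close> but not the supremum. The correction by \<open>S (t - r)\<close> cancels the
  part of the integrand before r by the semigroup law; this is why increments can be estimated at
  all. \<open>G\<close> is deterministic, hence so is the clock, and the dyadic points are nonrandom
  times. The summand \<delta> keeps the clock invertible where \<open>G\<close> vanishes. A maximum
  over 2^n increments costs 2^(n/q) in L^q against the gain 2^(-n/2); for q \<ge> 4 the net factor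
  is at most 2^(-n/4), and the sum of these is 2^(1/4) / (2^(1/4) - 1). One factor of the semigroup
  bound comes from the integrand, the other from transporting an increment to later times. Each
  \<open>U t\<close> is determined only up to a null set depending on t, so the paths are rebuilt
  from countably many values, and every continuous version is compared with \<open>U\<close> at
  those points.\<close>

lemma uniform_boundedness_principle:
  fixes L :: "'i \<Rightarrow> 'a::banach \<Rightarrow> 'b::real_normed_vector"
  assumes lin: "\<And>i. i \<in> I \<Longrightarrow> bounded_linear (L i)"
    and pw: "\<And>x. \<exists>K. \<forall>i\<in>I. norm (L i x) \<le> K"
  shows "\<exists>K. \<forall>i\<in>I. \<forall>x. norm (L i x) \<le> K * norm x"
proof -
  \<comment> \<open>Pointwise boundedness says that these closed sets cover the space, so by Baire's
    theorem one of them has an interior point.\<close>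
  define C where "C n = {x. \<forall>i\<in>I. norm (L i x) \<le> real n}" for n
  have clC: "closed (C n)" for n
  proof -
    have "C n = (\<Inter>i\<in>I. {x. norm (L i x) \<le> real n})" by (auto simp: C_def)
    moreover have "closed {x. norm (L i x) \<le> real n}" if "i \<in> I" for i
      by (intro closed_Collect_le continuous_on_norm linear_continuous_on lin[OF that]
          continuous_on_const)
    ultimately show ?thesis by auto
  qed
  have U: "(\<Union>n. C n) = UNIV"
  proof -
    have "\<exists>n. x \<in> C n" for x
    proof -
      obtain K where "\<forall>i\<in>I. norm (L i x) \<le> K" using pw by blast
      moreover obtain n where "K \<le> real n" using real_arch_simple by blast
      ultimately have "x \<in> C n" unfolding C_def by auto
      then show ?thesis by blast
    qed
    then show ?thesis by auto
  qed
  have "\<exists>n. interior (C n) \<noteq> {}"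
  proof (rule ccontr)
    assume "\<not> (\<exists>n. interior (C n) \<noteq> {})"
    then have "Met_TC.mtopology interior_of \<Union>(range C) = {}"
      by (intro Met_TC.metric_Baire_category_alt) (auto simp: clC complete_UNIV)
    then show False using U by simp
  qed
  then obtain n x0 where "x0 \<in> interior (C n)" by auto
  then obtain r where r: "0 < r" "ball x0 r \<subseteq> C n" by (auto simp: mem_interior)
  \<comment> \<open>A vector y of norm r/2 is the difference of two points of \<open>C n\<close>, so
    \<open>L i y\<close> has norm at most 2 n; scaling back by 2 * norm x / r gives the
    constant.\<close>
  have "norm (L i x) \<le> (4 * real n / r) * norm x" if i: "i \<in> I" for i x
  proof (cases "x = 0")
    case True
    then show ?thesis using linear_0[OF bounded_linear.linear[OF lin[OF i]]] by simp
  next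
    case False
    define y where "y = (r / (2 * norm x)) *\<^sub>R x"
    have "norm y = r / 2" using False r by (simp add: y_def)
    then have "x0 + y \<in> C n" "x0 \<in> C n" using r by (auto simp: dist_norm subset_iff)
    then have "norm (L i (x0 + y)) \<le> n" "norm (L i x0) \<le> n" using i by (auto simp: C_def)
    moreover have "L i (x0 + y) = L i x0 + L i y"
      using linear_add[OF bounded_linear.linear[OF lin[OF i]]] .
    ultimately have "norm (L i y) \<le> 2 * real n"
      using norm_triangle_ineq4[of "L i (x0 + y)" "L i x0"] by simp
    moreover have "L i y = (r / (2 * norm x)) *\<^sub>R L i x"
      unfolding y_def by (rule linear_scale[OF bounded_linear.linear[OF lin[OF i]]])
    ultimately have "(r / (2 * norm x)) * norm (L i x) \<le> 2 * real n" using r by simp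
    then show ?thesis using False r by (simp add: field_simps)
  qed
  then show ?thesis by blast
qed

lemma C0_semigroupD:
  assumes "C0_semigroup S"
  shows "0 \<le> t \<Longrightarrow> bounded_linear (S t)"
    and "S 0 x = x"
    and "0 \<le> s \<Longrightarrow> 0 \<le> t \<Longrightarrow> S (s + t) x = S s (S t x)"
    and "((\<lambda>t. S t x) \<longlongrightarrow> x) (at_right 0)"
  using assms by (auto simp: C0_semigroup_def)

lemma C0_semigroup_tendsto_0:
  assumes S: "C0_semigroup S" and t: "\<And>n. 0 \<le> t n" "t \<longlonglongrightarrow> 0"
  shows "(\<lambda>n. S (t n) x) \<longlonglongrightarrow> x"
proof -
  have "((\<lambda>t. S t x) \<longlongrightarrow> S 0 x) (at 0 within {0..})"
    using C0_semigroupD(4)[OF S, of x]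
    by (simp add: C0_semigroupD(2)[OF S] at_within_Ici_at_right)
  then have "continuous (at 0 within {0..}) (\<lambda>t. S t x)" by (simp add: continuous_within)
  then have "(\<lambda>n. S (t n) x) \<longlonglongrightarrow> S 0 x"
    using t by (auto simp: continuous_within_sequentially o_def)
  then show ?thesis by (simp add: C0_semigroupD(2)[OF S])
qed

text \<open>Otherwise there are times t n tending to 0 at which the operator norms exceed n. But
  \<open>S (t n) y\<close> converges for every y, so uniform boundedness gives a common
  bound.\<close>

lemma C0_semigroup_bounded_near_0:
  assumes S: "C0_semigroup S"
  shows "\<exists>\<eta>>0. \<exists>K. \<forall>t\<in>{0..\<eta>}. \<forall>x. norm (S t x) \<le> K * norm x"
proof (rule ccontr)
  assume *: "\<not> ?thesis"
  have "\<exists>t x. 0 \<le> t \<and> t \<le> inverse (real (Suc n)) \<and> real n * norm x < norm (S t x)" for n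
  proof -
    have "\<not> (\<forall>t\<in>{0..inverse (real (Suc n))}. \<forall>x. norm (S t x) \<le> real n * norm x)"
      using * by (metis inverse_positive_iff_positive of_nat_0_less_iff zero_less_Suc)
    then show ?thesis by (auto simp: not_le)
  qed
  then obtain t x where t: "\<And>n. 0 \<le> t n" "\<And>n. t n \<le> inverse (real (Suc n))"
    and x: "\<And>n. real n * norm (x n) < norm (S (t n) (x n))" by metis
  have "t \<longlonglongrightarrow> 0"
    by (rule tendsto_sandwich[OF _ _ tendsto_const LIMSEQ_inverse_real_of_nat])
      (use t in auto)
  then have lim: "(\<lambda>n. S (t n) y) \<longlonglongrightarrow> y" for y using C0_semigroup_tendsto_0[OF S] t(1) by blast
  have "\<exists>K. \<forall>n\<in>UNIV. \<forall>y. norm (S (t n) y) \<le> K * norm y"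
  proof (rule uniform_boundedness_principle)
    show "bounded_linear (S (t i))" for i by (rule C0_semigroupD(1)[OF S t(1)])
    show "\<exists>K. \<forall>i\<in>UNIV. norm (S (t i) y) \<le> K" for y
      using convergent_imp_Bseq[OF convergentI[OF lim[of y]]] by (auto simp: Bseq_def)
  qed
  then obtain K where K: "\<And>n y. norm (S (t n) y) \<le> K * norm y" by blast
  obtain n where n: "K \<le> real n" using real_arch_simple by blast
  have "K * norm (x n) \<le> real n * norm (x n)" using n by (intro mult_right_mono) auto
  then show False using K[of n "x n"] x[of n] by linarith
qed

text \<open>The interval is cut into steps of length \<eta>, each of which costs a factor
  \<open>K\<close> by the semigroup law.\<close>

lemma C0_semigroup_bounded:
  assumes S: "C0_semigroup S"
  shows "\<exists>K. \<forall>t\<in>{0..T}. \<forall>x. norm (S t x) \<le> K * norm x"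
proof -
  obtain \<eta> K0 where \<eta>: "0 < \<eta>" and K0: "\<And>t x. t \<in> {0..\<eta>} \<Longrightarrow> norm (S t x) \<le> K0 * norm x"
    using C0_semigroup_bounded_near_0[OF S] by blast
  \<comment> \<open>Raising the constant to at least 1 makes the powers of \<open>K\<close> increase
    with the number of steps.\<close>
  define K where "K = max K0 1"
  have K1: "1 \<le> K" by (simp add: K_def)
  have K: "norm (S t x) \<le> K * norm x" if "t \<in> {0..\<eta>}" for t x
    by (rule order_trans[OF K0[OF that]]) (simp add: K_def mult_right_mono)
  have *: "\<forall>t\<in>{0..real k * \<eta>}. \<forall>x. norm (S t x) \<le> K ^ k * norm x" for k
  proof (induction k)
    case 0
    then show ?case by (simp add: C0_semigroupD(2)[OF S])
  next
    case (Suc k)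
    show ?case
    proof (intro ballI allI)
      fix t x assume t: "t \<in> {0..real (Suc k) * \<eta>}"
      show "norm (S t x) \<le> K ^ Suc k * norm x"
      proof (cases "t \<le> \<eta>")
        case True
        have "norm (S t x) \<le> K * norm x" using K True t by auto
        also have "\<dots> \<le> K ^ Suc k * norm x"
          using K1 power_increasing[of 1 "Suc k" K] by (intro mult_right_mono) auto
        finally show ?thesis .
      next
        case False
        then have "S t x = S \<eta> (S (t - \<eta>) x)"
          using C0_semigroupD(3)[OF S, of \<eta> "t - \<eta>" x] \<eta> by simp
        then have "norm (S t x) \<le> K * norm (S (t - \<eta>) x)" using K[of \<eta>] \<eta> by simp
        also have "\<dots> \<le> K * (K ^ k * norm x)"
          using Suc False t K1 by (intro mult_left_mono) (auto simp: algebra_simps)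
        finally show ?thesis by (simp add: mult.assoc)
      qed
    qed
  qed
  obtain k where "T / \<eta> \<le> real k" using real_arch_simple by blast
  then have "T \<le> real k * \<eta>" using \<eta> by (simp add: field_simps)
  then show ?thesis using *[of k] by (intro exI[of _ "K ^ k"]) auto
qed

text \<open>A supremum of reals is an upper bound only when the set is bounded above, which the
  preceding lemma supplies.\<close>

lemma C0_semigroup_onorm:
  assumes S: "C0_semigroup S" and T: "0 < T"
  defines "K \<equiv> SUP t\<in>{0..T}. onorm (S t)"
  shows "0 \<le> K" and "t \<in> {0..T} \<Longrightarrow> norm (S t x) \<le> K * norm x"
proof -
  obtain C where C: "\<And>t x. t \<in> {0..T} \<Longrightarrow> norm (S t x) \<le> C * norm x"
    using C0_semigroup_bounded[OF S] by blast
  have "norm (S t x) \<le> max C 0 * norm x" if "t \<in> {0..T}" for t x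
    by (rule order_trans[OF C[OF that]]) (simp add: mult_right_mono)
  then have "onorm (S t) \<le> max C 0" if "t \<in> {0..T}" for t
    using that by (intro onorm_bound) auto
  then have "bdd_above ((\<lambda>t. onorm (S t)) ` {0..T})"
    by (intro bdd_aboveI[of _ "max C 0"]) auto
  then have le: "onorm (S t) \<le> K" if "t \<in> {0..T}" for t
    unfolding K_def using that by (rule cSUP_upper[rotated])
  have bl: "bounded_linear (S t)" if "t \<in> {0..T}" for t
    using C0_semigroupD(1)[OF S] that by simp
  show "0 \<le> K" using le[of 0] onorm_pos_le[OF bl, of 0] T by simp
  show "norm (S t x) \<le> K * norm x" if t: "t \<in> {0..T}"
    using onorm[OF bl[OF t]] le[OF t] by (meson mult_right_mono norm_ge_zero order_trans)
qed

text \<open>Factoring out the operator at the smaller of two times u, v bounds the difference by a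
  multiple of \<open>norm (S \<bar>u - v\<bar> x - x)\<close>. Continuity on both sides thus reduces
  to right continuity at 0.\<close>

lemma C0_semigroup_continuous_on_orbit:
  assumes S: "C0_semigroup S"
  shows "continuous_on {0..T} (\<lambda>t. S t x)"
proof -
  obtain C where C: "\<And>t x. t \<in> {0..T} \<Longrightarrow> norm (S t x) \<le> C * norm x"
    using C0_semigroup_bounded[OF S] by blast
  have *: "norm (S u x - S v x) \<le> C * norm (S \<bar>u - v\<bar> x - x)"
    if "u \<in> {0..T}" "v \<in> {0..T}" for u v
    using that
  proof (induction u v rule: linorder_wlog)
    case (le u v)
    have "S v x = S u (S (v - u) x)" using C0_semigroupD(3)[OF S, of u "v - u"] le by simp
    then have "norm (S u x - S v x) = norm (S u (S (v - u) x - x))"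
      using le by (simp add: linear_diff[OF bounded_linear.linear[OF C0_semigroupD(1)[OF S]]]
          norm_minus_commute)
    also have "\<dots> \<le> C * norm (S (v - u) x - x)" using C le by blast
    finally show ?case using le by simp
  next
    case (sym u v)
    then show ?case by (simp add: norm_minus_commute abs_minus_commute)
  qed
  show ?thesis
    unfolding continuous_on_sequentially o_def
  proof safe
    fix u l assume u: "\<forall>n. u n \<in> {0..T}" "l \<in> {0..T}" "u \<longlonglongrightarrow> l"
    have "(\<lambda>n. \<bar>u n - l\<bar>) \<longlonglongrightarrow> 0"
      using u(3) by (simp add: LIM_zero tendsto_rabs_zero)
    then have "(\<lambda>n. S \<bar>u n - l\<bar> x) \<longlonglongrightarrow> x"
      by (intro C0_semigroup_tendsto_0[OF S]) auto
    then have "(\<lambda>n. C * norm (S \<bar>u n - l\<bar> x - x)) \<longlonglongrightarrow> 0"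
      by (intro tendsto_mult_right_zero tendsto_norm_zero) (simp add: LIM_zero)
    then have "(\<lambda>n. S (u n) x - S l x) \<longlonglongrightarrow> 0"
      by (rule Lim_null_comparison[rotated]) (use * u in auto)
    then show "(\<lambda>n. S (u n) x) \<longlonglongrightarrow> S l x" by (rule LIM_zero_cancel)
  qed
qed

text \<open>Splitting S t y into S t x and S t (y - x) leaves an orbit and a term that is small
  uniformly in t. Joint continuity is what makes the integrand of the convolution
  predictable.\<close>

lemma C0_semigroup_continuous_on:
  fixes S :: "real \<Rightarrow> 'a \<Rightarrow> 'a::chilbert_space"
  assumes S: "C0_semigroup S"
  shows "continuous_on ({0..T} \<times> UNIV) (\<lambda>(t, x). S t x)"
proof -
  obtain C where C: "\<And>t x. t \<in> {0..T} \<Longrightarrow> norm (S t x) \<le> C * norm x"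
    using C0_semigroup_bounded[OF S] by blast
  show ?thesis
    unfolding continuous_on_sequentially o_def
  proof safe
    fix u t and x :: 'a assume "\<forall>n. u n \<in> {0..T} \<times> UNIV" "t \<in> {0..T}" "u \<longlonglongrightarrow> (t, x)"
    then have u: "\<And>n. fst (u n) \<in> {0..T}" "(\<lambda>n. fst (u n)) \<longlonglongrightarrow> t" "(\<lambda>n. snd (u n)) \<longlonglongrightarrow> x"
      by (auto simp: mem_Times_iff dest: tendsto_fst tendsto_snd)
    have "(\<lambda>n. S (fst (u n)) x) \<longlonglongrightarrow> S t x"
      using C0_semigroup_continuous_on_orbit[OF S, of T x] u \<open>t \<in> _\<close>
      by (auto simp: continuous_on_sequentially o_def)
    moreover have "(\<lambda>n. S (fst (u n)) (snd (u n) - x)) \<longlonglongrightarrow> 0"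
    proof (rule Lim_null_comparison)
      show "\<forall>\<^sub>F n in sequentially. norm (S (fst (u n)) (snd (u n) - x)) \<le> C * norm (snd (u n) - x)"
        using C u by simp
      show "(\<lambda>n. C * norm (snd (u n) - x)) \<longlonglongrightarrow> 0"
        using u(3) by (intro tendsto_mult_right_zero tendsto_norm_zero) (simp add: LIM_zero)
    qed
    ultimately have "(\<lambda>n. S (fst (u n)) x + S (fst (u n)) (snd (u n) - x)) \<longlonglongrightarrow> S t x + 0"
      by (rule tendsto_add)
    moreover have "S (fst (u n)) x + S (fst (u n)) (snd (u n) - x) = S (fst (u n)) (snd (u n))" for n
      using u(1)[of n] by (simp add: linear_diff[OF bounded_linear.linear[OF C0_semigroupD(1)[OF S]]])
    ultimately show "(\<lambda>n. case u n of (t, x) \<Rightarrow> S t x) \<longlonglongrightarrow> S t x" by (simp add: case_prod_beta)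
  qed
qed

section \<open>Two limit principles: telescoping sequences and piecewise approximation\<close>

lemma telescoping_lim:
  fixes f :: "nat \<Rightarrow> 'a::banach"
  assumes le: "\<And>n. norm (f (Suc n) - f n) \<le> x n" and x: "summable x"
  shows "f \<longlonglongrightarrow> lim f" and "norm (lim f - f n) \<le> (\<Sum>j. x (j + n))"
proof -
  have x0: "0 \<le> x n" for n using order_trans[OF norm_ge_zero le[of n]] .
  have "summable (\<lambda>n. f (Suc n) - f n)"
    by (rule summable_comparison_test'[OF x]) (rule le)
  then have "convergent (\<lambda>n. \<Sum>j<n. f (Suc j) - f j)" by (simp add: summable_iff_convergent)
  then have "convergent (\<lambda>n. f n - f 0)" using sum_lessThan_telescope[of f] by simp
  then have "convergent f" by (simp add: convergent_diff_const_right_iff)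
  then show lim: "f \<longlonglongrightarrow> lim f" by (simp add: convergent_LIMSEQ_iff)
  have "norm (f (n + m) - f n) \<le> (\<Sum>j. x (j + n))" for m
  proof -
    have "norm (f (n + m) - f n) \<le> (\<Sum>j<m. x (j + n))"
    proof (induction m)
      case (Suc m)
      have "norm (f (n + Suc m) - f n) \<le> norm (f (Suc (n + m)) - f (n + m)) + norm (f (n + m) - f n)"
        using norm_triangle_ineq[of "f (Suc (n + m)) - f (n + m)" "f (n + m) - f n"] by simp
      then show ?case using Suc le[of "n + m"] by (simp add: add.commute)
    qed simp
    also have "\<dots> \<le> (\<Sum>j. x (j + n))"
      by (intro sum_le_suminf summable_ignore_initial_segment x) (auto simp: x0)
    finally show ?thesis .
  qed
  then have "\<exists>N. \<forall>k\<ge>N. norm (f k - f n) \<le> (\<Sum>j. x (j + n))" by (metis le_Suc_ex)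
  then show "norm (lim f - f n) \<le> (\<Sum>j. x (j + n))"
    by (intro LIMSEQ_le_const2[OF tendsto_norm[OF tendsto_diff[OF lim tendsto_const]]])
qed

text \<open>The pieces are closed and finitely many, so near a point x only those containing x
  occur. On such a piece y and x are compared through the same \<open>h k\<close>; the functions of
  different pieces need not agree where the pieces meet.\<close>

lemma continuous_on_piecewise_approx:
  fixes V :: "'a::metric_space \<Rightarrow> 'b::metric_space"
  assumes "\<And>\<epsilon>. 0 < \<epsilon> \<Longrightarrow> \<exists>(N::nat) I h. A \<subseteq> (\<Union>k<N. I k) \<and>
    (\<forall>k<N. closed (I k) \<and> continuous_on (I k \<inter> A) (h k) \<and> (\<forall>t\<in>I k \<inter> A. dist (V t) (h k t) \<le> \<epsilon>))"
  shows "continuous_on A V"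
  unfolding continuous_on_iff
proof (intro ballI allI impI)
  fix x and e :: real assume x: "x \<in> A" and e: "0 < e"
  obtain N :: nat and I h where cov: "A \<subseteq> (\<Union>k<N. I k)"
    and k: "\<And>k. k < N \<Longrightarrow> closed (I k)" "\<And>k. k < N \<Longrightarrow> continuous_on (I k \<inter> A) (h k)"
      "\<And>k t. k < N \<Longrightarrow> t \<in> I k \<inter> A \<Longrightarrow> dist (V t) (h k t) \<le> e / 4"
  proof -
    have "0 < e / 4" using e by simp
    from assms[OF this] show ?thesis using that by blast
  qed
  \<comment> \<open>A piece that misses x is kept away by closedness; on the others
    \<open>h k\<close> is continuous at x.\<close>
  have "\<exists>d>0. \<forall>y\<in>A. dist y x < d \<longrightarrow> y \<in> I k \<longrightarrow> x \<in> I k \<and> dist (h k y) (h k x) < e / 4"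
    if kN: "k < N" for k
  proof (cases "x \<in> I k")
    case True
    then show ?thesis
      using k(2)[OF kN] x e unfolding continuous_on_iff
      by (metis IntI divide_pos_pos zero_less_numeral)
  next
    case False
    then have "open (- I k)" "x \<in> - I k" using k(1)[OF kN] by auto
    then obtain d where "0 < d" "\<And>y. dist y x < d \<Longrightarrow> y \<in> - I k"
      by (metis open_dist)
    then show ?thesis by (intro exI[of _ d]) auto
  qed
  then obtain d where d: "\<And>k. k < N \<Longrightarrow> 0 < d k"
    "\<And>k y. k < N \<Longrightarrow> y \<in> A \<Longrightarrow> dist y x < d k \<Longrightarrow> y \<in> I k \<Longrightarrow> x \<in> I k \<and> dist (h k y) (h k x) < e / 4"
    by metis
  define d0 where "d0 = Min (insert 1 (d ` {..<N}))"
  have d0: "0 < d0" "\<And>k. k < N \<Longrightarrow> d0 \<le> d k"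
    unfolding d0_def using d(1) by (auto simp: Min_gr_iff)
  show "\<exists>d>0. \<forall>x'\<in>A. dist x' x < d \<longrightarrow> dist (V x') (V x) < e"
  proof (intro exI[of _ d0] conjI ballI impI d0)
    fix y assume y: "y \<in> A" "dist y x < d0"
    obtain j where j: "j < N" "y \<in> I j" using cov y by auto
    then have "x \<in> I j" "dist (h j y) (h j x) < e / 4"
      using d(2)[of j y] d0(2)[of j] y by auto
    moreover from this have "dist (V y) (h j y) \<le> e / 4" "dist (V x) (h j x) \<le> e / 4"
      using k(3) j x y by auto
    moreover have "dist (V y) (V x) \<le> dist (V y) (h j y) + (dist (h j y) (h j x) + dist (V x) (h j x))"
      by (metis dist_commute dist_triangle dist_triangle_le add_left_mono order_trans)
    ultimately show "dist (V y) (V x) < e" using e by linarith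
  qed
qed

section \<open>Dyadic chaining\<close>

text \<open>The pathwise part of the argument, with no probability in it. \<sigma> is the clock
  normalised to total 1 and \<tau> a right inverse; \<open>\<sigma>_expand\<close> says that the
  inverse is Lipschitz with constant c.\<close>

locale dyadic_chain =
  fixes S :: "real \<Rightarrow> 'a \<Rightarrow> 'a::banach" and T K c :: real and \<sigma> \<tau> :: "real \<Rightarrow> real"
  assumes T_pos: "0 < T" and K_nonneg: "0 \<le> K" and c_pos: "0 < c"
    and S_linear: "t \<in> {0..T} \<Longrightarrow> linear (S t)"
    and S_0: "S 0 x = x"
    and S_add: "0 \<le> s \<Longrightarrow> 0 \<le> t \<Longrightarrow> S (s + t) x = S s (S t x)"
    and S_bound: "t \<in> {0..T} \<Longrightarrow> norm (S t x) \<le> K * norm x"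
    and S_continuous: "continuous_on {0..T} (\<lambda>t. S t x)"
    and \<sigma>_0: "\<sigma> 0 = 0" and \<sigma>_T: "\<sigma> T = 1"
    and \<sigma>_expand: "0 \<le> u \<Longrightarrow> u \<le> v \<Longrightarrow> v \<le> T \<Longrightarrow> v - u \<le> c * (\<sigma> v - \<sigma> u)"
    and \<tau>_range: "u \<in> {0..1} \<Longrightarrow> \<tau> u \<in> {0..T}"
    and \<sigma>_\<tau>: "u \<in> {0..1} \<Longrightarrow> \<sigma> (\<tau> u) = u"
begin

definition pt :: "nat \<Rightarrow> nat \<Rightarrow> real" where "pt n k = \<tau> (real k / 2 ^ n)"

definition idx :: "nat \<Rightarrow> real \<Rightarrow> nat" where "idx n t = nat \<lfloor>2 ^ n * \<sigma> t\<rfloor>"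

text \<open>\<open>W\<close> stands for a path of \<open>U\<close>; this is then the process
  \<open>V n\<close> of the overview.\<close>

definition chain_approx :: "(real \<Rightarrow> 'a) \<Rightarrow> nat \<Rightarrow> real \<Rightarrow> 'a" where
  "chain_approx W n t = S (t - pt n (idx n t)) (W (pt n (idx n t)))"

definition chain_incr :: "(real \<Rightarrow> 'a) \<Rightarrow> nat \<Rightarrow> nat \<Rightarrow> 'a" where
  "chain_incr W n k = W (pt n (Suc k)) - S (pt n (Suc k) - pt n k) (W (pt n k))"

lemma \<sigma>_mono: assumes "0 \<le> u" "u \<le> v" "v \<le> T" shows "\<sigma> u \<le> \<sigma> v"
proof -
  have "0 \<le> c * (\<sigma> v - \<sigma> u)" using \<sigma>_expand[OF assms] assms by linarith
  then show ?thesis using c_pos by (simp add: zero_le_mult_iff)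
qed

lemma \<sigma>_range: "t \<in> {0..T} \<Longrightarrow> \<sigma> t \<in> {0..1}"
  using \<sigma>_mono[of 0 t] \<sigma>_mono[of t T] by (simp add: \<sigma>_0 \<sigma>_T)

text \<open>Expansion forces \<sigma> to be injective, so its right inverse is two-sided.\<close>

lemma \<tau>_\<sigma>: assumes "t \<in> {0..T}" shows "\<tau> (\<sigma> t) = t"
  using \<sigma>_expand[of t "\<tau> (\<sigma> t)"] \<sigma>_expand[of "\<tau> (\<sigma> t)" t] assms \<tau>_range[OF \<sigma>_range[OF assms]]
  by (cases "t \<le> \<tau> (\<sigma> t)") (simp_all add: \<sigma>_\<tau>[OF \<sigma>_range[OF assms]])

lemma \<tau>_mono: assumes "0 \<le> u" "u \<le> v" "v \<le> 1" shows "\<tau> u \<le> \<tau> v"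
proof (rule ccontr)
  assume *: "\<not> ?thesis"
  have "\<tau> u - \<tau> v \<le> c * (\<sigma> (\<tau> u) - \<sigma> (\<tau> v))"
    using \<tau>_range[of u] \<tau>_range[of v] assms * by (intro \<sigma>_expand) auto
  also have "\<dots> = c * (u - v)" using assms by (simp add: \<sigma>_\<tau>)
  also have "\<dots> \<le> 0" using assms c_pos by (simp add: mult_le_0_iff)
  finally show False using * by simp
qed

lemma pt_range: "k \<le> 2 ^ n \<Longrightarrow> pt n k \<in> {0..T}"
  unfolding pt_def by (rule \<tau>_range) (simp add: divide_le_eq)

lemma pt_0: "pt n 0 = 0"
  using \<tau>_\<sigma>[of 0] T_pos by (simp add: pt_def \<sigma>_0)

lemma pt_T: "pt n (2 ^ n) = T"
  using \<tau>_\<sigma>[of T] T_pos by (simp add: pt_def \<sigma>_T)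

lemma \<sigma>_pt: "k \<le> 2 ^ n \<Longrightarrow> \<sigma> (pt n k) = real k / 2 ^ n"
  unfolding pt_def by (rule \<sigma>_\<tau>) (simp add: divide_le_eq)

lemma pt_double: "pt (Suc n) (2 * k) = pt n k"
  by (simp add: pt_def)

lemma pt_mono: "j \<le> k \<Longrightarrow> k \<le> 2 ^ n \<Longrightarrow> pt n j \<le> pt n k"
  unfolding pt_def by (rule \<tau>_mono) (simp_all add: divide_le_eq divide_right_mono)

lemma idx_bounds:
  assumes "t \<in> {0..T}"
  shows "idx n t \<le> 2 ^ n" "real (idx n t) / 2 ^ n \<le> \<sigma> t" "\<sigma> t < (real (idx n t) + 1) / 2 ^ n"
proof -
  have s: "0 \<le> \<sigma> t" "\<sigma> t \<le> 1" using \<sigma>_range[OF assms] by auto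
  have r: "real (idx n t) = of_int \<lfloor>2 ^ n * \<sigma> t\<rfloor>"
    unfolding idx_def using s by (simp add: of_nat_nat)
  have "real (idx n t) \<le> 2 ^ n * \<sigma> t" unfolding r by (rule of_int_floor_le)
  also have "2 ^ n * \<sigma> t \<le> 2 ^ n * 1" using s by (intro mult_left_mono) auto
  finally have "real (idx n t) \<le> real (2 ^ n)" by simp
  then show "idx n t \<le> 2 ^ n" by (simp only: of_nat_le_iff)
  show "real (idx n t) / 2 ^ n \<le> \<sigma> t"
    using of_int_floor_le[of "2 ^ n * \<sigma> t"] by (simp add: r divide_le_eq mult.commute)
  show "\<sigma> t < (real (idx n t) + 1) / 2 ^ n"
    using floor_correct[of "2 ^ n * \<sigma> t"] by (simp add: r less_divide_eq mult.commute)
qed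

lemma idx_eqI:
  assumes "real k / 2 ^ n \<le> \<sigma> t" "\<sigma> t < (real k + 1) / 2 ^ n"
  shows "idx n t = k"
proof -
  have "\<lfloor>2 ^ n * \<sigma> t\<rfloor> = int k"
    using assms by (intro floor_unique) (simp_all add: field_simps)
  then show ?thesis by (simp add: idx_def)
qed

lemma pt_idx_range: "t \<in> {0..T} \<Longrightarrow> pt n (idx n t) \<in> {0..T}"
  by (intro pt_range idx_bounds)

lemma pt_idx_le: assumes "t \<in> {0..T}" shows "pt n (idx n t) \<le> t"
proof -
  have "pt n (idx n t) \<le> \<tau> (\<sigma> t)"
    unfolding pt_def using idx_bounds[OF assms, of n] \<sigma>_range[OF assms] by (intro \<tau>_mono) auto
  then show ?thesis by (simp add: \<tau>_\<sigma>[OF assms])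
qed

lemma idx_Suc:
  assumes "t \<in> {0..T}"
  shows "idx (Suc n) t = 2 * idx n t \<or> idx (Suc n) t = Suc (2 * idx n t)"
proof (cases "\<sigma> t < (2 * real (idx n t) + 1) / 2 ^ Suc n")
  case True
  then have "idx (Suc n) t = 2 * idx n t"
    using idx_bounds[OF assms, of n] by (intro idx_eqI) simp_all
  then show ?thesis ..
next
  case False
  then have "idx (Suc n) t = Suc (2 * idx n t)"
    using idx_bounds[OF assms, of n] by (intro idx_eqI) (simp_all add: field_simps)
  then show ?thesis ..
qed

lemma idx_pt:
  assumes "j \<le> 2 ^ m" "m \<le> n"
  shows "pt n (idx n (pt m j)) = pt m j"
proof -
  have "(2::real) ^ n = 2 ^ (n - m) * 2 ^ m" using assms by (simp flip: power_add)
  then have e: "real (j * 2 ^ (n - m)) / 2 ^ n = real j / 2 ^ m" by simp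
  have "idx n (pt m j) = j * 2 ^ (n - m)"
    using e by (intro idx_eqI) (simp_all add: \<sigma>_pt[OF assms(1)] add_divide_distrib)
  then show ?thesis unfolding pt_def by (simp only: e)
qed

text \<open>By expansion an interval of level n, which has clock length 1 / 2^n, is no longer than c
  / 2^n in real time.\<close>

lemma pt_idx_tendsto: assumes "t \<in> {0..T}" shows "(\<lambda>n. pt n (idx n t)) \<longlonglongrightarrow> t"
proof (rule LIM_zero_cancel, rule Lim_null_comparison)
  have "norm (pt n (idx n t) - t) \<le> c * (1 / 2 ^ n)" for n
  proof -
    have "t - pt n (idx n t) \<le> c * (\<sigma> t - \<sigma> (pt n (idx n t)))"
      using pt_idx_range[OF assms, of n] pt_idx_le[OF assms] assms by (intro \<sigma>_expand) auto
    also have "\<dots> \<le> c * (1 / 2 ^ n)"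
      using idx_bounds[OF assms, of n] c_pos
      by (intro mult_left_mono) (auto simp: \<sigma>_pt add_divide_distrib)
    finally show ?thesis using pt_idx_le[OF assms, of n] by simp
  qed
  then show "\<forall>\<^sub>F n in sequentially. norm (pt n (idx n t) - t) \<le> c * (1 / 2) ^ n"
    by (simp add: power_one_over)
  show "(\<lambda>n. c * (1 / 2) ^ n) \<longlonglongrightarrow> 0"
    by (intro tendsto_mult_right_zero LIMSEQ_power_zero) simp
qed

section \<open>Convergence of the chain for one path whose increments are summable\<close>

context
  fixes W :: "real \<Rightarrow> 'a" and D :: "nat \<Rightarrow> real"
  assumes W_0: "W 0 = 0"
    and D: "\<And>n k. k < 2 ^ n \<Longrightarrow> norm (chain_incr W n k) \<le> D n"
    and D_summable: "summable D"
begin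

lemma D_nonneg: "0 \<le> D n"
  using order_trans[OF norm_ge_zero D[of 0 n]] by simp

text \<open>Refinement changes nothing when t lies in the left half of its interval. In the right
  half the old value can be carried through the new midpoint by the semigroup law, so the two values
  differ by one increment of the finer level, transported to t.\<close>

lemma chain_approx_Suc:
  assumes t: "t \<in> {0..T}"
  shows "norm (chain_approx W (Suc n) t - chain_approx W n t) \<le> K * D (Suc n)"
  using idx_Suc[OF t, of n]
proof
  assume "idx (Suc n) t = 2 * idx n t"
  then show ?thesis using K_nonneg D_nonneg by (simp add: chain_approx_def pt_double)
next
  assume i: "idx (Suc n) t = Suc (2 * idx n t)"
  let ?k = "2 * idx n t"
  let ?q = "pt (Suc n) ?k" and ?r = "pt (Suc n) (Suc ?k)"
  have k: "Suc ?k \<le> 2 ^ Suc n" using idx_bounds(1)[OF t, of "Suc n"] i by simp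
  have qr: "?q \<le> ?r" using k by (intro pt_mono) auto
  have q0: "?q \<in> {0..T}" "?r \<in> {0..T}" using k by (intro pt_range; simp)+
  have rt: "?r \<le> t" using pt_idx_le[OF t, of "Suc n"] i by simp
  have "chain_approx W n t = S (t - ?q) (W ?q)" by (simp add: chain_approx_def pt_double)
  also have "\<dots> = S (t - ?r) (S (?r - ?q) (W ?q))"
    using S_add[of "t - ?r" "?r - ?q" "W ?q"] qr rt by simp
  finally have "chain_approx W (Suc n) t - chain_approx W n t =
      S (t - ?r) (W ?r) - S (t - ?r) (S (?r - ?q) (W ?q))"
    by (simp add: chain_approx_def i)
  also have "\<dots> = S (t - ?r) (chain_incr W (Suc n) ?k)"
    unfolding chain_incr_def using rt q0 t by (subst linear_diff[OF S_linear]) auto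
  also have "norm \<dots> \<le> K * norm (chain_incr W (Suc n) ?k)"
    using rt q0 t by (intro S_bound) auto
  also have "\<dots> \<le> K * D (Suc n)" using k K_nonneg by (intro mult_left_mono D) auto
  finally show ?thesis .
qed

text \<open>At level 0 the only points are 0 and T. As \<open>W 0 = 0\<close>, the value is 0 before
  T, while at T it is the single increment of that level. The factor \<open>K\<close>, which comes
  from bounding the identity \<open>S 0\<close>, matches the other terms of the series.\<close>

lemma chain_approx_0:
  assumes t: "t \<in> {0..T}"
  shows "norm (chain_approx W 0 t) \<le> K * D 0"
proof (cases "idx 0 t = 0")
  case True
  then show ?thesis
    using t K_nonneg D_nonneg by (simp add: chain_approx_def pt_0 W_0 linear_0[OF S_linear])
next
  case False
  then have i: "idx 0 t = 1" using idx_bounds(1)[OF t, of 0] by simp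
  have tT: "t = T" "pt 0 1 = T" "pt 0 (Suc 0) = T"
    using pt_idx_le[OF t, of 0] i t pt_T[of 0] by auto
  have "W T = chain_incr W 0 0"
    using T_pos by (simp add: chain_incr_def tT pt_0 W_0 linear_0[OF S_linear])
  then have "norm (S 0 (W T)) \<le> K * norm (chain_incr W 0 0)" using S_bound[of 0 "W T"] T_pos by simp
  also have "\<dots> \<le> K * D 0" using K_nonneg by (intro mult_left_mono D) auto
  finally show ?thesis using i[unfolded tT(1)] by (simp add: chain_approx_def tT)
qed

definition chain_lim :: "real \<Rightarrow> 'a" where "chain_lim t = lim (\<lambda>n. chain_approx W n t)"

lemma summable_KD: "summable (\<lambda>n. K * D n)"
  by (intro summable_mult D_summable)

lemma summable_KD_Suc: "summable (\<lambda>n. K * D (Suc n))"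
  using summable_ignore_initial_segment[OF summable_KD, of 1] by simp

lemma chain_approx_tendsto:
  "t \<in> {0..T} \<Longrightarrow> (\<lambda>n. chain_approx W n t) \<longlonglongrightarrow> chain_lim t"
  unfolding chain_lim_def by (rule telescoping_lim(1)[OF chain_approx_Suc summable_KD_Suc])

lemma norm_chain_lim_diff:
  "t \<in> {0..T} \<Longrightarrow> norm (chain_lim t - chain_approx W n t) \<le> (\<Sum>j. K * D (j + Suc n))"
  unfolding chain_lim_def
  using telescoping_lim(2)[of "\<lambda>n. chain_approx W n t", OF chain_approx_Suc summable_KD_Suc, of n] by simp

lemma norm_chain_lim:
  assumes t: "t \<in> {0..T}"
  shows "norm (chain_lim t) \<le> K * (\<Sum>n. D n)"
proof -
  have "norm (chain_lim t) \<le> norm (chain_approx W 0 t) + norm (chain_lim t - chain_approx W 0 t)"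
    by (metis norm_triangle_sub add.commute)
  also have "\<dots> \<le> K * D 0 + (\<Sum>j. K * D (Suc j))"
    using chain_approx_0[OF t] norm_chain_lim_diff[OF t, of 0] by simp
  also have "\<dots> = K * (\<Sum>n. D n)"
    using suminf_split_head[OF summable_KD] suminf_mult[OF D_summable] by simp
  finally show ?thesis .
qed

lemma chain_approx_pt: "j \<le> 2 ^ m \<Longrightarrow> m \<le> n \<Longrightarrow> chain_approx W n (pt m j) = W (pt m j)"
  by (simp add: chain_approx_def idx_pt S_0)

text \<open>A dyadic point is its own predecessor on all finer levels, so the sequence is eventually
  constant there.\<close>

lemma chain_lim_pt:
  assumes "j \<le> 2 ^ m"
  shows "chain_lim (pt m j) = W (pt m j)"
proof (rule LIMSEQ_unique[OF chain_approx_tendsto[OF pt_range[OF assms]]])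
  show "(\<lambda>n. chain_approx W n (pt m j)) \<longlonglongrightarrow> W (pt m j)"
    by (rule tendsto_eventually, rule eventually_sequentiallyI[of m])
      (simp add: chain_approx_pt assms)
qed

text \<open>On each closed dyadic interval the limit is close to one orbit of \<open>S\<close>; at the right end point
  the distance is the size of an increment, so that the limit has no jumps.\<close>

lemma continuous_on_chain_lim: "continuous_on {0..T} chain_lim"
proof (rule continuous_on_piecewise_approx)
  fix \<epsilon> :: real assume \<epsilon>: "0 < \<epsilon>"
  have "(\<lambda>n. (\<Sum>j. K * D (j + n)) + D n) \<longlonglongrightarrow> 0 + 0"
    by (intro tendsto_add suminf_exist_split2 summable_KD summable_LIMSEQ_zero D_summable)
  then have "eventually (\<lambda>n. (\<Sum>j. K * D (j + n)) + D n < \<epsilon>) sequentially"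
    using \<epsilon> by (intro order_tendstoD(2)[where y = 0]) simp_all
  then obtain n where n0: "\<And>m. n \<le> m \<Longrightarrow> (\<Sum>j. K * D (j + m)) + D m < \<epsilon>"
    by (auto simp: eventually_sequentially)
  have n: "(\<Sum>j. K * D (j + Suc n)) \<le> \<epsilon>" "D n \<le> \<epsilon>"
  proof -
    have "0 \<le> (\<Sum>j. K * D (j + n))"
      using K_nonneg D_nonneg by (intro suminf_nonneg summable_ignore_initial_segment summable_KD) simp
    then show "D n \<le> \<epsilon>" using n0[of n] by linarith
    show "(\<Sum>j. K * D (j + Suc n)) \<le> \<epsilon>" using n0[of "Suc n"] D_nonneg[of "Suc n"] by linarith
  qed
  show "\<exists>(N::nat) I h. {0..T} \<subseteq> (\<Union>k<N. I k) \<and>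
    (\<forall>k<N. closed (I k) \<and> continuous_on (I k \<inter> {0..T}) (h k) \<and>
      (\<forall>t\<in>I k \<inter> {0..T}. dist (chain_lim t) (h k t) \<le> \<epsilon>))"
  proof (intro exI conjI allI impI ballI)
    let ?I = "\<lambda>k. {pt n k..pt n (Suc k)}"
    let ?h = "\<lambda>k t. S (t - pt n k) (W (pt n k))"
    show "{0..T} \<subseteq> (\<Union>k<2 ^ n. ?I k)"
    proof
      fix t assume t: "t \<in> {0..T}"
      show "t \<in> (\<Union>k<2 ^ n. ?I k)"
      proof (cases "idx n t < 2 ^ n")
        case True
        have "\<tau> (\<sigma> t) \<le> pt n (Suc (idx n t))"
          unfolding pt_def using idx_bounds[OF t, of n] \<sigma>_range[OF t] True
          by (intro \<tau>_mono) (auto simp: divide_le_eq add.commute simp flip: of_nat_Suc)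
        then show ?thesis using True pt_idx_le[OF t, of n] by (auto simp: \<tau>_\<sigma>[OF t])
      next
        case False
        then have "idx n t = 2 ^ n" using idx_bounds[OF t, of n] by simp
        then have "t = T" using pt_idx_le[OF t, of n] t by (simp add: pt_T)
        moreover have "T \<in> ?I (2 ^ n - 1)"
          using pt_range[of "2 ^ n - 1" n] by (simp add: pt_T)
        ultimately show ?thesis by (intro UN_I[of "2 ^ n - 1"]) auto
      qed
    qed
    fix k :: nat assume k: "k < 2 ^ n"
    have r: "pt n k \<in> {0..T}" "pt n (Suc k) \<in> {0..T}" using k by (intro pt_range; simp)+
    show "closed (?I k)" by simp
    show "continuous_on (?I k \<inter> {0..T}) (?h k)"
      by (rule continuous_on_compose2[OF S_continuous]) (use r in \<open>auto intro!: continuous_intros\<close>)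
    fix t assume t: "t \<in> ?I k \<inter> {0..T}"
    show "dist (chain_lim t) (?h k t) \<le> \<epsilon>"
    proof (cases "t = pt n (Suc k)")
      case True
      then have "chain_lim t - ?h k t = chain_incr W n k"
        using k chain_lim_pt[of "Suc k" n] by (simp add: chain_incr_def)
      then show ?thesis using D[OF k] n by (simp add: dist_norm)
    next
      case False
      have "idx n t = k"
      proof (rule idx_eqI)
        show "real k / 2 ^ n \<le> \<sigma> t"
          using \<sigma>_mono[of "pt n k" t] t r k by (simp add: \<sigma>_pt)
        have "pt n (Suc k) \<le> \<tau> (\<sigma> t)" if "(real k + 1) / 2 ^ n \<le> \<sigma> t"
          unfolding pt_def using that \<sigma>_range[of t] t by (intro \<tau>_mono) (auto simp: add.commute)
        then show "\<sigma> t < (real k + 1) / 2 ^ n" using False t \<tau>_\<sigma>[of t] by force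
      qed
      then have "chain_approx W n t = ?h k t" by (simp add: chain_approx_def)
      then show ?thesis using norm_chain_lim_diff[of t n] t n by (simp add: dist_norm)
    qed
  qed
qed

end

text \<open>The dyadic points are dense. This carries the estimate over to a continuous version of
  which only the values at these points are known.\<close>

lemma norm_le_on_pt_imp_norm_le:
  assumes cont: "continuous_on {0..T} V" and t: "t \<in> {0..T}"
    and le: "\<And>n k. k \<le> 2 ^ n \<Longrightarrow> norm (V (pt n k)) \<le> B"
  shows "norm (V t :: 'a) \<le> B"
proof (rule LIMSEQ_le_const2)
  show "(\<lambda>n. norm (V (pt n (idx n t)))) \<longlonglongrightarrow> norm (V t)"
    by (intro tendsto_norm continuous_on_tendsto_compose[OF cont pt_idx_tendsto[OF t] t])
      (simp add: pt_idx_range[OF t, simplified])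
  show "\<exists>N. \<forall>n\<ge>N. norm (V (pt n (idx n t))) \<le> B" using le idx_bounds(1)[OF t] by blast
qed

end

section \<open>Moments and convergence in probability\<close>

lemma enn_powr_ennreal: "0 \<le> x \<Longrightarrow> enn_powr (ennreal x) a = ennreal (x powr a)"
  by (simp add: enn_powr_def)

lemma enn_powr_top [simp]: "enn_powr top a = top"
  by (simp add: enn_powr_def)

lemma enn_powr_mono: "0 \<le> a \<Longrightarrow> x \<le> y \<Longrightarrow> enn_powr x a \<le> enn_powr y a"
  by (cases x; cases y) (auto simp: enn_powr_ennreal powr_mono2 top_unique)

lemma enn_powr_enn_powr: "enn_powr (enn_powr x a) b = enn_powr x (a * b)"
  by (cases x) (auto simp: enn_powr_ennreal powr_powr)

lemma enn_powr_2: "enn_powr x 2 = x\<^sup>2"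
  by (cases x) (auto simp: enn_powr_ennreal ennreal_power powr_numeral power2_eq_square[of top])

lemma enn_powr_1: "enn_powr x 1 = x"
  by (cases x) (auto simp: enn_powr_ennreal)

lemma enn_powr_le_iff:
  assumes "0 < q" "0 \<le> c"
  shows "enn_powr x (1 / q) \<le> ennreal c \<longleftrightarrow> x \<le> ennreal (c powr q)"
proof
  assume "enn_powr x (1 / q) \<le> ennreal c"
  then have "enn_powr (enn_powr x (1 / q)) q \<le> enn_powr (ennreal c) q"
    using assms by (intro enn_powr_mono) auto
  then show "x \<le> ennreal (c powr q)"
    using assms by (simp add: enn_powr_enn_powr enn_powr_1 enn_powr_ennreal)
next
  assume "x \<le> ennreal (c powr q)"
  then have "enn_powr x (1 / q) \<le> enn_powr (ennreal (c powr q)) (1 / q)"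
    using assms by (intro enn_powr_mono) auto
  then show "enn_powr x (1 / q) \<le> ennreal c"
    using assms by (simp add: enn_powr_ennreal powr_powr)
qed

lemma measurable_enn_powr [measurable (raw)]:
  assumes [measurable]: "f \<in> borel_measurable M"
  shows "(\<lambda>x. enn_powr (f x) a) \<in> borel_measurable M"
  unfolding enn_powr_def by measurable

lemma Lp_norm_le_iff:
  assumes "0 < q" "0 \<le> c"
  shows "Lp_norm M q f \<le> ennreal c \<longleftrightarrow> (\<integral>\<^sup>+w. enn_powr (f w) q \<partial>M) \<le> ennreal (c powr q)"
  unfolding Lp_norm_def by (rule enn_powr_le_iff[OF assms])

lemma L2_time_norm_power2:
  "(L2_time_norm J f)\<^sup>2 = (\<integral>\<^sup>+s\<in>J. (ennreal (norm (f s)))\<^sup>2 \<partial>lborel)"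
  by (simp add: L2_time_norm_def enn_powr_enn_powr enn_powr_1 flip: enn_powr_2)

section \<open>Inequalities between moments\<close>

lemma convex_on_powr_nonneg:
  assumes p: "1 \<le> p"
  shows "convex_on {0..} (\<lambda>x. x powr p)"
proof (rule convex_onI)
  fix t x y :: real assume t: "0 < t" "t < 1" and xy: "x \<in> {0..}" "y \<in> {0..}"
  \<comment> \<open>When one of the two points is 0, convexity reduces to this scaling
    inequality.\<close>
  have scale: "(a * z) powr p \<le> a * z powr p" if "0 < a" "a < 1" "0 \<le> z" for a z :: real
  proof -
    have "a powr p \<le> a powr 1" using p that by (intro powr_mono') auto
    then show ?thesis using that by (simp add: powr_mult mult_right_mono)
  qed
  consider "x = 0" | "y = 0" | "0 < x" "0 < y" using xy by force
  then show "((1 - t) *\<^sub>R x + t *\<^sub>R y) powr p \<le> (1 - t) * x powr p + t * y powr p"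
  proof cases
    case 3
    then show ?thesis using powr_convex[OF p] t by (intro convex_onD) auto
  qed (use p t xy scale[of t y] scale[of "1 - t" x] in auto)
qed simp

text \<open>Monotonicity of L^p norms on a probability space, by integrating a pointwise Young
  inequality X^p \<le> A * X^q + B. The coefficients are chosen such that A * K^q + B is exactly
  K^p.\<close>

lemma nn_integral_powr_le_mono:
  assumes M: "prob_space M" and [measurable]: "X \<in> borel_measurable M"
    and X: "\<And>w. w \<in> space M \<Longrightarrow> 0 \<le> X w" and pq: "0 < p" "p \<le> q" and K: "0 < K"
    and le: "(\<integral>\<^sup>+w. ennreal (X w powr q) \<partial>M) \<le> ennreal (K powr q)"
  shows "(\<integral>\<^sup>+w. ennreal (X w powr p) \<partial>M) \<le> ennreal (K powr p)"
proof -
  interpret prob_space M by fact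
  define A where "A = p / q * K powr (p - q)"
  define B where "B = (1 - p / q) * K powr p"
  have AB: "0 \<le> A" "0 \<le> B" using pq by (auto simp: A_def B_def)
  have *: "X w powr p \<le> A * X w powr q + B" if "w \<in> space M" for w
  proof (cases "X w = 0")
    case False
    then have x: "0 < X w" using X[OF that] by simp
    have "(X w powr q * K powr (p - q)) powr (p / q) * (K powr p) powr (1 - p / q)
        \<le> p / q * (X w powr q * K powr (p - q)) + (1 - p / q) * K powr p"
      using pq x K by (intro Youngs_inequality_0) auto
    moreover have "(X w powr q * K powr (p - q)) powr (p / q) * (K powr p) powr (1 - p / q)
        = X w powr p * K powr ((p - q) * (p / q) + p * (1 - p / q))"
      using pq x K by (simp add: powr_mult powr_powr powr_add)
    moreover have "(p - q) * (p / q) + p * (1 - p / q) = 0" using pq by (simp add: field_simps)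
    ultimately show ?thesis using K by (simp add: A_def B_def mult_ac)
  qed (use AB in simp)
  have "(\<integral>\<^sup>+w. ennreal (X w powr p) \<partial>M) \<le> (\<integral>\<^sup>+w. ennreal A * ennreal (X w powr q) + ennreal B \<partial>M)"
    using * AB by (intro nn_integral_mono) (simp flip: ennreal_mult ennreal_plus)
  also have "\<dots> = ennreal A * (\<integral>\<^sup>+w. ennreal (X w powr q) \<partial>M) + ennreal B"
    by (subst nn_integral_add) (simp_all add: nn_integral_cmult emeasure_space_1)
  also have "\<dots> \<le> ennreal A * ennreal (K powr q) + ennreal B"
    by (intro add_right_mono mult_left_mono le) auto
  also have "\<dots> = ennreal (A * K powr q + B)" using AB by (simp flip: ennreal_mult ennreal_plus)
  also have "A * K powr q + B = K powr p"
    using K by (simp add: A_def B_def algebra_simps flip: powr_add)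
  finally show ?thesis .
qed

text \<open>Minkowski's inequality follows from Jensen's, with weights proportional to the bounds.\<close>

lemma nn_integral_powr_suminf_le:
  fixes X :: "nat \<Rightarrow> 'w \<Rightarrow> real"
  assumes M: "prob_space M" and [measurable]: "\<And>n. X n \<in> borel_measurable M"
    and X: "\<And>n w. w \<in> space M \<Longrightarrow> 0 \<le> X n w"
    and q: "1 \<le> q" and L: "0 < L" and c: "\<And>n. 0 < c n" "summable c"
    and le: "\<And>n. (\<integral>\<^sup>+w. ennreal (X n w powr q) \<partial>M) \<le> ennreal ((L * c n) powr q)"
  shows "AE w in M. summable (\<lambda>n. X n w)"
    and "(\<integral>\<^sup>+w. ennreal ((\<Sum>n. X n w) powr q) \<partial>M) \<le> ennreal ((L * (\<Sum>n. c n)) powr q)"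
proof -
  interpret prob_space M by fact
  have c0: "0 \<le> c n" for n using c(1)[of n] by simp
  have "(\<integral>\<^sup>+w. (\<Sum>n. ennreal (X n w)) \<partial>M) = (\<Sum>n. \<integral>\<^sup>+w. ennreal (X n w) \<partial>M)"
    by (rule nn_integral_suminf) measurable
  \<comment> \<open>Passing from exponent q to exponent 1 bounds each first moment by L * c n; the
    series then has finite expectation and converges almost surely.\<close>
  also have "\<dots> \<le> (\<Sum>n. ennreal (L * c n))"
  proof (intro suminf_le summableI)
    fix n
    have "(\<integral>\<^sup>+w. ennreal (X n w powr 1) \<partial>M) \<le> ennreal ((L * c n) powr 1)"
      using q L c by (intro nn_integral_powr_le_mono[OF M _ X _ _ _ le]) auto
    then show "(\<integral>\<^sup>+w. ennreal (X n w) \<partial>M) \<le> ennreal (L * c n)"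
      using L c0 X by (simp cong: nn_integral_cong_simp)
  qed
  also have "\<dots> = ennreal (\<Sum>n. L * c n)"
    using L c0 by (intro suminf_ennreal2 summable_mult c) auto
  finally have "(\<integral>\<^sup>+w. (\<Sum>n. ennreal (X n w)) \<partial>M) < \<infinity>"
    by (rule order.strict_trans1) simp
  then have "AE w in M. (\<Sum>n. ennreal (X n w)) \<noteq> \<infinity>"
    by (intro nn_integral_PInf_AE) auto
  then show AEs: "AE w in M. summable (\<lambda>n. X n w)"
    by (rule AE_mp, intro AE_I2 impI) (auto intro: summable_suminf_not_top X)
  define C where "C N = (\<Sum>n<N. c n)" for N
  have fin: "(\<integral>\<^sup>+w. ennreal ((\<Sum>n<N. X n w) powr q) \<partial>M) \<le> ennreal ((L * (\<Sum>n. c n)) powr q)"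
    if N: "0 < N" for N
  proof -
    \<comment> \<open>These coefficients arise from Jensen's inequality for the points
      \<open>X n w / c n\<close> with weights \<open>c n / C N\<close>, multiplied through by
      \<open>C N powr q\<close>.\<close>
    define a where "a n = C N powr q * (c n / C N) * c n powr - q" for n
    have C: "0 < C N" unfolding C_def using c N by (intro sum_pos) auto
    have a: "0 \<le> a n" for n using c0 C by (simp add: a_def)
    have "(\<Sum>n<N. X n w) powr q \<le> (\<Sum>n<N. a n * X n w powr q)" if w: "w \<in> space M" for w
    proof -
      have "(\<Sum>n<N. (c n / C N) *\<^sub>R (X n w / c n)) powr q
        \<le> (\<Sum>n<N. (c n / C N) * (X n w / c n) powr q)"
      proof (rule convex_on_sum[OF _ _ convex_on_powr_nonneg[OF q]])
        show "(\<Sum>n<N. c n / C N) = 1" using C by (simp add: C_def flip: sum_divide_distrib)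
      qed (use N c0 C X[OF w] in auto)
      also have "(\<Sum>n<N. (c n / C N) *\<^sub>R (X n w / c n)) = (\<Sum>n<N. X n w) / C N"
        using c by (simp add: sum_divide_distrib less_imp_neq[symmetric])
      finally have "C N powr q * ((\<Sum>n<N. X n w) / C N) powr q
        \<le> C N powr q * (\<Sum>n<N. (c n / C N) * (X n w / c n) powr q)"
        by (intro mult_left_mono) auto
      moreover have "C N powr q * ((\<Sum>n<N. X n w) / C N) powr q = (\<Sum>n<N. X n w) powr q"
        using C X[OF w] by (simp add: powr_divide sum_nonneg)
      moreover have "C N powr q * (\<Sum>n<N. (c n / C N) * (X n w / c n) powr q)
        = (\<Sum>n<N. a n * X n w powr q)"
        unfolding sum_distrib_left using c0 X[OF w]
        by (intro sum.cong refl) (simp add: a_def powr_divide powr_minus_divide)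
      ultimately show ?thesis by simp
    qed
    then have "(\<integral>\<^sup>+w. ennreal ((\<Sum>n<N. X n w) powr q) \<partial>M)
      \<le> (\<integral>\<^sup>+w. ennreal (\<Sum>n<N. a n * X n w powr q) \<partial>M)"
      by (intro nn_integral_mono ennreal_leI)
    also have "\<dots> = (\<Sum>n<N. \<integral>\<^sup>+w. ennreal (a n) * ennreal (X n w powr q) \<partial>M)"
    proof (subst nn_integral_sum[symmetric])
      have "(\<Sum>n<N. ennreal (a n) * ennreal (X n w powr q)) = (\<Sum>n<N. ennreal (a n * X n w powr q))" for w
        using a by (intro sum.cong refl ennreal_mult[symmetric]) auto
      moreover have "(\<Sum>n<N. ennreal (a n * X n w powr q)) = ennreal (\<Sum>n<N. a n * X n w powr q)" for w
        using a by (intro sum_ennreal) auto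
      ultimately show "(\<integral>\<^sup>+w. ennreal (\<Sum>n<N. a n * X n w powr q) \<partial>M)
        = (\<integral>\<^sup>+w. (\<Sum>n<N. ennreal (a n) * ennreal (X n w powr q)) \<partial>M)"
        by simp
    qed measurable
    also have "\<dots> = (\<Sum>n<N. ennreal (a n) * (\<integral>\<^sup>+w. ennreal (X n w powr q) \<partial>M))"
      by (intro sum.cong nn_integral_cmult) auto
    also have "\<dots> \<le> (\<Sum>n<N. ennreal (a n) * ennreal ((L * c n) powr q))"
      by (intro sum_mono mult_left_mono le) auto
    also have "\<dots> = (\<Sum>n<N. ennreal ((C N * L) powr q * (c n / C N)))"
    proof (rule sum.cong[OF refl])
      fix n
      have "a n * (L * c n) powr q = (C N * L) powr q * (c n / C N)"
        using C L c(1)[of n] by (simp add: a_def powr_mult powr_minus_divide)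
      then show "ennreal (a n) * ennreal ((L * c n) powr q)
          = ennreal ((C N * L) powr q * (c n / C N))"
        using a by (subst ennreal_mult[symmetric]) auto
    qed
    also have "\<dots> = ennreal (\<Sum>n<N. (C N * L) powr q * (c n / C N))"
      using C c0 by (intro sum_ennreal) simp
    also have "(\<Sum>n<N. (C N * L) powr q * (c n / C N)) = (C N * L) powr q"
      using C by (simp add: C_def flip: sum_distrib_left sum_divide_distrib)
    also have "\<dots> \<le> (L * (\<Sum>n. c n)) powr q"
      using C L q c0 sum_le_suminf[OF c(2), of "{..<N}"]
      by (intro powr_mono2) (auto simp: C_def mult.commute)
    finally show ?thesis using ennreal_leI by simp
  qed
  \<comment> \<open>Fatou's lemma passes to the whole series. The partial sums start with one term
    because the weights are undefined for the empty sum.\<close>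
  have "(\<integral>\<^sup>+w. ennreal ((\<Sum>n. X n w) powr q) \<partial>M)
      = (\<integral>\<^sup>+w. liminf (\<lambda>N. ennreal ((\<Sum>n<Suc N. X n w) powr q)) \<partial>M)"
  proof (rule nn_integral_cong_AE, rule AE_mp[OF AEs], intro AE_I2 impI)
    fix w assume s: "summable (\<lambda>n. X n w)" and w: "w \<in> space M"
    have "(\<lambda>N. (\<Sum>n<Suc N. X n w) powr q) \<longlonglongrightarrow> (\<Sum>n. X n w) powr q"
    proof (rule tendsto_powr2)
      show "(\<lambda>N. \<Sum>n<Suc N. X n w) \<longlonglongrightarrow> (\<Sum>n. X n w)"
        by (rule LIMSEQ_Suc[OF summable_LIMSEQ[OF s]])
      show "\<forall>\<^sub>F N in sequentially. 0 \<le> (\<Sum>n<Suc N. X n w)"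
        using X[OF w] by (intro always_eventually allI sum_nonneg) auto
    qed (use q in auto)
    then have "(\<lambda>N. ennreal ((\<Sum>n<Suc N. X n w) powr q)) \<longlonglongrightarrow> ennreal ((\<Sum>n. X n w) powr q)"
      by (rule tendsto_ennrealI)
    then show "ennreal ((\<Sum>n. X n w) powr q) = liminf (\<lambda>N. ennreal ((\<Sum>n<Suc N. X n w) powr q))"
      by (rule lim_imp_Liminf[OF sequentially_bot, symmetric])
  qed
  also have "\<dots> \<le> liminf (\<lambda>N. \<integral>\<^sup>+w. ennreal ((\<Sum>n<Suc N. X n w) powr q) \<partial>M)"
    by (rule nn_integral_liminf) measurable
  also have "\<dots> \<le> liminf (\<lambda>N. ennreal ((L * (\<Sum>n. c n)) powr q))"
    by (intro Liminf_mono always_eventually allI fin zero_less_Suc)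
  finally show "(\<integral>\<^sup>+w. ennreal ((\<Sum>n. X n w) powr q) \<partial>M) \<le> ennreal ((L * (\<Sum>n. c n)) powr q)"
    by (simp add: Liminf_const)
qed

text \<open>The essential supremum exceeds y exactly when the section of {f > y} has positive
  measure, and the measure of a section depends measurably on the parameter.\<close>

lemma borel_measurable_esssup_section:
  fixes f :: "'s \<times> 'w \<Rightarrow> ennreal"
  assumes "sigma_finite_measure M" and [measurable]: "f \<in> borel_measurable (N \<Otimes>\<^sub>M M)"
  shows "(\<lambda>s. esssup M (\<lambda>w. f (s, w))) \<in> borel_measurable N"
proof (rule borel_measurableI_greater)
  interpret sigma_finite_measure M by fact
  fix y
  let ?A = "{z \<in> space (N \<Otimes>\<^sub>M M). y < f z}"
  have "y < esssup M (\<lambda>w. f (s, w)) \<longleftrightarrow> emeasure M (Pair s -` ?A) \<noteq> 0" if s: "s \<in> space N" for s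
  proof -
    have [measurable]: "(\<lambda>w. f (s, w)) \<in> borel_measurable M"
      using s by measurable
    have e: "Pair s -` ?A = {w \<in> space M. y < f (s, w)}"
      using s by (auto simp: space_pair_measure)
    have [measurable]: "{w \<in> space M. y < f (s, w)} \<in> sets M" by measurable
    have z: "emeasure M (Pair s -` ?A) = 0 \<longleftrightarrow> (AE w in M. f (s, w) \<le> y)"
      unfolding e by (subst AE_iff_measurable[OF _ refl]) (auto simp: not_le)
    show ?thesis
    proof
      assume "y < esssup M (\<lambda>w. f (s, w))"
      then show "emeasure M (Pair s -` ?A) \<noteq> 0"
        unfolding z using esssup_I[of "\<lambda>w. f (s, w)" M y] by force
    next
      assume ne: "emeasure M (Pair s -` ?A) \<noteq> 0"
      show "y < esssup M (\<lambda>w. f (s, w))"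
      proof (rule ccontr)
        assume "\<not> ?thesis"
        then have "AE w in M. f (s, w) \<le> y"
          using esssup_AE[of "\<lambda>w. f (s, w)" M] by (auto elim!: eventually_mono)
        then show False using ne z by simp
      qed
    qed
  qed
  then have "{s \<in> space N. y < esssup M (\<lambda>w. f (s, w))} = {s \<in> space N. emeasure M (Pair s -` ?A) \<noteq> 0}"
    by auto
  also have "\<dots> \<in> sets N"
    using measurable_emeasure_Pair[of ?A N] by measurable
  finally show "{s \<in> space N. y < esssup M (\<lambda>w. f (s, w))} \<in> sets N" .
qed

text \<open>For fixed s the inequality holds off a null set that depends on s; Fubini's theorem
  exchanges the two quantifiers.\<close>

lemma AE_le_esssup_section:
  fixes f :: "'s \<times> 'w \<Rightarrow> ennreal"
  assumes "sigma_finite_measure M" "sigma_finite_measure N"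
    and [measurable]: "f \<in> borel_measurable (N \<Otimes>\<^sub>M M)"
  shows "AE w in M. AE s in N. f (s, w) \<le> esssup M (\<lambda>w. f (s, w))"
proof -
  interpret pair_sigma_finite N M using assms by (simp add: pair_sigma_finite_def)
  have [measurable]: "(\<lambda>s. esssup M (\<lambda>w. f (s, w))) \<in> borel_measurable N"
    using assms by (intro borel_measurable_esssup_section)
  have "AE s in N. AE w in M. f (s, w) \<le> esssup M (\<lambda>w. f (s, w))"
    by (intro AE_I2 esssup_AE)
  then show ?thesis by (subst (asm) AE_commute) measurable
qed

section \<open>Criteria for convergence in probability\<close>

lemma tendsto_0_le_ennreal:
  fixes f g :: "nat \<Rightarrow> ennreal"
  assumes "\<And>n. f n \<le> g n" "g \<longlonglongrightarrow> 0"
  shows "f \<longlonglongrightarrow> 0"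
  by (rule tendsto_sandwich[OF _ _ tendsto_const assms(2)]) (simp_all add: assms(1))

context
  fixes M :: "'w measure"
  assumes M: "prob_space M"
begin

interpretation prob_space M by (rule M)

lemma tendsto_0_in_prob_AE_mono:
  assumes le: "\<And>n. AE w in M. f n w \<le> ennreal c * (g n w + h n w)"
    and [measurable]: "\<And>n. g n \<in> borel_measurable M" "\<And>n. h n \<in> borel_measurable M"
    and g: "tendsto_0_in_prob M g" and h: "tendsto_0_in_prob M h"
  shows "tendsto_0_in_prob M f"
  unfolding tendsto_0_in_prob_def
proof (intro allI impI)
  fix \<epsilon> :: ennreal assume \<epsilon>: "0 < \<epsilon>"
  show "(\<lambda>n. emeasure M {w \<in> space M. \<epsilon> < f n w}) \<longlonglongrightarrow> 0"
  proof (cases \<epsilon>)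
    case (real e)
    then have e: "0 < e" using \<epsilon> by (auto simp: zero_less_iff_neq_zero)
    \<comment> \<open>With this threshold, \<open>f n w > \<epsilon>\<close> forces one of
      \<open>g n w\<close>, \<open>h n w\<close> above d.\<close>
    define d where "d = e / (2 * max c 1)"
    have d: "0 < d" using e by (simp add: d_def)
    let ?A = "\<lambda>f n. {w \<in> space M. ennreal d < f n w}"
    have *: "AE w in M. w \<in> {w \<in> space M. \<epsilon> < f n w} \<longrightarrow>
        w \<in> ?A g n \<union> ?A h n" for n
      using le[of n]
    proof (eventually_elim, intro impI)
      fix w assume 1: "f n w \<le> ennreal c * (g n w + h n w)" and 2: "w \<in> {w \<in> space M. \<epsilon> < f n w}"
      have False if "g n w \<le> ennreal d" "h n w \<le> ennreal d"
      proof -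
        have "f n w \<le> ennreal (max c 1) * (ennreal d + ennreal d)"
          by (rule order_trans[OF 1]) (intro mult_mono add_mono that ennreal_leI; simp)
        also have "\<dots> = ennreal (max c 1 * (d + d))"
          using d by (simp add: ennreal_mult ennreal_plus del: mult_2 mult_2_right flip: ennreal_plus)
        also have "max c 1 * (d + d) = e" by (simp add: d_def field_simps)
        finally have "f n w \<le> \<epsilon>" by (simp add: real)
        then show False using 2 by (auto dest: leD)
      qed
      then show "w \<in> ?A g n \<union> ?A h n"
        using 2 by force
    qed
    have **: "emeasure M {w \<in> space M. \<epsilon> < f n w} \<le>
      emeasure M (?A g n) + emeasure M (?A h n)" for n
      by (rule order_trans[OF emeasure_mono_AE[OF *[of n]]])
        (measurable, intro emeasure_subadditive, measurable)
    have "(\<lambda>n. emeasure M (?A g n) + emeasure M (?A h n)) \<longlonglongrightarrow> 0 + 0"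
      using g h d unfolding tendsto_0_in_prob_def by (intro tendsto_add) auto
    then show ?thesis using tendsto_0_le_ennreal[OF **] by simp
  qed simp
qed

lemma tendsto_0_in_prob_AE:
  assumes [measurable]: "\<And>n. r n \<in> borel_measurable M"
    and AE: "AE w in M. (\<lambda>n. r n w) \<longlonglongrightarrow> 0"
  shows "tendsto_0_in_prob M r"
  unfolding tendsto_0_in_prob_def
proof (intro allI impI)
  fix \<epsilon> :: ennreal assume \<epsilon>: "0 < \<epsilon>"
  have "(\<lambda>n. \<integral>\<^sup>+w. indicator {w \<in> space M. \<epsilon> < r n w} w \<partial>M) \<longlonglongrightarrow> (\<integral>\<^sup>+w. 0 \<partial>M)"
  proof (rule nn_integral_dominated_convergence[where w = "\<lambda>_. 1"])
    show "AE w in M. (\<lambda>n. indicator {w \<in> space M. \<epsilon> < r n w} w :: ennreal) \<longlonglongrightarrow> 0"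
      using AE
    proof eventually_elim
      fix w assume "(\<lambda>n. r n w) \<longlonglongrightarrow> 0"
      then have "eventually (\<lambda>n. r n w < \<epsilon>) sequentially" using \<epsilon> by (rule order_tendstoD)
      then have "eventually (\<lambda>n. indicator {w \<in> space M. \<epsilon> < r n w} w = (0::ennreal)) sequentially"
        by eventually_elim (auto simp: indicator_def)
      then show "(\<lambda>n. indicator {w \<in> space M. \<epsilon> < r n w} w :: ennreal) \<longlonglongrightarrow> 0"
        by (rule tendsto_eventually)
    qed
  qed (auto simp: indicator_def emeasure_space_1)
  then show "(\<lambda>n. emeasure M {w \<in> space M. \<epsilon> < r n w}) \<longlonglongrightarrow> 0" by simp
qed

text \<open>Chebyshev's inequality for second moments.\<close>

lemma tendsto_0_in_prob_L2:
  assumes [measurable]: "\<And>n. f n \<in> borel_measurable M"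
    and lim: "(\<lambda>n. \<integral>\<^sup>+w. (f n w)\<^sup>2 \<partial>M) \<longlonglongrightarrow> 0"
  shows "tendsto_0_in_prob M f"
  unfolding tendsto_0_in_prob_def
proof (intro allI impI)
  fix \<epsilon> :: ennreal assume \<epsilon>: "0 < \<epsilon>"
  show "(\<lambda>n. emeasure M {w \<in> space M. \<epsilon> < f n w}) \<longlonglongrightarrow> 0"
  proof (cases \<epsilon>)
    case (real e)
    then have e: "0 < e" using \<epsilon> by (auto simp: zero_less_iff_neq_zero)
    have *: "emeasure M {w \<in> space M. \<epsilon> < f n w} \<le> ennreal (1 / e\<^sup>2) * (\<integral>\<^sup>+w. (f n w)\<^sup>2 \<partial>M)" for n
    proof -
      have "emeasure M {w \<in> space M. \<epsilon> < f n w} \<le> emeasure M {w \<in> space M. 1 \<le> ennreal (1 / e\<^sup>2) * (f n w)\<^sup>2}"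
      proof (rule emeasure_mono)
        show "{w \<in> space M. \<epsilon> < f n w} \<subseteq> {w \<in> space M. 1 \<le> ennreal (1 / e\<^sup>2) * (f n w)\<^sup>2}"
        proof safe
          fix w assume "\<epsilon> < f n w"
          then have "ennreal e ^ 2 \<le> (f n w)\<^sup>2" using real by (intro power_mono) auto
          then have "ennreal (1 / e\<^sup>2) * ennreal (e\<^sup>2) \<le> ennreal (1 / e\<^sup>2) * (f n w)\<^sup>2"
            using e by (intro mult_left_mono) (auto simp: ennreal_power)
          then show "1 \<le> ennreal (1 / e\<^sup>2) * (f n w)\<^sup>2" using e by (simp flip: ennreal_mult)
        qed
      qed measurable
      also have "\<dots> \<le> ennreal (1 / e\<^sup>2) * (\<integral>\<^sup>+w. (f n w)\<^sup>2 * indicator (space M) w \<partial>M)"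
        by (rule nn_integral_Markov_inequality) auto
      also have "(\<integral>\<^sup>+w. (f n w)\<^sup>2 * indicator (space M) w \<partial>M) = (\<integral>\<^sup>+w. (f n w)\<^sup>2 \<partial>M)"
        by (intro nn_integral_cong) auto
      finally show ?thesis .
    qed
    have "(\<lambda>n. ennreal (1 / e\<^sup>2) * (\<integral>\<^sup>+w. (f n w)\<^sup>2 \<partial>M)) \<longlonglongrightarrow> ennreal (1 / e\<^sup>2) * 0"
      by (intro ennreal_tendsto_cmult lim) simp
    then show ?thesis using tendsto_0_le_ennreal[OF *] by simp
  qed simp
qed

end

section \<open>Stochastic integrals of elementary processes\<close>

lemma ennreal_power2_le_imp_le:
  assumes "x\<^sup>2 \<le> (y::ennreal)\<^sup>2" shows "x \<le> y"
  using enn_powr_mono[of "1/2" "enn_powr x 2" "enn_powr y 2"] assms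
  by (simp add: enn_powr_2[symmetric] enn_powr_enn_powr enn_powr_1)

lemma power2_add_le: "(a + b)\<^sup>2 \<le> 2 * (a\<^sup>2 + b\<^sup>2)" for a b :: real
  using sum_squares_bound[of a b] by (simp add: power2_sum)

lemma ennreal_norm_diff_power2_le:
  fixes x y :: "'h::real_normed_vector"
  shows "(ennreal (norm (x - y)))\<^sup>2 \<le> 2 * (ennreal (norm x))\<^sup>2 + 2 * (ennreal (norm y))\<^sup>2"
proof -
  have "(norm (x - y))\<^sup>2 \<le> (norm x + norm y)\<^sup>2" by (intro power_mono norm_triangle_ineq4) auto
  also have "\<dots> \<le> 2 * (norm x)\<^sup>2 + 2 * (norm y)\<^sup>2"
    using power2_add_le[of "norm x" "norm y"] by simp
  finally have "ennreal ((norm (x - y))\<^sup>2) \<le> ennreal (2 * (norm x)\<^sup>2 + 2 * (norm y)\<^sup>2)"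
    by (rule ennreal_leI)
  then show ?thesis by (simp add: ennreal_power ennreal_plus ennreal_mult)
qed

lemma SUP_eq_SUP_dense:
  fixes f :: "'a::metric_space \<Rightarrow> ennreal"
  assumes "D \<subseteq> S" "S \<subseteq> closure D" and f: "continuous_on S f"
  shows "(SUP x\<in>S. f x) = (SUP x\<in>D. f x)"
proof (rule antisym)
  show "(SUP x\<in>S. f x) \<le> (SUP x\<in>D. f x)"
  proof (rule SUP_least)
    fix x assume x: "x \<in> S"
    then have "x \<in> closure D" using assms(2) by blast
    then obtain d where d: "\<And>n. d n \<in> D" "d \<longlonglongrightarrow> x"
      unfolding closure_sequential by blast
    then have "(\<lambda>n. f (d n)) \<longlonglongrightarrow> f x"
      by (intro continuous_on_tendsto_compose[OF f d(2) x] always_eventually allI subsetD[OF assms(1) d(1)])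
    then show "f x \<le> (SUP x\<in>D. f x)"
      by (rule LIMSEQ_le_const2) (auto intro: SUP_upper d)
  qed
qed (rule SUP_subset_mono[OF assms(1)], simp)

lemma borel_measurable_complete_AE:
  fixes f :: "'a \<Rightarrow> ennreal"
  assumes "complete_measure M" and [measurable]: "f \<in> borel_measurable M"
    and AE: "AE x in M. f x = g x"
  shows "g \<in> borel_measurable M"
proof (rule borel_measurableI_greater)
  fix y
  show "{x \<in> space M. y < g x} \<in> sets M"
  proof (rule complete_measure.in_sets_AE[OF assms(1)])
    show "AE x in M. x \<in> {x \<in> space M. y < f x} \<longleftrightarrow> x \<in> {x \<in> space M. y < g x}"
      using AE by eventually_elim auto
  qed auto
qed

text \<open>On continuous paths the supremum over a countable dense set is the same; completeness of
  the measure absorbs the exceptional paths.\<close>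

lemma borel_measurable_SUP_continuous_AE:
  fixes X :: "real \<Rightarrow> 'w \<Rightarrow> 'h::{real_normed_vector, second_countable_topology}"
  assumes M: "complete_measure M" and X[measurable]: "\<And>s. s \<in> A \<Longrightarrow> X s \<in> borel_measurable M"
    and cont: "AE w in M. continuous_on A (\<lambda>s. X s w)"
  shows "(\<lambda>w. SUP s\<in>A. ennreal (norm (X s w))) \<in> borel_measurable M"
proof -
  obtain D where D: "countable D" "D \<subseteq> A" "A \<subseteq> closure D" using separable by blast
  have [measurable]: "X s \<in> borel_measurable M" if "s \<in> D" for s using X D that by auto
  show ?thesis
  proof (rule borel_measurable_complete_AE[OF M])
    show "(\<lambda>w. SUP s\<in>D. ennreal (norm (X s w))) \<in> borel_measurable M"
      using D(1) by (intro borel_measurable_SUP) auto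
    show "AE w in M. (SUP s\<in>D. ennreal (norm (X s w))) = (SUP s\<in>A. ennreal (norm (X s w)))"
      using cont
    proof eventually_elim
      fix w assume "continuous_on A (\<lambda>s. X s w)"
      then have "continuous_on A (\<lambda>s. ennreal (norm (X s w)))"
        by (intro continuous_on_ennreal continuous_on_norm)
      then show "(SUP s\<in>D. ennreal (norm (X s w))) = (SUP s\<in>A. ennreal (norm (X s w)))"
        by (rule SUP_eq_SUP_dense[OF D(2,3), symmetric])
    qed
  qed
qed

section \<open>Sums, linear images and stopping of elementary processes\<close>

lemma elementary_process_Nil [simp]: "elementary_process M F J []"
  by (simp add: elementary_process_def)

lemma elementary_process_Cons [simp]:
  "elementary_process M F J ((a, b, \<xi>) # es) \<longleftrightarrow>
    0 \<le> a \<and> a \<le> b \<and> b \<in> J \<and> \<xi> \<in> borel_measurable (F a) \<and> bounded (\<xi> ` space M) \<and>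
    elementary_process M F J es"
  by (simp add: elementary_process_def)

lemma elementary_fun_simps [simp]:
  "elementary_fun [] t w = 0"
  "elementary_fun ((a, b, \<xi>) # es) t w = indicat_real {a<..b} t *\<^sub>R \<xi> w + elementary_fun es t w"
  by (simp_all add: elementary_fun_def)

lemma elementary_integral_simps [simp]:
  "elementary_integral \<beta> [] t w = 0"
  "elementary_integral \<beta> ((a, b, \<xi>) # es) t w =
    (\<beta> (min b t) w - \<beta> (min a t) w) *\<^sub>R \<xi> w + elementary_integral \<beta> es t w"
  by (simp_all add: elementary_integral_def)

lemma elementary_induct [case_names Nil Cons]:
  assumes "P []" "\<And>a b \<xi> es. P es \<Longrightarrow> P ((a, b, \<xi>) # es)"
  shows "P es"
  using assms by (induction es) auto

lemma elementary_process_append: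
  "elementary_process M F J (es @ es') \<longleftrightarrow> elementary_process M F J es \<and> elementary_process M F J es'"
  by (simp add: elementary_process_def ball_Un)

lemma elementary_fun_append: "elementary_fun (es @ es') t w = elementary_fun es t w + elementary_fun es' t w"
  by (simp add: elementary_fun_def)

lemma elementary_integral_append:
  "elementary_integral \<beta> (es @ es') t w = elementary_integral \<beta> es t w + elementary_integral \<beta> es' t w"
  by (simp add: elementary_integral_def)

definition map_elementary :: "('h \<Rightarrow> 'k) \<Rightarrow> ('w, 'h) elementary \<Rightarrow> ('w, 'k) elementary" where
  "map_elementary L es = map (\<lambda>(a, b, \<xi>). (a, b, \<lambda>w. L (\<xi> w))) es"

lemma map_elementary_simps [simp]:
  "map_elementary L [] = []"
  "map_elementary L ((a, b, \<xi>) # es) = (a, b, \<lambda>w. L (\<xi> w)) # map_elementary L es"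
  by (simp_all add: map_elementary_def)

lemma elementary_process_map:
  fixes L :: "'h::{real_normed_vector, second_countable_topology} \<Rightarrow> 'k::{real_normed_vector, second_countable_topology}"
  assumes L: "bounded_linear L" and es: "elementary_process M F J es"
  shows "elementary_process M F J (map_elementary L es)"
  using es
proof (induction es rule: elementary_induct)
  case (Cons a b \<xi> es)
  have "bounded ((\<lambda>w. L (\<xi> w)) ` space M)"
    using bounded_linear_image[OF _ L, of "\<xi> ` space M"] Cons.prems by (simp add: image_image)
  moreover have "(\<lambda>w. L (\<xi> w)) \<in> borel_measurable (F a)"
    by (rule measurable_compose[where N = borel])
      (use Cons.prems in \<open>auto intro!: borel_measurable_continuous_onI linear_continuous_on L\<close>)
  ultimately show ?case using Cons by simp
qed simp

lemma elementary_fun_map: "linear L \<Longrightarrow> elementary_fun (map_elementary L es) t w = L (elementary_fun es t w)"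
  by (induction es rule: elementary_induct) (simp_all add: linear_0 linear_add linear_scale)

lemma elementary_integral_map:
  "linear L \<Longrightarrow> elementary_integral \<beta> (map_elementary L es) t w = L (elementary_integral \<beta> es t w)"
  by (induction es rule: elementary_induct) (simp_all add: linear_0 linear_add linear_scale)

lemma elementary_process_mono:
  "elementary_process M F J es \<Longrightarrow> J \<subseteq> J' \<Longrightarrow> elementary_process M F J' es"
  by (induction es rule: elementary_induct) auto

lemma elementary_fun_eq_0:
  "elementary_process M F {0..r} es \<Longrightarrow> r < t \<Longrightarrow> elementary_fun es t w = 0"
  by (induction es rule: elementary_induct) auto

text \<open>All intervals end by r, so both Brownian arguments of each term stop changing there. An
  approximation of an integral on [0, r] thereby serves on longer intervals too.\<close>

lemma elementary_integral_stopped: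
  "elementary_process M F {0..r} es \<Longrightarrow>
    elementary_integral \<beta> es (min t r) w = elementary_integral \<beta> es t w"
proof (induction es rule: elementary_induct)
  case (Cons a b \<xi> es)
  then have "min b (min t r) = min b t" "min a (min t r) = min a t" by auto
  then show ?case using Cons by simp
qed simp

locale stoch_basis =
  fixes M :: "'w measure" and F :: "real \<Rightarrow> 'w measure" and \<beta> :: "real \<Rightarrow> 'w \<Rightarrow> real"
  assumes basis: "stochastic_basis M F \<beta>"
begin

lemma prob: "prob_space M" and complete: "complete_measure M"
  using basis by (auto simp: stochastic_basis_def complete_filtered_prob_space_def)

sublocale prob_space M by (rule prob)

lemma subalgebra_F: "0 \<le> t \<Longrightarrow> subalgebra M (F t)"
  and sets_F_mono: "0 \<le> s \<Longrightarrow> s \<le> t \<Longrightarrow> sets (F s) \<subseteq> sets (F t)"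
  using basis by (auto simp: stochastic_basis_def complete_filtered_prob_space_def)

lemma space_F: "0 \<le> t \<Longrightarrow> space (F t) = space M"
  and sets_F: "0 \<le> t \<Longrightarrow> sets (F t) \<subseteq> sets M"
  using subalgebra_F by (auto simp: subalgebra_def)

lemma measurable_F_mono:
  assumes "f \<in> borel_measurable (F s)" "0 \<le> s" "s \<le> t"
  shows "f \<in> borel_measurable (F t)"
  by (rule measurable_from_subalg[OF _ assms(1)])
    (use assms sets_F_mono[of s t] in \<open>simp add: subalgebra_def space_F\<close>)

lemma measurable_F_M: "f \<in> borel_measurable (F s) \<Longrightarrow> 0 \<le> s \<Longrightarrow> f \<in> borel_measurable M"
  by (rule measurable_from_subalg[OF subalgebra_F])

lemma \<beta>_measurable: "0 \<le> t \<Longrightarrow> \<beta> t \<in> borel_measurable (F t)"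
  and \<beta>_continuous: "AE w in M. continuous_on {0..} (\<lambda>t. \<beta> t w)"
  using basis by (auto simp: stochastic_basis_def brownian_motion_def)

abbreviation pred :: "real \<Rightarrow> (real \<times> 'w) measure" where
  "pred T \<equiv> predictable_algebra M F {0..T}"

abbreviation time :: "real \<Rightarrow> real measure" where
  "time T \<equiv> restrict_space lborel {0..T}"

abbreviation elem :: "real \<Rightarrow> ('w, 'h::real_normed_vector) elementary \<Rightarrow> bool" where
  "elem T \<equiv> elementary_process M F {0..T}"

abbreviation ito :: "real \<Rightarrow> (real \<Rightarrow> 'w \<Rightarrow> 'h::{real_normed_vector, second_countable_topology}) \<Rightarrow> (real \<Rightarrow> 'w \<Rightarrow> 'h) \<Rightarrow> bool" where
  "ito T \<equiv> has_stoch_integral M F \<beta> {0..T}"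

abbreviation el_int :: "('w, 'h::real_normed_vector) elementary \<Rightarrow> real \<Rightarrow> 'w \<Rightarrow> 'h" where
  "el_int \<equiv> elementary_integral \<beta>"

abbreviation sup_norm :: "real \<Rightarrow> (real \<Rightarrow> 'w \<Rightarrow> 'h::real_normed_vector) \<Rightarrow> 'w \<Rightarrow> ennreal" where
  "sup_norm T Y w \<equiv> SUP t\<in>{0..T}. ennreal (norm (Y t w))"

abbreviation time_norm :: "real \<Rightarrow> (real \<Rightarrow> 'w \<Rightarrow> 'h::real_normed_vector) \<Rightarrow> 'w \<Rightarrow> ennreal" where
  "time_norm T h w \<equiv> L2_time_norm {0..T} (\<lambda>s. h s w)"

section \<open>Measurability with respect to the predictable sigma-algebra\<close>

lemma space_time: "space (time T) = {0..T}" by (simp add: space_restrict_space)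

lemma finite_measure_time: "finite_measure (time T)"
  by (rule finite_measureI) (simp add: emeasure_restrict_space space_restrict_space emeasure_lborel_Icc_eq)

lemma sigma_finite_time: "sigma_finite_measure (time T)"
  by (rule finite_measure.axioms(1)[OF finite_measure_time])

text \<open>The generator of \<open>predictable_algebra\<close> gets a name because the density
  argument runs over it as a pi-system.\<close>

definition pred_gen :: "real \<Rightarrow> (real \<times> 'w) set set" where
  "pred_gen T = {{0} \<times> A | A. A \<in> sets (F 0)} \<union>
     {{s<..t} \<times> A | s t A. 0 \<le> s \<and> s \<le> t \<and> t \<in> {0..T} \<and> A \<in> sets (F s)}"

lemma pred_gen_cases:
  assumes "X \<in> pred_gen T"
  obtains A where "X = {0} \<times> A" "A \<in> sets (F 0)"
    | s t A where "X = {s<..t} \<times> A" "0 \<le> s" "s \<le> t" "t \<le> T" "A \<in> sets (F s)"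
  using assms unfolding pred_gen_def by auto

lemma pred_gen_subset: assumes "0 \<le> T" shows "pred_gen T \<subseteq> Pow ({0..T} \<times> space M)"
proof
  fix X assume "X \<in> pred_gen T"
  then show "X \<in> Pow ({0..T} \<times> space M)"
  proof (cases rule: pred_gen_cases)
    case (1 A)
    then show ?thesis using sets.sets_into_space[OF 1(2)] assms by (auto simp: space_F)
  next
    case (2 s t A)
    then show ?thesis using sets.sets_into_space[OF 2(5)] assms by (auto simp: space_F)
  qed
qed

lemma space_pred: "0 \<le> T \<Longrightarrow> space (pred T) = {0..T} \<times> space M"
  unfolding predictable_algebra_def pred_gen_def[symmetric] by (simp add: pred_gen_subset)

lemma sets_pred: "0 \<le> T \<Longrightarrow> sets (pred T) = sigma_sets ({0..T} \<times> space M) (pred_gen T)"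
  unfolding predictable_algebra_def pred_gen_def[symmetric] by (simp add: pred_gen_subset)

lemma pred_gen_in_sets: "0 \<le> T \<Longrightarrow> A \<in> pred_gen T \<Longrightarrow> A \<in> sets (pred T)"
  by (simp add: sets_pred)

lemma Ioc_times_in_pred: "0 \<le> s \<Longrightarrow> t \<le> T \<Longrightarrow> 0 \<le> T \<Longrightarrow> A \<in> sets (F s) \<Longrightarrow> {s<..t} \<times> A \<in> sets (pred T)"
  by (cases "s \<le> t") (auto intro!: pred_gen_in_sets simp: pred_gen_def)

lemma zero_times_in_pred: "0 \<le> T \<Longrightarrow> A \<in> sets (F 0) \<Longrightarrow> {0} \<times> A \<in> sets (pred T)"
  by (rule pred_gen_in_sets) (auto simp: pred_gen_def)

lemma space_in_F: "0 \<le> t \<Longrightarrow> space M \<in> sets (F t)"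
  using sets.top[of "F t"] by (simp add: space_F)

text \<open>The inclusion makes Tonelli's theorem available for predictable processes.\<close>

lemma subalgebra_pred: assumes "0 \<le> T" shows "subalgebra (time T \<Otimes>\<^sub>M M) (pred T)"
proof -
  have "pred_gen T \<subseteq> sets (time T \<Otimes>\<^sub>M M)"
  proof
    fix X assume "X \<in> pred_gen T"
    then show "X \<in> sets (time T \<Otimes>\<^sub>M M)"
    proof (cases rule: pred_gen_cases)
      case (1 A)
      then show ?thesis using sets_F[of 0] assms
        by (auto intro!: pair_measureI simp: sets_restrict_space_iff)
    next
      case (2 s t A)
      then show ?thesis using sets_F[of s] assms
        by (auto intro!: pair_measureI simp: sets_restrict_space_iff)
    qed
  qed
  then have "sigma_sets (space (time T \<Otimes>\<^sub>M M)) (pred_gen T) \<subseteq> sets (time T \<Otimes>\<^sub>M M)"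
    by (rule sets.sigma_sets_subset)
  then show ?thesis
    by (simp add: subalgebra_def space_pair_measure space_time space_pred sets_pred assms)
qed

lemma pred_measurable_imp_pair:
  "0 \<le> T \<Longrightarrow> f \<in> borel_measurable (pred T) \<Longrightarrow> f \<in> borel_measurable (time T \<Otimes>\<^sub>M M)"
  by (rule measurable_from_subalg[OF subalgebra_pred])

lemma measurable_fst_pred: assumes T: "0 \<le> T" shows "fst \<in> borel_measurable (pred T)"
proof (rule borel_measurableI_le)
  fix c :: real
  show "{z \<in> space (pred T). fst z \<le> c} \<in> sets (pred T)"
  proof (cases "c < 0")
    case True
    then have "{z \<in> space (pred T). fst z \<le> c} = {}" by (auto simp: space_pred T)
    then show ?thesis by (simp only: sets.empty_sets)
  next
    case False
    then have "{z \<in> space (pred T). fst z \<le> c} = {0} \<times> space M \<union> {0<..min c T} \<times> space M"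
      using T by (auto simp: space_pred)
    then show ?thesis
      using T by (auto intro!: sets.Un Ioc_times_in_pred zero_times_in_pred space_in_F)
  qed
qed

text \<open>Cutting a generating set at time r leaves its left end, and hence its sigma-algebra,
  unchanged.\<close>

lemma measurable_id_pred:
  assumes "0 \<le> r" "r \<le> T"
  shows "(\<lambda>z. z) \<in> measurable (pred r) (pred T)"
proof (rule measurable_sigma_sets[where A = "pred_gen T" and \<Omega> = "{0..T} \<times> space M"])
  show "sets (pred T) = sigma_sets ({0..T} \<times> space M) (pred_gen T)" using assms by (simp add: sets_pred)
  show "pred_gen T \<subseteq> Pow ({0..T} \<times> space M)" using assms by (simp add: pred_gen_subset)
  show "(\<lambda>z. z) \<in> space (pred r) \<rightarrow> {0..T} \<times> space M" using assms by (auto simp: space_pred)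
  fix X assume "X \<in> pred_gen T"
  then show "(\<lambda>z. z) -` X \<inter> space (pred r) \<in> sets (pred r)"
  proof (cases rule: pred_gen_cases)
    case (1 A)
    then have "(\<lambda>z. z) -` X \<inter> space (pred r) = {0} \<times> A"
      using assms sets.sets_into_space[OF 1(2)] by (auto simp: space_pred space_F)
    then show ?thesis using 1 assms by (simp add: zero_times_in_pred)
  next
    case (2 s t A)
    then have "(\<lambda>z. z) -` X \<inter> space (pred r) = {s<..min t r} \<times> A"
      using assms sets.sets_into_space[OF 2(5)] by (auto simp: space_pred space_F)
    then show ?thesis using 2 assms by (simp add: Ioc_times_in_pred)
  qed
qed

lemma predictable_mono:
  assumes "predictable M F {0..T} h" "0 \<le> r" "r \<le> T"
  shows "predictable M F {0..r} h"
  using measurable_compose[OF measurable_id_pred[OF assms(2,3)]] assms(1)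
  unfolding predictable_def by blast

lemma predictable_elementary_fun:
  fixes es :: "('w, 'h::{real_normed_vector, second_countable_topology}) elementary"
  assumes T: "0 \<le> T" and es: "elem T es"
  shows "predictable M F {0..T} (elementary_fun es)"
proof -
  have 1: "(\<lambda>z. indicat_real {a<..b} (fst z) *\<^sub>R \<xi> (snd z)) \<in> borel_measurable (pred T)"
    if "0 \<le> a" "b \<le> T" "\<xi> \<in> borel_measurable (F a)" for a b and \<xi> :: "'w \<Rightarrow> 'h"
  proof (rule measurableI)
    fix A :: "'h set" assume A: "A \<in> sets borel"
    have s: "{a<..b} \<times> (\<xi> -` A \<inter> space M) \<in> sets (pred T)"
      using measurable_sets[OF that(3) A] that T by (intro Ioc_times_in_pred) (auto simp: space_F)
    have c: "{a<..b} \<times> space M \<in> sets (pred T)"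
      using that T by (intro Ioc_times_in_pred space_in_F) auto
    have "(\<lambda>z. indicat_real {a<..b} (fst z) *\<^sub>R \<xi> (snd z)) -` A \<inter> space (pred T) =
      {a<..b} \<times> (\<xi> -` A \<inter> space M) \<union> (if 0 \<in> A then space (pred T) - {a<..b} \<times> space M else {})"
      using that T by (auto simp: space_pred split: split_indicator split_indicator_asm)
    then show "(\<lambda>z. indicat_real {a<..b} (fst z) *\<^sub>R \<xi> (snd z)) -` A \<inter> space (pred T) \<in> sets (pred T)"
      using s c by auto
  qed simp
  have "(\<lambda>z. elementary_fun es (fst z) (snd z)) \<in> borel_measurable (pred T)"
    using es
  proof (induction es rule: elementary_induct)
    case (Cons a b \<xi> es)
    then show ?case by (auto intro!: borel_measurable_add 1)
  qed simp
  then show ?thesis by (simp add: predictable_def case_prod_beta')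
qed

lemma measurable_nn_integral_time:
  assumes T: "0 \<le> T" and f: "f \<in> borel_measurable (time T \<Otimes>\<^sub>M M)" and t: "t \<le> T"
  shows "(\<lambda>w. \<integral>\<^sup>+s\<in>{0..t}. f (s, w) \<partial>lborel) \<in> borel_measurable M"
proof -
  interpret T: sigma_finite_measure "time T" by (rule sigma_finite_time)
  note [measurable] = f
  have "(indicator {0..t} :: real \<Rightarrow> ennreal) \<in> borel_measurable (time T)"
    by (rule measurable_restrict_space1) measurable
  from measurable_compose[OF measurable_snd this]
  have "(\<lambda>(w, s). f (s, w) * indicator {0..t} s) \<in> borel_measurable (M \<Otimes>\<^sub>M time T)"
    using measurable_pair_swap[OF f] unfolding case_prod_beta' by (intro borel_measurable_times_ennreal)
  then have "(\<lambda>w. \<integral>\<^sup>+s. f (s, w) * indicator {0..t} s \<partial>time T) \<in> borel_measurable M"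
    by (rule T.borel_measurable_nn_integral)
  also have "(\<lambda>w. \<integral>\<^sup>+s. f (s, w) * indicator {0..t} s \<partial>time T) = (\<lambda>w. \<integral>\<^sup>+s\<in>{0..t}. f (s, w) \<partial>lborel)"
    using t by (intro ext, subst nn_integral_restrict_space) (auto intro!: nn_integral_cong simp: indicator_def)
  finally show ?thesis .
qed

lemma measurable_L2_time_norm:
  fixes h :: "real \<Rightarrow> 'w \<Rightarrow> 'h::{real_normed_vector, second_countable_topology}"
  assumes T: "0 \<le> T" and h: "predictable M F {0..T} h" and t: "t \<le> T"
  shows "(\<lambda>w. L2_time_norm {0..t} (\<lambda>s. h s w)) \<in> borel_measurable M"
proof -
  have [measurable]: "(\<lambda>(t, w). h t w) \<in> borel_measurable (time T \<Otimes>\<^sub>M M)"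
    using T h by (intro pred_measurable_imp_pair) (auto simp: predictable_def)
  have "(\<lambda>z. (ennreal (norm (case z of (t, w) \<Rightarrow> h t w)))\<^sup>2) \<in> borel_measurable (time T \<Otimes>\<^sub>M M)"
    by measurable
  from measurable_nn_integral_time[OF T this t] show ?thesis
    unfolding L2_time_norm_def by (intro measurable_enn_powr) simp
qed

lemma predictable_diff:
  fixes h k :: "real \<Rightarrow> 'w \<Rightarrow> 'h::{real_normed_vector, second_countable_topology}"
  assumes "predictable M F J h" "predictable M F J k"
  shows "predictable M F J (\<lambda>s w. h s w - k s w)"
  using borel_measurable_diff[OF assms[unfolded predictable_def]]
  by (simp add: predictable_def case_prod_beta')

text \<open>The factor \<xi> is only known at time a, but for a > t both Brownian values are taken
  at t and the term vanishes.\<close>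

lemma elementary_integral_measurable:
  fixes es :: "('w, 'h::{real_normed_vector, second_countable_topology}) elementary"
  assumes es: "elem T es" and t: "0 \<le> t"
  shows "el_int es t \<in> borel_measurable (F t)"
  using es
proof (induction es rule: elementary_induct)
  case Nil
  have "el_int [] t = (\<lambda>_. 0 :: 'h)" by (simp add: fun_eq_iff)
  then show ?case by simp
next
  case (Cons a b \<xi> es)
  then have ab: "0 \<le> a" "a \<le> b" and \<xi>: "\<xi> \<in> borel_measurable (F a)" by auto
  have "(\<lambda>w. (\<beta> (min b t) w - \<beta> (min a t) w) *\<^sub>R \<xi> w) \<in> borel_measurable (F t)"
  proof (cases "a \<le> t")
    case True
    have [measurable]: "\<beta> (min b t) \<in> borel_measurable (F t)" "\<beta> (min a t) \<in> borel_measurable (F t)"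
      using ab t by (auto intro!: measurable_F_mono[OF \<beta>_measurable])
    have [measurable]: "\<xi> \<in> borel_measurable (F t)" using measurable_F_mono[OF \<xi>] ab True by auto
    show ?thesis by measurable
  next
    case False
    then have "min b t = t" "min a t = t" using ab by auto
    then show ?thesis by simp
  qed
  then have "(\<lambda>w. (\<beta> (min b t) w - \<beta> (min a t) w) *\<^sub>R \<xi> w + el_int es t w)
      \<in> borel_measurable (F t)"
    using Cons by (intro borel_measurable_add) auto
  then show ?case by (simp flip: elementary_integral_simps)
qed

lemma elementary_integral_continuous:
  assumes es: "elem T es"
  shows "AE w in M. continuous_on {0..} (\<lambda>t. el_int es t w)"
  using \<beta>_continuous
proof eventually_elim
  fix w assume c: "continuous_on {0..} (\<lambda>t. \<beta> t w)"
  show "continuous_on {0..} (\<lambda>t. el_int es t w)"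
    using es
  proof (induction es rule: elementary_induct)
    case (Cons a b \<xi> es)
    then have ab: "0 \<le> a" "a \<le> b" by auto
    have "continuous_on {0..} (\<lambda>t. \<beta> (min d t) w)" if "0 \<le> d" for d
      by (rule continuous_on_compose2[OF c]) (use that in \<open>auto intro!: continuous_intros\<close>)
    then show ?case using Cons ab by (auto intro!: continuous_intros)
  qed simp
qed

lemma has_stoch_integral_elementary:
  fixes es :: "('w, 'h::{real_normed_vector, second_countable_topology}) elementary"
  assumes T: "0 \<le> T" and es: "elem T es"
  shows "ito T (elementary_fun es) (el_int es)"
  unfolding has_stoch_integral_def
proof (intro conjI ballI exI[of _ "\<lambda>_. es"] allI)
  show "AE w in M. continuous_on {0..T} (\<lambda>t. el_int es t w)"
    using elementary_integral_continuous[OF es] by eventually_elim (auto intro: continuous_on_subset)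
qed (use T es elementary_integral_measurable[OF es] in
  \<open>auto simp: tendsto_0_in_prob_def predictable_elementary_fun L2_time_norm_def enn_powr_def\<close>)

lemma measurable_pred_section:
  fixes h :: "real \<Rightarrow> 'w \<Rightarrow> 'h::{real_normed_vector, second_countable_topology}"
  assumes "0 \<le> t" "predictable M F {0..t} h" "w \<in> space M"
  shows "(\<lambda>s. (ennreal (norm (h s w)))\<^sup>2 * indicator {0..t} s) \<in> borel_measurable lborel"
proof -
  have "(\<lambda>(t, w). h t w) \<in> borel_measurable (time t \<Otimes>\<^sub>M M)"
    using assms by (intro pred_measurable_imp_pair) (auto simp: predictable_def)
  from measurable_Pair1[OF this assms(3)]
  have [measurable]: "(\<lambda>s. h s w) \<in> borel_measurable (time t)" by simp
  have "(\<lambda>s. (ennreal (norm (h s w)))\<^sup>2) \<in> borel_measurable (time t)" by measurable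
  then show ?thesis by (subst (asm) borel_measurable_restrict_space_iff_ennreal) auto
qed

text \<open>The factor 2 comes from using (a + b)^2 \<le> 2 * (a^2 + b^2) in place of Minkowski's
  inequality; the estimate serves convergence to 0, for which the size of the constant is
  immaterial.\<close>

lemma L2_time_norm_le_add:
  fixes f :: "real \<Rightarrow> 'h::real_normed_vector"
    and g :: "real \<Rightarrow> 'w \<Rightarrow> 'k::{real_normed_vector, second_countable_topology}"
    and k :: "real \<Rightarrow> 'w \<Rightarrow> 'l::{real_normed_vector, second_countable_topology}"
  assumes "0 \<le> t" "0 \<le> r" "w \<in> space M" "0 \<le> C"
    and g: "predictable M F {0..t} g" and k: "predictable M F {0..r} k"
    and le: "\<And>s. s \<in> {0..t} \<Longrightarrow> norm (f s) \<le> C * (norm (g s w) + indicat_real {0..r} s * norm (k s w))"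
  shows "L2_time_norm {0..t} f \<le>
    ennreal (2 * C) * (L2_time_norm {0..t} (\<lambda>s. g s w) + L2_time_norm {0..r} (\<lambda>s. k s w))"
proof (rule ennreal_power2_le_imp_le)
  let ?g = "\<lambda>s. (ennreal (norm (g s w)))\<^sup>2 * indicator {0..t} s"
  let ?k = "\<lambda>s. (ennreal (norm (k s w)))\<^sup>2 * indicator {0..r} s"
  have [measurable]: "?g \<in> borel_measurable lborel" "?k \<in> borel_measurable lborel"
    using assms by (intro measurable_pred_section; simp)+
  have pw: "(ennreal (norm (f s)))\<^sup>2 * indicator {0..t} s \<le> ennreal (2 * C\<^sup>2) * (?g s + ?k s)" for s
  proof (cases "s \<in> {0..t}")
    case True
    have "(norm (f s))\<^sup>2 \<le> (C * (norm (g s w) + indicat_real {0..r} s * norm (k s w)))\<^sup>2"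
      using le[OF True] by (intro power_mono) auto
    also have "\<dots> \<le> 2 * C\<^sup>2 * ((norm (g s w))\<^sup>2 + (indicat_real {0..r} s * norm (k s w))\<^sup>2)"
    proof -
      have "C\<^sup>2 * (a + b)\<^sup>2 \<le> C\<^sup>2 * (2 * (a\<^sup>2 + b\<^sup>2))" for a b
        by (rule mult_left_mono[OF power2_add_le]) simp
      then have "(C * (a + b))\<^sup>2 \<le> 2 * C\<^sup>2 * (a\<^sup>2 + b\<^sup>2)" for a b
        unfolding power_mult_distrib by (simp only: mult.left_commute[of 2] mult.assoc)
      then show ?thesis .
    qed
    finally have "ennreal ((norm (f s))\<^sup>2) \<le>
        ennreal (2 * C\<^sup>2 * ((norm (g s w))\<^sup>2 + (indicat_real {0..r} s * norm (k s w))\<^sup>2))"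
      by (rule ennreal_leI)
    then show ?thesis
      using True by (cases "s \<in> {0..r}") (simp_all add: ennreal_power ennreal_plus ennreal_mult)
  qed simp
  have "(L2_time_norm {0..t} f)\<^sup>2 \<le> (\<integral>\<^sup>+s. ennreal (2 * C\<^sup>2) * (?g s + ?k s) \<partial>lborel)"
    unfolding L2_time_norm_power2 by (intro nn_integral_mono pw)
  also have "\<dots> = ennreal (2 * C\<^sup>2) * ((L2_time_norm {0..t} (\<lambda>s. g s w))\<^sup>2 + (L2_time_norm {0..r} (\<lambda>s. k s w))\<^sup>2)"
    unfolding L2_time_norm_power2 by (subst nn_integral_cmult, simp, subst nn_integral_add) simp_all
  also have "\<dots> \<le> ennreal ((2 * C)\<^sup>2) * (L2_time_norm {0..t} (\<lambda>s. g s w) + L2_time_norm {0..r} (\<lambda>s. k s w))\<^sup>2"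
    using zero_le_power2[of C]
    by (intro mult_mono ennreal_leI) (auto simp: power2_sum power_mult_distrib intro: add_increasing2)
  finally show "(L2_time_norm {0..t} f)\<^sup>2 \<le>
      (ennreal (2 * C) * (L2_time_norm {0..t} (\<lambda>s. g s w) + L2_time_norm {0..r} (\<lambda>s. k s w)))\<^sup>2"
    using assms by (simp only: power_mult_distrib ennreal_power mult_nonneg_nonneg zero_le_numeral)
qed

section \<open>Linearity of the stochastic integral\<close>

abbreviation fun_err :: "('w, 'h::real_normed_vector) elementary \<Rightarrow> (real \<Rightarrow> 'w \<Rightarrow> 'h) \<Rightarrow> real \<Rightarrow> 'w \<Rightarrow> ennreal" where
  "fun_err es h t w \<equiv> L2_time_norm {0..t} (\<lambda>s. elementary_fun es s w - h s w)"

abbreviation int_err :: "('w, 'h::real_normed_vector) elementary \<Rightarrow> (real \<Rightarrow> 'w \<Rightarrow> 'h) \<Rightarrow> real \<Rightarrow> 'w \<Rightarrow> ennreal" where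
  "int_err es Y t w \<equiv> SUP s\<in>{0..t}. ennreal (norm (el_int es s w - Y s w))"

lemma has_stoch_integralE:
  assumes "has_stoch_integral M F \<beta> J h Y"
  obtains es where "predictable M F J h" "\<And>t. t \<in> J \<Longrightarrow> Y t \<in> borel_measurable (F t)"
    "AE w in M. continuous_on J (\<lambda>t. Y t w)"
    "\<And>n. elementary_process M F J (es n)"
    "\<And>t. t \<in> J \<Longrightarrow> tendsto_0_in_prob M (\<lambda>n w. fun_err (es n) h t w)"
    "\<And>t. t \<in> J \<Longrightarrow> tendsto_0_in_prob M (\<lambda>n w. int_err (es n) Y t w)"
  using assms unfolding has_stoch_integral_def by blast

lemma measurable_SUP_elementary_integral_diff:
  fixes Y :: "real \<Rightarrow> 'w \<Rightarrow> 'h::{real_normed_vector, second_countable_topology}"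
  assumes t: "0 \<le> t" "t \<le> T" and es: "elem T es"
    and Y: "\<And>t. t \<in> {0..T} \<Longrightarrow> Y t \<in> borel_measurable (F t)"
    and cY: "AE w in M. continuous_on {0..T} (\<lambda>t. Y t w)"
  shows "(\<lambda>w. int_err es Y t w) \<in> borel_measurable M"
proof (rule borel_measurable_SUP_continuous_AE[OF complete])
  show "(\<lambda>w. el_int es s w - Y s w) \<in> borel_measurable M" if "s \<in> {0..t}" for s
    using that t by (intro borel_measurable_diff measurable_F_M[OF elementary_integral_measurable[OF es]]
        measurable_F_M[OF Y]) auto
  show "AE w in M. continuous_on {0..t} (\<lambda>s. el_int es s w - Y s w)"
    using cY elementary_integral_continuous[OF es]
  proof eventually_elim
    fix w assume "continuous_on {0..T} (\<lambda>t. Y t w)"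
      "continuous_on {0..} (\<lambda>t. el_int es t w)"
    then show "continuous_on {0..t} (\<lambda>s. el_int es s w - Y s w)"
      using t by (intro continuous_on_diff) (auto elim!: continuous_on_subset)
  qed
qed

text \<open>With L the identity and L' = S (t - r), this presents
  \<open>U t - S (t - r) (U r)\<close> as the terminal value of one stochastic integral whose
  integrand lives after r. The combination is formed on the approximating elementary processes,
  where it is algebra.\<close>

lemma has_stoch_integral_linear_diff:
  fixes L :: "'h::{real_normed_vector, second_countable_topology} \<Rightarrow> 'k::{real_normed_vector, second_countable_topology}"
    and L' :: "'l::{real_normed_vector, second_countable_topology} \<Rightarrow> 'k"
  assumes r: "0 \<le> r" "r \<le> T" and L: "bounded_linear L" and L': "bounded_linear L'"
    and H: "ito T h Y" and K: "ito r k Z"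
    and f: "predictable M F {0..T} f"
    and f_eq: "\<And>s w. s \<in> {0..T} \<Longrightarrow> f s w = L (h s w) - indicat_real {0..r} s *\<^sub>R L' (k s w)"
  shows "ito T f (\<lambda>s w. L (Y s w) - L' (Z (min s r) w))"
proof -
  have T: "0 \<le> T" using r by simp
  have neg: "bounded_linear (\<lambda>x. - L' x)" by (rule bounded_linear_minus[OF L'])
  note lin = bounded_linear.linear[OF L] bounded_linear.linear[OF L'] bounded_linear.linear[OF neg]
  have cont: "continuous_on UNIV L" "continuous_on UNIV L'"
    using L L' by (auto intro: linear_continuous_on)
  obtain C where C: "0 \<le> C" "\<And>x. norm (L x) \<le> C * norm x" "\<And>x. norm (L' x) \<le> C * norm x"
  proof -
    obtain A B where "\<And>x. norm (L x) \<le> norm x * A" "\<And>x. norm (L' x) \<le> norm x * B"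
      using bounded_linear.bounded[OF L] bounded_linear.bounded[OF L'] by blast
    then show thesis
      by (intro that[of "max 0 (max A B)"]) (simp, (subst mult.commute, meson order_trans mult_left_mono norm_ge_zero max.cobounded1 max.cobounded2)+)
  qed
  from H obtain es where pr: "predictable M F {0..T} h"
    and Y: "\<And>t. t \<in> {0..T} \<Longrightarrow> Y t \<in> borel_measurable (F t)"
    and cY: "AE w in M. continuous_on {0..T} (\<lambda>t. Y t w)"
    and es: "\<And>n. elem T (es n)"
    and l1: "\<And>t. t \<in> {0..T} \<Longrightarrow> tendsto_0_in_prob M (\<lambda>n w. fun_err (es n) h t w)"
    and l2: "\<And>t. t \<in> {0..T} \<Longrightarrow> tendsto_0_in_prob M (\<lambda>n w. int_err (es n) Y t w)"
    by (rule has_stoch_integralE) blast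
  from K obtain fs where pr': "predictable M F {0..r} k"
    and Z: "\<And>t. t \<in> {0..r} \<Longrightarrow> Z t \<in> borel_measurable (F t)"
    and cZ: "AE w in M. continuous_on {0..r} (\<lambda>t. Z t w)"
    and fs: "\<And>n. elem r (fs n)"
    and k1: "\<And>t. t \<in> {0..r} \<Longrightarrow> tendsto_0_in_prob M (\<lambda>n w. fun_err (fs n) k t w)"
    and k2: "\<And>t. t \<in> {0..r} \<Longrightarrow> tendsto_0_in_prob M (\<lambda>n w. int_err (fs n) Z t w)"
    by (rule has_stoch_integralE) blast
  have fs': "elem T (fs n)" for n
    using fs r by (rule_tac elementary_process_mono) auto
  \<comment> \<open>The approximants of \<open>k\<close> have no interval beyond r, so their fun
    part needs no cut-off and their integral stays at its value at time r.\<close>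
  define gs where "gs n = map_elementary L (es n) @ map_elementary (\<lambda>x. - L' x) (fs n)" for n
  have gf: "elementary_fun (gs n) s w = L (elementary_fun (es n) s w) - L' (elementary_fun (fs n) s w)" for n s w
    by (simp add: gs_def elementary_fun_append elementary_fun_map lin)
  have gi: "el_int (gs n) s w
      = L (el_int (es n) s w) - L' (el_int (fs n) (min s r) w)" for n s w
    by (simp add: gs_def elementary_integral_append elementary_integral_map lin elementary_integral_stopped[OF fs])
  \<comment> \<open>One Lipschitz estimate controls the error of the integrands and of the integrals
    alike.\<close>
  have tri: "norm (L x - L y - (L' x' - L' y')) \<le> C * (norm (x - y) + norm (x' - y'))" for x y x' y'
  proof -
    have "L x - L y - (L' x' - L' y') = L (x - y) - L' (x' - y')"
      by (simp add: linear_diff[OF lin(1)] linear_diff[OF lin(2)])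
    then have "norm (L x - L y - (L' x' - L' y')) \<le> norm (L (x - y)) + norm (L' (x' - y'))"
      by (simp only: norm_triangle_ineq4)
    then show ?thesis using C(2)[of "x - y"] C(3)[of "x' - y'"] by (simp add: distrib_left)
  qed
  show ?thesis
    unfolding has_stoch_integral_def
  proof (intro conjI ballI exI[of _ gs] allI f)
    show "(\<lambda>w. L (Y t w) - L' (Z (min t r) w)) \<in> borel_measurable (F t)" if "t \<in> {0..T}" for t
      using that r
      by (intro borel_measurable_diff borel_measurable_continuous_on[OF cont(1)]
          borel_measurable_continuous_on[OF cont(2)] Y measurable_F_mono[OF Z]) auto
    show "AE w in M. continuous_on {0..T} (\<lambda>t. L (Y t w) - L' (Z (min t r) w))"
      using cY cZ
    proof eventually_elim
      fix w assume 1: "continuous_on {0..T} (\<lambda>t. Y t w)" and 2: "continuous_on {0..r} (\<lambda>t. Z t w)"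
      have "continuous_on {0..T} (\<lambda>t. Z (min t r) w)"
        by (rule continuous_on_compose2[OF 2]) (use r in \<open>auto intro!: continuous_intros\<close>)
      with 1 show "continuous_on {0..T} (\<lambda>t. L (Y t w) - L' (Z (min t r) w))"
        by (intro continuous_on_diff bounded_linear.continuous_on[OF L] bounded_linear.continuous_on[OF L'])
    qed
    show "elem T (gs n)" for n
      unfolding gs_def elementary_process_append
      using elementary_process_map[OF L es] elementary_process_map[OF neg fs'] by blast
    fix t assume t: "t \<in> {0..T}"
    then have tr: "min t r \<in> {0..r}" using r by auto
    have prd: "predictable M F {0..t} (\<lambda>s w. elementary_fun (es n) s w - h s w)" for n
      using predictable_mono[OF predictable_diff[OF predictable_elementary_fun[OF T es] pr]] t by auto
    have prd': "predictable M F {0..min t r} (\<lambda>s w. elementary_fun (fs n) s w - k s w)" for n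
      using predictable_mono[OF predictable_diff[OF predictable_elementary_fun[OF r(1) fs] pr']] tr by auto
    have m1: "(\<lambda>w. fun_err (es n) h t w) \<in> borel_measurable M" for n
      by (rule measurable_L2_time_norm[OF _ prd]) (use t in auto)
    have m1': "(\<lambda>w. fun_err (fs n) k (min t r) w) \<in> borel_measurable M" for n
      by (rule measurable_L2_time_norm[OF _ prd']) (use tr in auto)
    have m2: "(\<lambda>w. int_err (es n) Y t w) \<in> borel_measurable M" for n
      using t by (intro measurable_SUP_elementary_integral_diff[OF _ _ es Y cY]) auto
    have m2': "(\<lambda>w. int_err (fs n) Z (min t r) w) \<in> borel_measurable M" for n
      using tr by (intro measurable_SUP_elementary_integral_diff[OF _ _ fs Z cZ]) auto
    show "tendsto_0_in_prob M (\<lambda>n w. fun_err (gs n) f t w)"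
    proof (rule tendsto_0_in_prob_AE_mono[OF prob AE_I2 m1 m1' l1[OF t] k1[OF tr]])
      fix n w assume "w \<in> space M"
      then show "fun_err (gs n) f t w \<le> ennreal (2 * C) * (fun_err (es n) h t w + fun_err (fs n) k (min t r) w)"
      proof (intro L2_time_norm_le_add prd prd' C)
        fix s assume s: "s \<in> {0..t}"
        show "norm (elementary_fun (gs n) s w - f s w) \<le> C * (norm (elementary_fun (es n) s w - h s w) +
            indicat_real {0..min t r} s * norm (elementary_fun (fs n) s w - k s w))"
        proof (cases "s \<le> r")
          case True
          then show ?thesis
            using s t tri[of "elementary_fun (es n) s w" "h s w" "elementary_fun (fs n) s w" "k s w"]
            by (simp add: gf f_eq algebra_simps)
        next
          \<comment> \<open>After r the second process contributes nothing on either side, so its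
            two arguments in the estimate are 0.\<close>
          case False
          then show ?thesis
            using s t tri[of "elementary_fun (es n) s w" "h s w" 0 0]
            by (simp add: gf f_eq elementary_fun_eq_0[OF fs] linear_0 lin)
        qed
      qed (use t tr in auto)
    qed
    show "tendsto_0_in_prob M (\<lambda>n w. int_err (gs n) (\<lambda>s w. L (Y s w) - L' (Z (min s r) w)) t w)"
    proof (rule tendsto_0_in_prob_AE_mono[OF prob AE_I2 m2 m2' l2[OF t] k2[OF tr]], rule SUP_least)
      fix n w s assume s: "s \<in> {0..t}"
      then have s': "min s r \<in> {0..min t r}" using r by auto
      let ?a = "norm (el_int (es n) s w - Y s w)"
      let ?b = "norm (el_int (fs n) (min s r) w - Z (min s r) w)"
      have "norm (el_int (gs n) s w - (L (Y s w) - L' (Z (min s r) w))) \<le> C * (?a + ?b)"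
        using tri[of "el_int (es n) s w" "Y s w" "el_int (fs n) (min s r) w" "Z (min s r) w"]
        by (simp add: gi algebra_simps)
      then have "ennreal (norm (el_int (gs n) s w - (L (Y s w) - L' (Z (min s r) w))))
        \<le> ennreal C * (ennreal ?a + ennreal ?b)"
        using C(1) by (simp flip: ennreal_plus ennreal_mult)
      also have "\<dots> \<le> ennreal C * (int_err (es n) Y t w + int_err (fs n) Z (min t r) w)"
        by (intro mult_left_mono add_mono SUP_upper[OF s] SUP_upper[OF s']) simp
      finally show "ennreal (norm (el_int (gs n) s w - (L (Y s w) - L' (Z (min s r) w)))) \<le> \<dots>" .
    qed
  qed
qed

text \<open>The case in which the subtracted integral is that of the empty elementary
  process.\<close>

lemma has_stoch_integral_bounded_linear:
  fixes L :: "'h::{real_normed_vector, second_countable_topology} \<Rightarrow> 'k::{real_normed_vector, second_countable_topology}"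
  assumes T: "0 \<le> T" and L: "bounded_linear L" and H: "ito T h Y"
  shows "ito T (\<lambda>s w. L (h s w)) (\<lambda>s w. L (Y s w))"
proof -
  have 0: "ito T (elementary_fun ([] :: ('w, 'k) elementary)) (el_int [])"
    by (rule has_stoch_integral_elementary[OF T]) simp
  have "predictable M F {0..T} (\<lambda>s w. L (h s w))"
    using H borel_measurable_continuous_on[OF linear_continuous_on[OF L]]
    unfolding has_stoch_integral_def predictable_def case_prod_beta' by blast
  then show ?thesis
    using has_stoch_integral_linear_diff[OF T order_refl L bounded_linear_ident H 0] by simp
qed

end

section \<open>Approximation by elementary processes\<close>

context stoch_basis begin

abbreviation prod_time :: "real \<Rightarrow> (real \<times> 'w) measure" where
  "prod_time T \<equiv> time T \<Otimes>\<^sub>M M"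

text \<open>The squared distance in L^2 over time and sample space. Leaving it squared avoids roots,
  at the price of factors 2 in the triangle inequality.\<close>

definition sq_dist :: "real \<Rightarrow> (real \<Rightarrow> 'w \<Rightarrow> 'h::real_normed_vector) \<Rightarrow> (real \<Rightarrow> 'w \<Rightarrow> 'h) \<Rightarrow> ennreal" where
  "sq_dist T h k = (\<integral>\<^sup>+z. (ennreal (norm (h (fst z) (snd z) - k (fst z) (snd z))))\<^sup>2 \<partial>prod_time T)"

lemma space_prod_time: "space (prod_time T) = {0..T} \<times> space M"
  by (simp add: space_pair_measure space_time)

lemma finite_measure_prod_time: "finite_measure (prod_time T)"
proof -
  interpret T: finite_measure "time T" by (rule finite_measure_time)
  show ?thesis by (intro finite_measure_pair_measure finite_measure_axioms T.finite_measure_axioms)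
qed

lemma predictable_norm_diff_measurable:
  fixes h k :: "real \<Rightarrow> 'w \<Rightarrow> 'h::{real_normed_vector, second_countable_topology}"
  assumes "0 \<le> T" "predictable M F {0..T} h" "predictable M F {0..T} k"
  shows "(\<lambda>z. (ennreal (norm (h (fst z) (snd z) - k (fst z) (snd z))))\<^sup>2) \<in> borel_measurable (prod_time T)"
proof -
  have [measurable]: "(\<lambda>z. h (fst z) (snd z)) \<in> borel_measurable (prod_time T)"
      "(\<lambda>z. k (fst z) (snd z)) \<in> borel_measurable (prod_time T)"
    using assms by (auto intro!: pred_measurable_imp_pair simp: predictable_def case_prod_beta')
  show ?thesis by measurable
qed

lemma sq_dist_eq_nn_integral_L2:
  fixes h k :: "real \<Rightarrow> 'w \<Rightarrow> 'h::{real_normed_vector, second_countable_topology}"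
  assumes "0 \<le> T" "predictable M F {0..T} h" "predictable M F {0..T} k"
  shows "sq_dist T h k = (\<integral>\<^sup>+w. (L2_time_norm {0..T} (\<lambda>s. h s w - k s w))\<^sup>2 \<partial>M)"
proof -
  interpret T: sigma_finite_measure "time T" by (rule sigma_finite_time)
  interpret pair_sigma_finite "time T" M ..
  show ?thesis
    unfolding sq_dist_def L2_time_norm_power2 nn_integral_snd[OF predictable_norm_diff_measurable[OF assms], symmetric]
    by (simp add: nn_integral_restrict_space)
qed

lemma sq_dist_triangle:
  fixes h k l :: "real \<Rightarrow> 'w \<Rightarrow> 'h::{real_normed_vector, second_countable_topology}"
  assumes T: "0 \<le> T" and p: "predictable M F {0..T} h" "predictable M F {0..T} k" "predictable M F {0..T} l"
  shows "sq_dist T h l \<le> 2 * sq_dist T h k + 2 * sq_dist T k l"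
proof -
  note [measurable] = predictable_norm_diff_measurable[OF T p(1,2)] predictable_norm_diff_measurable[OF T p(2,3)]
  have "(ennreal (norm (h t w - l t w)))\<^sup>2 \<le> 2 * (ennreal (norm (h t w - k t w)))\<^sup>2 + 2 * (ennreal (norm (k t w - l t w)))\<^sup>2" for t w
    using ennreal_norm_diff_power2_le[of "h t w - k t w" "l t w - k t w"] by (simp add: norm_minus_commute)
  then have "sq_dist T h l \<le> (\<integral>\<^sup>+z. 2 * (ennreal (norm (h (fst z) (snd z) - k (fst z) (snd z))))\<^sup>2 +
      2 * (ennreal (norm (k (fst z) (snd z) - l (fst z) (snd z))))\<^sup>2 \<partial>prod_time T)"
    unfolding sq_dist_def by (intro nn_integral_mono)
  also have "\<dots> = 2 * sq_dist T h k + 2 * sq_dist T k l"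
    unfolding sq_dist_def by (subst nn_integral_add) (simp_all add: nn_integral_cmult)
  finally show ?thesis .
qed

lemma sq_dist_commute: "sq_dist T h k = sq_dist T k h"
  by (simp add: sq_dist_def norm_minus_commute)

text \<open>Membership in the L^2 closure of the elementary processes.\<close>

definition approximable :: "real \<Rightarrow> (real \<Rightarrow> 'w \<Rightarrow> 'h::{real_normed_vector, second_countable_topology}) \<Rightarrow> bool" where
  "approximable T h \<longleftrightarrow> predictable M F {0..T} h \<and>
    (\<forall>e>0. \<exists>es. elem T es \<and> sq_dist T (elementary_fun es) h \<le> ennreal e)"

lemma ennreal_four_quarters: "0 \<le> e \<Longrightarrow> 2 * ennreal (e / 4) + 2 * ennreal (e / 4) = ennreal e"
  by (simp add: ennreal_plus[symmetric] ennreal_mult[symmetric] flip: ennreal_numeral del: ennreal_plus)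

lemma approximable_closed:
  assumes T: "0 \<le> T" and h: "predictable M F {0..T} h"
    and *: "\<And>e. 0 < e \<Longrightarrow> \<exists>k. approximable T k \<and> sq_dist T k h \<le> ennreal e"
  shows "approximable T h"
  unfolding approximable_def
proof (intro conjI h allI impI)
  fix e :: real assume e: "0 < e"
  then obtain k where k: "approximable T k" "sq_dist T k h \<le> ennreal (e / 4)" using *[of "e / 4"] by auto
  then obtain es where es: "elem T es" "sq_dist T (elementary_fun es) k \<le> ennreal (e / 4)"
    using e unfolding approximable_def by (metis zero_less_divide_iff zero_less_numeral)
  have "sq_dist T (elementary_fun es) h \<le> 2 * sq_dist T (elementary_fun es) k + 2 * sq_dist T k h"
    using k(1) by (intro sq_dist_triangle T predictable_elementary_fun es h) (simp add: approximable_def)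
  also have "\<dots> \<le> 2 * ennreal (e / 4) + 2 * ennreal (e / 4)"
    by (intro add_mono mult_left_mono k es) auto
  also have "\<dots> = ennreal e" using e by (simp only: ennreal_four_quarters less_imp_le)
  finally show "\<exists>es. elem T es \<and> sq_dist T (elementary_fun es) h \<le> ennreal e"
    using es(1) by blast
qed

lemma approximable_dominated:
  fixes h :: "real \<Rightarrow> 'w \<Rightarrow> 'h::{real_normed_vector, second_countable_topology}"
  assumes T: "0 \<le> T" and h: "predictable M F {0..T} h" and k: "\<And>n. approximable T (k n)"
    and lim: "\<And>t w. t \<in> {0..T} \<Longrightarrow> w \<in> space M \<Longrightarrow> (\<lambda>n. k n t w) \<longlonglongrightarrow> h t w"
    and d: "d \<in> borel_measurable (prod_time T)" "(\<integral>\<^sup>+z. d z \<partial>prod_time T) < \<infinity>"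
    and le: "\<And>n t w. t \<in> {0..T} \<Longrightarrow> w \<in> space M \<Longrightarrow> (ennreal (norm (k n t w - h t w)))\<^sup>2 \<le> d (t, w)"
  shows "approximable T h"
proof (rule approximable_closed[OF T h])
  have pk: "predictable M F {0..T} (k n)" for n using k by (simp add: approximable_def)
  have "(\<lambda>n. \<integral>\<^sup>+z. (ennreal (norm (k n (fst z) (snd z) - h (fst z) (snd z))))\<^sup>2 \<partial>prod_time T) \<longlonglongrightarrow>
      (\<integral>\<^sup>+z. 0 \<partial>prod_time T)"
  proof (rule nn_integral_dominated_convergence[OF _ _ d(1) _ d(2)])
    show "AE z in prod_time T. (\<lambda>n. (ennreal (norm (k n (fst z) (snd z) - h (fst z) (snd z))))\<^sup>2) \<longlonglongrightarrow> 0"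
    proof (rule AE_I2)
      fix z assume "z \<in> space (prod_time T)"
      then have "(\<lambda>n. k n (fst z) (snd z) - h (fst z) (snd z)) \<longlonglongrightarrow> 0"
        by (intro LIM_zero lim) (auto simp: space_prod_time)
      then have "(\<lambda>n. ennreal ((norm (k n (fst z) (snd z) - h (fst z) (snd z)))\<^sup>2)) \<longlonglongrightarrow> ennreal (0\<^sup>2)"
        by (intro tendsto_ennrealI tendsto_power tendsto_norm_zero)
      then show "(\<lambda>n. (ennreal (norm (k n (fst z) (snd z) - h (fst z) (snd z))))\<^sup>2) \<longlonglongrightarrow> 0"
        by (simp add: ennreal_power)
    qed
    show "AE z in prod_time T. (ennreal (norm (k n (fst z) (snd z) - h (fst z) (snd z))))\<^sup>2 \<le> d z" for n
      using le by (intro AE_I2) (auto simp: space_prod_time)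
  qed (auto intro!: predictable_norm_diff_measurable T pk h)
  then have 0: "(\<lambda>n. sq_dist T (k n) h) \<longlonglongrightarrow> 0" by (simp add: sq_dist_def)
  fix e :: real assume "0 < e"
  then have "eventually (\<lambda>n. sq_dist T (k n) h < ennreal e) sequentially"
    by (intro order_tendstoD(2)[OF 0]) simp
  then obtain n where "sq_dist T (k n) h < ennreal e" by (meson eventually_sequentially order_refl)
  then show "\<exists>k. approximable T k \<and> sq_dist T k h \<le> ennreal e" using k by (intro exI[of _ "k n"]) auto
qed

lemma approximable_add:
  assumes T: "0 \<le> T" and h: "approximable T h" and k: "approximable T k"
  shows "approximable T (\<lambda>t w. h t w + k t w)"
  unfolding approximable_def
proof (intro conjI allI impI)
  have p: "predictable M F {0..T} h" "predictable M F {0..T} k" using h k by (auto simp: approximable_def)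
  show p': "predictable M F {0..T} (\<lambda>t w. h t w + k t w)"
    using p unfolding predictable_def case_prod_beta' by (rule borel_measurable_add)
  fix e :: real assume e: "0 < e"
  then have "0 < e / 4" by simp
  then obtain es fs where es: "elem T es" "sq_dist T (elementary_fun es) h \<le> ennreal (e / 4)"
    and fs: "elem T fs" "sq_dist T (elementary_fun fs) k \<le> ennreal (e / 4)"
    using h k unfolding approximable_def by metis
  let ?l = "\<lambda>t w. h t w + elementary_fun fs t w"
  have pl: "predictable M F {0..T} ?l"
    using p(1) predictable_elementary_fun[OF T fs(1)] unfolding predictable_def case_prod_beta'
    by (rule borel_measurable_add)
  have ep: "elem T (es @ fs)" using es fs by (simp add: elementary_process_append)
  have "sq_dist T (elementary_fun (es @ fs)) (\<lambda>t w. h t w + k t w)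
    \<le> 2 * sq_dist T (elementary_fun (es @ fs)) ?l + 2 * sq_dist T ?l (\<lambda>t w. h t w + k t w)"
    by (intro sq_dist_triangle T pl p' predictable_elementary_fun ep)
  also have "sq_dist T (elementary_fun (es @ fs)) ?l = sq_dist T (elementary_fun es) h"
    by (simp add: sq_dist_def elementary_fun_append)
  also have "sq_dist T ?l (\<lambda>t w. h t w + k t w) = sq_dist T (elementary_fun fs) k"
    by (simp add: sq_dist_def)
  also have "2 * sq_dist T (elementary_fun es) h + 2 * sq_dist T (elementary_fun fs) k
    \<le> 2 * ennreal (e / 4) + 2 * ennreal (e / 4)"
    by (intro add_mono mult_left_mono fs es) auto
  also have "\<dots> = ennreal e" using e by (simp only: ennreal_four_quarters less_imp_le)
  finally show "\<exists>es. elem T es \<and> sq_dist T (elementary_fun es) (\<lambda>t w. h t w + k t w) \<le> ennreal e"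
    using ep by blast
qed

lemma approximable_elementary:
  "0 \<le> T \<Longrightarrow> elem T es \<Longrightarrow> approximable T (elementary_fun es)"
  unfolding approximable_def by (auto simp: predictable_elementary_fun sq_dist_def)

lemma approximable_0:
  assumes "0 \<le> T"
  shows "approximable T (\<lambda>t w. 0 :: 'h::{real_normed_vector, second_countable_topology})"
proof -
  have "elementary_fun ([] :: ('w, 'h) elementary) = (\<lambda>t w. 0)" by (simp add: fun_eq_iff)
  then show ?thesis using approximable_elementary[OF assms elementary_process_Nil] by metis
qed

lemma approximable_minus:
  fixes h :: "real \<Rightarrow> 'w \<Rightarrow> 'h::{real_normed_vector, second_countable_topology}"
  assumes "0 \<le> T" "approximable T h"
  shows "approximable T (\<lambda>t w. - h t w)"
proof -
  have neg: "bounded_linear (uminus :: 'h \<Rightarrow> 'h)" by (rule bounded_linear_minus[OF bounded_linear_ident])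
  have "sq_dist T (elementary_fun (map_elementary uminus es)) (\<lambda>t w. - h t w) = sq_dist T (elementary_fun es) h" for es
    by (simp add: sq_dist_def elementary_fun_map[OF bounded_linear.linear[OF neg]] norm_minus_commute)
  moreover have "predictable M F {0..T} (\<lambda>t w. - h t w)"
    using assms(2) unfolding approximable_def predictable_def case_prod_beta'
    by (intro borel_measurable_uminus) simp
  ultimately show ?thesis
    using assms(2) elementary_process_map[OF neg] unfolding approximable_def by metis
qed

lemma approximable_cong:
  assumes "0 \<le> T" "\<And>t w. t \<in> {0..T} \<Longrightarrow> w \<in> space M \<Longrightarrow> h t w = k t w"
  shows "approximable T h \<longleftrightarrow> approximable T k"
proof -
  have "predictable M F {0..T} h \<longleftrightarrow> predictable M F {0..T} k"
    unfolding predictable_def using assms by (intro measurable_cong) (auto simp: space_pred)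
  moreover have "sq_dist T l h = sq_dist T l k" for l
    unfolding sq_dist_def using assms by (intro nn_integral_cong) (auto simp: space_prod_time)
  ultimately show ?thesis by (simp add: approximable_def)
qed

text \<open>Two overlapping rectangles meet in one that starts at the later of the two left ends,
  and by then both events belong to the filtration.\<close>

lemma Int_stable_pred_gen: assumes T: "0 \<le> T" shows "Int_stable (pred_gen T)"
proof (rule Int_stableI)
  \<comment> \<open>Disjoint generators intersect in the empty set, which is a generator as {0}
    times the empty event.\<close>
  have e: "{} \<in> pred_gen T"
  proof -
    have "{0} \<times> {} \<in> pred_gen T" unfolding pred_gen_def by blast
    then show ?thesis by simp
  qed
  have mixed: "{0} \<times> A \<inter> {s<..t} \<times> B = {}" if "0 \<le> s" for s t :: real and A B :: "'w set" using that by auto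
  fix X Y assume X: "X \<in> pred_gen T" and Y: "Y \<in> pred_gen T"
  from X show "X \<inter> Y \<in> pred_gen T"
  proof (cases rule: pred_gen_cases)
    case X1: (1 A)
    from Y show ?thesis
    proof (cases rule: pred_gen_cases)
      case (1 B)
      then have "X \<inter> Y = {0} \<times> (A \<inter> B)" "A \<inter> B \<in> sets (F 0)" using X1 by auto
      then show ?thesis unfolding pred_gen_def by blast
    next
      case (2 s t B)
      then show ?thesis using X1 e mixed by simp
    qed
  next
    case X2: (2 s t A)
    from Y show ?thesis
    proof (cases rule: pred_gen_cases)
      case (1 B)
      then show ?thesis using X2 e mixed[of s B t A] by (simp add: Int_commute)
    next
      case (2 s' t' B)
      show ?thesis
      proof (cases "max s s' \<le> min t t'")
        case True
        have "A \<in> sets (F (max s s'))" "B \<in> sets (F (max s s'))"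
          using sets_F_mono[of s "max s s'"] sets_F_mono[of s' "max s s'"] X2 2 by auto
        then have "A \<inter> B \<in> sets (F (max s s'))" by blast
        moreover have "X \<inter> Y = {max s s'<..min t t'} \<times> (A \<inter> B)" using X2 2 by auto
        moreover have "0 \<le> max s s'" "min t t' \<in> {0..T}" using X2 2 by auto
        ultimately show ?thesis unfolding pred_gen_def using True by blast
      next
        case False
        then have "X \<inter> Y = {}" using X2 2 by auto
        then show ?thesis using e by simp
      qed
    qed
  qed
qed

text \<open>Dynkin's pi-lambda argument: the claim holds on the generator and survives complements
  and countable disjoint unions, the latter by dominated convergence.\<close>

lemma approximable_indicator:
  fixes x :: "'h::{real_normed_vector, second_countable_topology}"
  assumes T: "0 \<le> T" and P: "P \<in> sets (pred T)"
  shows "approximable T (\<lambda>t w. indicat_real P (t, w) *\<^sub>R x)"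
proof -
  let ?i = "\<lambda>P t w. indicat_real P (t, w) *\<^sub>R x"
  have pr: "predictable M F {0..T} (\<lambda>t w. indicat_real P (t, w) *\<^sub>R x)" if "P \<in> sets (pred T)" for P
    unfolding predictable_def using that by (simp add: case_prod_beta')
  \<comment> \<open>Half-open intervals never contain time 0, but {0} is a null set of times, so the
    zero process already approximates this indicator.\<close>
  have zero: "approximable T (\<lambda>t w. indicat_real ({0} \<times> A) (t, w) *\<^sub>R x)" if A: "A \<in> sets (F 0)" for A
  proof (rule approximable_closed[OF T pr])
    show "{0} \<times> A \<in> sets (pred T)" using T A by (rule zero_times_in_pred)
    have "sq_dist T (\<lambda>t w. 0) (\<lambda>t w. indicat_real ({0} \<times> A) (t, w) *\<^sub>R x) =
      (\<integral>\<^sup>+z. (ennreal (norm x))\<^sup>2 * indicator ({0} \<times> A) z \<partial>prod_time T)"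
      unfolding sq_dist_def by (intro nn_integral_cong) (auto split: split_indicator)
    also have "\<dots> = (ennreal (norm x))\<^sup>2 * emeasure (prod_time T) ({0} \<times> A)"
      using A sets_F[of 0] T
      by (intro nn_integral_cmult_indicator pair_measureI) (auto simp: sets_restrict_space_iff)
    also have "emeasure (prod_time T) ({0} \<times> A) = emeasure (time T) {0} * emeasure M A"
      using A sets_F[of 0] T
      by (intro emeasure_pair_measure_Times) (auto simp: sets_restrict_space_iff)
    also have "emeasure (time T) {0} = 0" using T by (subst emeasure_restrict_space) auto
    finally have "sq_dist T (\<lambda>t w. 0) (\<lambda>t w. indicat_real ({0} \<times> A) (t, w) *\<^sub>R x) = 0" by simp
    then show "\<exists>k. approximable T k \<and> sq_dist T k (\<lambda>t w. indicat_real ({0} \<times> A) (t, w) *\<^sub>R x) \<le> ennreal e" if "0 < e" for e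
      using approximable_0[OF T] by (intro exI[of _ "\<lambda>t w. 0"]) auto
  qed
  have Ioc: "approximable T (\<lambda>t w. indicat_real ({s<..t'} \<times> A) (t, w) *\<^sub>R x)"
    if "0 \<le> s" "s \<le> t'" "t' \<le> T" "A \<in> sets (F s)" for s t' A
  proof -
    have "bounded ((\<lambda>w. indicat_real A w *\<^sub>R x) ` space M)"
      by (rule boundedI[of _ "norm x"]) (auto split: split_indicator)
    then have "elem T [(s, t', \<lambda>w. indicat_real A w *\<^sub>R x)]"
      using that by simp
    then have "approximable T (elementary_fun [(s, t', \<lambda>w. indicat_real A w *\<^sub>R x)])"
      by (rule approximable_elementary[OF T])
    also have "elementary_fun [(s, t', \<lambda>w. indicat_real A w *\<^sub>R x)] = (\<lambda>t w. indicat_real ({s<..t'} \<times> A) (t, w) *\<^sub>R x)"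
      by (auto simp: fun_eq_iff split: split_indicator)
    finally show ?thesis .
  qed
  from P have "P \<in> sigma_sets ({0..T} \<times> space M) (pred_gen T)" using T by (simp add: sets_pred)
  from Int_stable_pred_gen[OF T] pred_gen_subset[OF T] this show ?thesis
  proof (induction rule: sigma_sets_induct_disjoint)
    case (basic A)
    then show ?case
    proof (cases rule: pred_gen_cases)
      case (1 B)
      then show ?thesis using zero by simp
    next
      case (2 s t B)
      then show ?thesis using Ioc by simp
    qed
  next
    case empty
    then show ?case using approximable_0[OF T] by simp
  next
    case (compl A)
    have "A \<in> sets (pred T)" using compl T by (simp add: sets_pred)
    then have sub: "A \<subseteq> {0..T} \<times> space M" using sets.sets_into_space T by (metis space_pred)
    \<comment> \<open>The whole space is itself put together from the two kinds of generators before
      \<open>A\<close> is subtracted.\<close>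
    have "approximable T (\<lambda>t w. (indicat_real ({0} \<times> space M) (t, w) *\<^sub>R x + indicat_real ({0<..T} \<times> space M) (t, w) *\<^sub>R x)
        + - (indicat_real A (t, w) *\<^sub>R x))"
      using T compl by (intro approximable_add approximable_minus zero Ioc space_in_F) auto
    also have "(\<lambda>t w. (indicat_real ({0} \<times> space M) (t, w) *\<^sub>R x + indicat_real ({0<..T} \<times> space M) (t, w) *\<^sub>R x)
        + - (indicat_real A (t, w) *\<^sub>R x)) = (\<lambda>t w. indicat_real ({0..T} \<times> space M - A) (t, w) *\<^sub>R x)"
      using sub T by (auto simp: fun_eq_iff split: split_indicator)
    finally show ?case .
  next
    case (union A)
    have "A i \<in> sets (pred T)" for i using union(2) T by (auto simp: sets_pred)
    then have U: "(\<Union>i. A i) \<in> sets (pred T)" by blast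
    have sums: "(\<lambda>t w. \<Sum>i<n. indicat_real (A i) (t, w) *\<^sub>R x) = (\<lambda>t w. indicat_real (\<Union>i<n. A i) (t, w) *\<^sub>R x)" for n
    proof -
      have "indicat_real (\<Union>i<n. A i) z = (\<Sum>i<n. indicat_real (A i) z)" for z
        using disjoint_family_on_mono[OF _ union(1), of "{..<n}"]
        by (intro indicator_UN_disjoint) auto
      then show ?thesis by (simp only: scaleR_sum_left)
    qed
    have app: "approximable T (\<lambda>t w. \<Sum>i<n. indicat_real (A i) (t, w) *\<^sub>R x)" for n
      by (induction n) (simp_all add: approximable_0 T approximable_add union(3))
    show ?case
    proof (rule approximable_dominated[OF T pr[OF U], of "\<lambda>n t w. indicat_real (\<Union>i<n. A i) (t, w) *\<^sub>R x" "\<lambda>_. (ennreal (norm x))\<^sup>2"])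
      show "approximable T (\<lambda>t w. indicat_real (\<Union>i<n. A i) (t, w) *\<^sub>R x)" for n
        using app[of n] by (simp only: sums)
      show "(\<lambda>n. indicat_real (\<Union>i<n. A i) (t, w) *\<^sub>R x) \<longlonglongrightarrow> indicat_real (\<Union>i. A i) (t, w) *\<^sub>R x" for t w
        by (intro tendsto_scaleR tendsto_const LIMSEQ_indicator_UN)
      show "(\<integral>\<^sup>+z. (ennreal (norm x))\<^sup>2 \<partial>prod_time T) < \<infinity>"
        using finite_measure.emeasure_finite[OF finite_measure_prod_time, of T "space (prod_time T)"]
        by (simp add: ennreal_mult_less_top ennreal_power less_top)
      show "(ennreal (norm (indicat_real (\<Union>i<n. A i) (t, w) *\<^sub>R x - indicat_real (\<Union>i. A i) (t, w) *\<^sub>R x)))\<^sup>2 \<le> (ennreal (norm x))\<^sup>2" for n t w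
        by (auto split: split_indicator intro!: power_mono)
    qed simp
  qed
qed

lemma approximable_sum:
  assumes "0 \<le> T" "finite A" "\<And>i. i \<in> A \<Longrightarrow> approximable T (h i)"
  shows "approximable T (\<lambda>t w. \<Sum>i\<in>A. h i t w)"
  using assms(2,3) by (induction A rule: finite_induct) (simp_all add: approximable_0 approximable_add assms(1))

text \<open>Simple functions converge pointwise to h with norms at most twice that of h, and each is
  a finite combination of indicators.\<close>

lemma approximable_square_integrable:
  fixes h :: "real \<Rightarrow> 'w \<Rightarrow> 'h::{real_normed_vector, second_countable_topology}"
  assumes T: "0 \<le> T" and h: "predictable M F {0..T} h" and fin: "sq_dist T h (\<lambda>_ _. 0) < \<infinity>"
  shows "approximable T h"
proof -
  have hm: "(\<lambda>z. h (fst z) (snd z)) \<in> borel_measurable (pred T)"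
    using h by (simp add: predictable_def case_prod_beta')
  from borel_measurable_implies_sequence_metric[OF hm, of 0]
  obtain f where f: "\<And>i. simple_function (pred T) (f i)"
    "\<And>z. z \<in> space (pred T) \<Longrightarrow> (\<lambda>i. f i z) \<longlonglongrightarrow> h (fst z) (snd z)"
    "\<And>i z. z \<in> space (pred T) \<Longrightarrow> norm (f i z) \<le> 2 * norm (h (fst z) (snd z))"
    by simp metis
  have app: "approximable T (\<lambda>t w. f i (t, w))" for i
  proof -
    have "approximable T (\<lambda>t w. \<Sum>y\<in>f i ` space (pred T). indicat_real (f i -` {y} \<inter> space (pred T)) (t, w) *\<^sub>R y)"
      using f(1)[of i] by (intro approximable_sum T approximable_indicator) (auto simp: simple_function_def)
    moreover have "(\<Sum>y\<in>f i ` space (pred T). indicat_real (f i -` {y} \<inter> space (pred T)) (t, w) *\<^sub>R y) = f i (t, w)"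
      if "t \<in> {0..T}" "w \<in> space M" for t w
    proof -
      have sp: "(t, w) \<in> space (pred T)" using that T by (simp add: space_pred)
      have "(\<Sum>y\<in>f i ` space (pred T). indicat_real (f i -` {y} \<inter> space (pred T)) (t, w) *\<^sub>R y)
        = (\<Sum>y\<in>f i ` space (pred T). if y = f i (t, w) then f i (t, w) else 0)"
        using sp by (intro sum.cong refl) (auto split: split_indicator)
      also have "\<dots> = f i (t, w)"
        using sp f(1)[of i] by (subst sum.delta) (auto simp: simple_function_def)
      finally show ?thesis .
    qed
    ultimately show ?thesis by (subst (asm) approximable_cong[OF T]) auto
  qed
  \<comment> \<open>The distance of an approximant to h is at most three times the norm of h, which
    gives 9 after squaring.\<close>
  let ?d = "\<lambda>z. 9 * (ennreal (norm (h (fst z) (snd z) - 0)))\<^sup>2"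
  have p0: "predictable M F {0..T} (\<lambda>_ _. 0 :: 'h)" by (simp add: predictable_def case_prod_beta')
  have m[measurable]: "(\<lambda>z. (ennreal (norm (h (fst z) (snd z) - 0)))\<^sup>2) \<in> borel_measurable (prod_time T)"
    using predictable_norm_diff_measurable[OF T h p0] .
  show ?thesis
  proof (rule approximable_dominated[OF T h app, where d = ?d])
    show "(\<lambda>i. f i (t, w)) \<longlonglongrightarrow> h t w" if "t \<in> {0..T}" "w \<in> space M" for t w
      using f(2)[of "(t, w)"] that T by (simp add: space_pred)
    show "?d \<in> borel_measurable (prod_time T)" by measurable
    show "(\<integral>\<^sup>+z. ?d z \<partial>prod_time T) < \<infinity>"
      using fin unfolding sq_dist_def by (subst nn_integral_cmult[OF m]) (simp add: ennreal_mult_less_top)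
    show "(ennreal (norm (f n (t, w) - h t w)))\<^sup>2 \<le> ?d (t, w)" if "t \<in> {0..T}" "w \<in> space M" for n t w
    proof -
      have "norm (f n (t, w) - h t w) \<le> norm (f n (t, w)) + norm (h t w)" by (rule norm_triangle_ineq4)
      also have "\<dots> \<le> 3 * norm (h t w)" using f(3)[of "(t, w)" n] that T by (simp add: space_pred)
      finally have "(norm (f n (t, w) - h t w))\<^sup>2 \<le> (3 * norm (h t w))\<^sup>2" by (intro power_mono) auto
      then have "ennreal ((norm (f n (t, w) - h t w))\<^sup>2) \<le> ennreal (9 * (norm (h t w))\<^sup>2)"
        by (intro ennreal_leI) (simp add: power_mult_distrib)
      then show ?thesis by (simp add: ennreal_power ennreal_mult)
    qed
  qed
qed

end

section \<open>Existence of the stochastic integral\<close>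

context stoch_basis begin

text \<open>The constant is specified for \<open>ell2\<close> only. An isometric linear embedding
  carries the integral into \<open>ell2\<close> and changes neither of the two norms.\<close>

lemma BDG_transfer:
  fixes h :: "real \<Rightarrow> 'w \<Rightarrow> 'h::{real_inner, second_countable_topology}"
  assumes bdg: "BDG_constant TYPE('w) q b" and T: "0 < T"
    and H: "ito T h Y"
    and fin: "Lp_norm M q (time_norm T h) < \<infinity>"
  shows "Lp_norm M q (sup_norm T Y)
    \<le> ennreal b * Lp_norm M q (time_norm T h)"
proof -
  obtain f :: "'h \<Rightarrow> ell2" where f: "linear f" "\<And>x. norm (f x) = norm x"
    using separable_embeds_ell2 by blast
  have bl: "bounded_linear f"
    using f by (intro bounded_linear_intro[where K = 1]) (auto simp: linear_add linear_scale)
  have H': "ito T (\<lambda>s w. f (h s w)) (\<lambda>s w. f (Y s w))"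
    using T by (intro has_stoch_integral_bounded_linear[OF _ bl H]) simp
  have L2: "L2_time_norm {0..T} (\<lambda>s. f (h s w)) = time_norm T h w" for w
    by (simp add: L2_time_norm_def f)
  have pr: "predictable M F {0..T} (\<lambda>s w. f (h s w))" using H' by (simp add: has_stoch_integral_def)
  have J: "{0..T} \<in> insert {0..} {{0..T'} | T'. 0 < T'}" using T by blast
  have "Lp_norm M q (\<lambda>w. SUP t\<in>{0..T}. ennreal (norm (f (Y t w))))
    \<le> ennreal b * Lp_norm M q (\<lambda>w. L2_time_norm {0..T} (\<lambda>s. f (h s w)))"
    using bdg[unfolded BDG_constant_def BDG_inequality_def] basis J pr fin[folded L2] H' by blast
  then show ?thesis by (simp add: L2 f)
qed

text \<open>A deterministic bound on the energy of the paths becomes a moment bound at one time.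
  Since \<open>ennreal b\<close> reads a negative b as 0, the real constant is
  \<open>max b 0\<close>.\<close>

lemma BDG_bounded:
  fixes h :: "real \<Rightarrow> 'w \<Rightarrow> 'h::{real_inner, second_countable_topology}"
  assumes bdg: "BDG_constant TYPE('w) q b" and q: "0 < q" and T: "0 < T"
    and H: "ito T h Y" and A: "0 \<le> A"
    and le: "AE w in M. (\<integral>\<^sup>+s\<in>{0..T}. (ennreal (norm (h s w)))\<^sup>2 \<partial>lborel) \<le> ennreal A"
    and t: "t \<in> {0..T}"
  shows "(\<integral>\<^sup>+w. ennreal (norm (Y t w) powr q) \<partial>M) \<le> ennreal ((max b 0 * sqrt A) powr q)"
proof -
  have "(\<integral>\<^sup>+w. enn_powr (time_norm T h w) q \<partial>M) \<le> (\<integral>\<^sup>+w. ennreal (sqrt A powr q) \<partial>M)"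
  proof (rule nn_integral_mono_AE, use le in eventually_elim)
    fix w assume "(\<integral>\<^sup>+s\<in>{0..T}. (ennreal (norm (h s w)))\<^sup>2 \<partial>lborel) \<le> ennreal A"
    then have "time_norm T h w \<le> ennreal (sqrt A)"
      unfolding L2_time_norm_def using A by (subst enn_powr_le_iff) (auto simp: powr_numeral)
    then have "enn_powr (time_norm T h w) q \<le> enn_powr (ennreal (sqrt A)) q"
      using q by (intro enn_powr_mono) auto
    then show "enn_powr (time_norm T h w) q \<le> ennreal (sqrt A powr q)"
      using A by (simp add: enn_powr_ennreal)
  qed
  also have "\<dots> = ennreal (sqrt A powr q)" by (simp add: emeasure_space_1)
  finally have Lp: "Lp_norm M q (time_norm T h) \<le> ennreal (sqrt A)"
    using q A by (subst Lp_norm_le_iff) auto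
  then have "Lp_norm M q (time_norm T h) < \<infinity>"
    by (rule order.strict_trans1) simp
  from BDG_transfer[OF bdg T H this]
  have "Lp_norm M q (sup_norm T Y)
    \<le> ennreal b * Lp_norm M q (time_norm T h)" .
  also have "\<dots> \<le> ennreal (max b 0) * ennreal (sqrt A)"
    by (intro mult_mono Lp ennreal_leI) auto
  also have "\<dots> = ennreal (max b 0 * sqrt A)" using A by (simp add: ennreal_mult)
  finally have "(\<integral>\<^sup>+w. enn_powr (sup_norm T Y w) q \<partial>M) \<le> ennreal ((max b 0 * sqrt A) powr q)"
    using q A by (subst (asm) Lp_norm_le_iff) auto
  moreover have "(\<integral>\<^sup>+w. ennreal (norm (Y t w) powr q) \<partial>M) \<le> (\<integral>\<^sup>+w. enn_powr (sup_norm T Y w) q \<partial>M)"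
  proof (rule nn_integral_mono)
    fix w
    have "enn_powr (ennreal (norm (Y t w))) q \<le> enn_powr (sup_norm T Y w) q"
      using q by (intro enn_powr_mono SUP_upper[OF t]) auto
    then show "ennreal (norm (Y t w) powr q) \<le> enn_powr (sup_norm T Y w) q"
      by (simp add: enn_powr_ennreal)
  qed
  ultimately show ?thesis by (rule order_trans[rotated])
qed

lemma BDG_L2:
  fixes h :: "real \<Rightarrow> 'w \<Rightarrow> 'h::{real_inner, second_countable_topology}"
  assumes bdg: "BDG_constant TYPE('w) 2 b" and T: "0 < T"
    and H: "ito T h Y" and fin: "sq_dist T h (\<lambda>_ _. 0) < \<infinity>"
  shows "(\<integral>\<^sup>+w. (sup_norm T Y w)\<^sup>2 \<partial>M) \<le> (ennreal b)\<^sup>2 * sq_dist T h (\<lambda>_ _. 0)"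
proof -
  have pr: "predictable M F {0..T} h" using H by (simp add: has_stoch_integral_def)
  have p0: "predictable M F {0..T} (\<lambda>_ _. 0 :: 'h)" by (simp add: predictable_def case_prod_beta')
  have e: "Lp_norm M 2 (time_norm T h) = enn_powr (sq_dist T h (\<lambda>_ _. 0)) (1 / 2)"
    using T by (simp add: Lp_norm_def enn_powr_2 sq_dist_eq_nn_integral_L2[OF _ pr p0])
  have "enn_powr (sq_dist T h (\<lambda>_ _. 0)) (1 / 2) < \<infinity>"
    using fin by (auto simp: enn_powr_def)
  with BDG_transfer[OF bdg T H] have
    "enn_powr (\<integral>\<^sup>+w. (sup_norm T Y w)\<^sup>2 \<partial>M) (1 / 2) \<le> ennreal b * enn_powr (sq_dist T h (\<lambda>_ _. 0)) (1 / 2)"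
    unfolding e by (simp add: Lp_norm_def enn_powr_2)
  then have "(enn_powr (\<integral>\<^sup>+w. (sup_norm T Y w)\<^sup>2 \<partial>M) (1 / 2))\<^sup>2
      \<le> (ennreal b * enn_powr (sq_dist T h (\<lambda>_ _. 0)) (1 / 2))\<^sup>2"
    by (rule power_mono) simp
  moreover have "(enn_powr x (1 / 2))\<^sup>2 = x" for x
    by (simp add: enn_powr_enn_powr enn_powr_1 flip: enn_powr_2)
  ultimately show ?thesis by (simp add: power_mult_distrib)
qed

text \<open>The Burkholder--Davis--Gundy inequality is specified for intervals of positive length,
  so the degenerate one is treated directly: a single time has Lebesgue measure 0.\<close>

lemma has_stoch_integral_zero_time:
  assumes h: "predictable M F {0..0} h"
  shows "ito 0 h (\<lambda>_ _. 0 :: 'h::{real_normed_vector, second_countable_topology})"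
  unfolding has_stoch_integral_def
proof (intro conjI exI[of _ "\<lambda>_. []"] ballI allI)
  have "L2_time_norm {0..0} f = 0" for f :: "real \<Rightarrow> 'h"
    by (simp add: L2_time_norm_def nn_integral_null_set enn_powr_def)
  then show "tendsto_0_in_prob M (\<lambda>n w. L2_time_norm {0..t} (\<lambda>s. elementary_fun [] s w - h s w))"
    if "t \<in> {0..0}" for t using that by (simp add: tendsto_0_in_prob_def)
qed (use h in \<open>auto simp: tendsto_0_in_prob_def\<close>)

text \<open>Approximants are chosen at a geometric rate. Consecutive integrals then differ in
  supremum norm by terms that are almost surely summable, so almost every path converges
  uniformly.\<close>

lemma has_stoch_integral_exists:
  fixes h :: "real \<Rightarrow> 'w \<Rightarrow> 'h::{real_inner, banach, second_countable_topology}"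
  assumes bdg: "BDG_constant TYPE('w) 2 b" and T: "0 < T"
    and h: "predictable M F {0..T} h" and fin: "sq_dist T h (\<lambda>_ _. 0) < \<infinity>"
  shows "\<exists>Y. ito T h Y"
proof -
  have T0: "0 \<le> T" using T by simp
  have "approximable T h" by (rule approximable_square_integrable[OF T0 h fin])
  \<comment> \<open>The rate 8^(-n) for squared distances leaves room for the geometric bound
    (1/2)^n on the norms of the suprema below.\<close>
  then have "\<exists>es. elem T es \<and> sq_dist T (elementary_fun es) h \<le> ennreal ((1/8) ^ n)" for n
    by (simp add: approximable_def)
  then obtain es where es: "\<And>n. elem T (es n)"
    and esh: "\<And>n. sq_dist T (elementary_fun (es n)) h \<le> ennreal ((1/8) ^ n)" by metis
  have neg: "bounded_linear (uminus :: 'h \<Rightarrow> 'h)" by (rule bounded_linear_minus[OF bounded_linear_ident])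
  have neg': "linear (uminus :: 'h \<Rightarrow> 'h)" by (rule bounded_linear.linear[OF neg])
  \<comment> \<open>The difference of consecutive approximants is again elementary, so the
    inequality applies to it.\<close>
  define ds where "ds n = es (Suc n) @ map_elementary uminus (es n)" for n
  have ds: "elem T (ds n)" for n
    unfolding ds_def elementary_process_append using es elementary_process_map[OF neg es] by blast
  have df: "elementary_fun (ds n) s w = elementary_fun (es (Suc n)) s w - elementary_fun (es n) s w" for n s w
    by (simp add: ds_def elementary_fun_append elementary_fun_map[OF neg'])
  let ?I = "\<lambda>n s w. el_int (es n) s w"
  have di: "el_int (ds n) s w = ?I (Suc n) s w - ?I n s w" for n s w
    by (simp add: ds_def elementary_integral_append elementary_integral_map[OF neg'])
  have dd: "sq_dist T (elementary_fun (ds n)) (\<lambda>_ _. 0) \<le> ennreal (4 * (1/8) ^ n)" for n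
  proof -
    have "sq_dist T (elementary_fun (ds n)) (\<lambda>_ _. 0) = sq_dist T (elementary_fun (es (Suc n))) (elementary_fun (es n))"
      by (simp add: sq_dist_def df)
    also have "\<dots> \<le> 2 * sq_dist T (elementary_fun (es (Suc n))) h + 2 * sq_dist T h (elementary_fun (es n))"
      by (intro sq_dist_triangle T0 h predictable_elementary_fun es)
    also have "\<dots> \<le> 2 * ennreal ((1/8) ^ Suc n) + 2 * ennreal ((1/8) ^ n)"
      using esh[of n] by (intro add_mono mult_left_mono esh) (auto simp: sq_dist_commute)
    also have "\<dots> = ennreal (2 * (1/8) ^ Suc n + 2 * (1/8) ^ n)"
      by (simp only: ennreal_plus ennreal_mult' ennreal_numeral zero_le_numeral mult_nonneg_nonneg
          zero_le_power zero_le_divide_1_iff)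
    also have "\<dots> \<le> ennreal (4 * (1/8) ^ n)" by (intro ennreal_leI) simp
    finally show ?thesis .
  qed
  define X where "X n w = (SUP t\<in>{0..T}. ennreal (norm (el_int (ds n) t w)))" for n w
  have [measurable]: "X n \<in> borel_measurable M" for n
    unfolding X_def
  proof (rule borel_measurable_SUP_continuous_AE[OF complete])
    show "el_int (ds n) s \<in> borel_measurable M" if "s \<in> {0..T}" for s
      using that by (intro measurable_F_M[OF elementary_integral_measurable[OF ds]]) auto
    show "AE w in M. continuous_on {0..T} (\<lambda>s. el_int (ds n) s w)"
      using elementary_integral_continuous[OF ds] by eventually_elim (auto elim!: continuous_on_subset)
  qed
  have X2: "(\<integral>\<^sup>+w. (X n w)\<^sup>2 \<partial>M) \<le> (ennreal b)\<^sup>2 * ennreal (4 * (1/8) ^ n)" for n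
  proof -
    have "sq_dist T (elementary_fun (ds n)) (\<lambda>_ _. 0) < \<infinity>"
      by (rule order.strict_trans1[OF dd]) simp
    from BDG_L2[OF bdg T has_stoch_integral_elementary[OF T0 ds] this]
    show ?thesis unfolding X_def by (rule order_trans) (intro mult_left_mono dd; simp)
  qed
  define x where "x n w = enn2real (X n w)" for n w
  let ?P = "\<lambda>w. summable (\<lambda>n. x n w) \<and> (\<forall>n. X n w = ennreal (x n w))"
  define L where "L = 2 * max b 1"
  have [measurable]: "x n \<in> borel_measurable M" for n unfolding x_def[abs_def] by measurable
  have "(\<integral>\<^sup>+w. ennreal (x n w powr 2) \<partial>M) \<le> ennreal ((L * (1/2) ^ n) powr 2)" for n
  proof -
    have "(\<integral>\<^sup>+w. ennreal (x n w powr 2) \<partial>M) \<le> (\<integral>\<^sup>+w. (X n w)\<^sup>2 \<partial>M)"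
    proof (rule nn_integral_mono)
      fix w show "ennreal (x n w powr 2) \<le> (X n w)\<^sup>2"
        by (cases "X n w") (auto simp: x_def powr_numeral ennreal_power)
    qed
    also have "\<dots> \<le> (ennreal (max b 1))\<^sup>2 * ennreal (4 * (1/4) ^ n)"
      by (rule order_trans[OF X2]) (intro mult_mono power_mono ennreal_leI, auto intro: power_mono)
    also have "\<dots> = ennreal ((max b 1)\<^sup>2 * (4 * (1/4) ^ n))" by (simp add: ennreal_mult ennreal_power)
    also have "(max b 1)\<^sup>2 * (4 * (1/4) ^ n) = (L * (1/2) ^ n)\<^sup>2"
    proof -
      have "(2 ^ n)\<^sup>2 = (4::real) ^ n" by (simp add: power2_eq_square flip: power_mult_distrib)
      then show ?thesis by (simp add: L_def power_mult_distrib power_divide)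
    qed
    also have "\<dots> = (L * (1/2) ^ n) powr 2" by (simp add: L_def powr_numeral)
    finally show ?thesis .
  qed
  then have sx: "AE w in M. summable (\<lambda>n. x n w)"
    by (intro nn_integral_powr_suminf_le(1)[OF prob, of x 2 L "\<lambda>n. (1/2) ^ n"])
      (auto simp: x_def L_def intro: summable_geometric)
  have "AE w in M. \<forall>n. X n w \<noteq> top"
    unfolding AE_all_countable
  proof
    fix n
    have "(\<integral>\<^sup>+w. (X n w)\<^sup>2 \<partial>M) < \<infinity>"
      by (rule order.strict_trans1[OF X2]) (simp add: ennreal_mult_less_top power2_eq_square)
    then have "AE w in M. (X n w)\<^sup>2 \<noteq> \<infinity>" by (intro nn_integral_PInf_AE) auto
    then show "AE w in M. X n w \<noteq> top" by eventually_elim (auto simp: power2_eq_square)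
  qed
  with sx have AE_X: "AE w in M. ?P w"
    by eventually_elim (simp add: x_def less_top)
  \<comment> \<open>The tail of the series bounds the uniform distance of the n-th integral from its
    limit.\<close>
  define r where "r n w = (\<Sum>j. X (j + n) w)" for n w
  have [measurable]: "r n \<in> borel_measurable M" for n unfolding r_def by measurable
  \<comment> \<open>Taking \<open>lim\<close> at every sample point, convergent or not, gives
    adaptedness directly from that of the elementary integrals.\<close>
  define Y where "Y t w = lim (\<lambda>n. ?I n t w)" for t w
  have good: "(\<forall>n. \<forall>t\<in>{0..T}. ennreal (norm (?I n t w - Y t w)) \<le> r n w \<and> r n w < top) \<and> (\<lambda>n. r n w) \<longlonglongrightarrow> 0"
    if X: "?P w" for w
  proof -
    have sx: "summable (\<lambda>n. x n w)" and xX: "X n w = ennreal (x n w)" and x0: "0 \<le> x n w" for n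
      using X by (auto simp: x_def)
    have rx: "r n w = ennreal (\<Sum>j. x (j + n) w)" for n
      unfolding r_def xX by (intro suminf_ennreal2 x0 summable_ignore_initial_segment sx)
    have "norm (?I (Suc n) t w - ?I n t w) \<le> x n w" if "t \<in> {0..T}" for n t
    proof -
      have "ennreal (norm (el_int (ds n) t w)) \<le> X n w"
        unfolding X_def by (rule SUP_upper[OF that])
      then show ?thesis using x0 by (simp add: di xX)
    qed
    from telescoping_lim(2)[of "\<lambda>n. ?I n t w" "\<lambda>n. x n w" for t, OF this sx]
    have "ennreal (norm (?I n t w - Y t w)) \<le> r n w" if "t \<in> {0..T}" for n t
      using that unfolding rx Y_def by (intro ennreal_leI) (simp add: norm_minus_commute)
    moreover have "(\<lambda>n. r n w) \<longlonglongrightarrow> 0"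
      unfolding rx using tendsto_ennrealI[OF suminf_exist_split2[OF sx]] by simp
    ultimately show ?thesis using rx by simp
  qed
  have "ito T h Y"
    unfolding has_stoch_integral_def
  proof (intro conjI ballI exI[of _ es] allI h es)
    show "Y t \<in> borel_measurable (F t)" if "t \<in> {0..T}" for t
      unfolding Y_def using that elementary_integral_measurable[OF es]
      by (intro borel_measurable_lim_metric) auto
    have "AE w in M. \<forall>n. continuous_on {0..} (\<lambda>t. ?I n t w)"
      by (subst AE_all_countable) (intro allI elementary_integral_continuous[OF es])
    with AE_X show "AE w in M. continuous_on {0..T} (\<lambda>t. Y t w)"
    proof eventually_elim
      fix w assume X: "?P w" and c: "\<forall>n. continuous_on {0..} (\<lambda>t. ?I n t w)"
      note g = good[OF X]
      show "continuous_on {0..T} (\<lambda>t. Y t w)"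
      proof (rule uniform_limit_theorem[OF _ _ sequentially_bot])
        show "\<forall>\<^sub>F n in sequentially. continuous_on {0..T} (\<lambda>t. ?I n t w)"
          by (intro always_eventually allI continuous_on_subset[OF spec[OF c]]) auto
        show "uniform_limit {0..T} (\<lambda>n t. ?I n t w) (\<lambda>t. Y t w) sequentially"
        proof (rule uniform_limitI)
          fix e :: real assume "0 < e"
          then have "\<forall>\<^sub>F n in sequentially. r n w < ennreal e"
            by (intro order_tendstoD(2)[where y = 0]) (use g in auto)
          then show "\<forall>\<^sub>F n in sequentially. \<forall>t\<in>{0..T}. dist (?I n t w) (Y t w) < e"
          proof eventually_elim
            fix n assume n: "r n w < ennreal e"
            show "\<forall>t\<in>{0..T}. dist (?I n t w) (Y t w) < e"
            proof
              fix t assume "t \<in> {0..T}"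
              then have "ennreal (norm (?I n t w - Y t w)) < ennreal e"
                using g n by (meson order.strict_trans1)
              then show "dist (?I n t w) (Y t w) < e" by (simp add: dist_norm ennreal_less_iff)
            qed
          qed
        qed
      qed
    qed
    fix t assume t: "t \<in> {0..T}"
    have rp: "tendsto_0_in_prob M r"
      by (rule tendsto_0_in_prob_AE[OF prob _ eventually_mono[OF AE_X]]) (use good in auto)
    show "tendsto_0_in_prob M (\<lambda>n w. int_err (es n) Y t w)"
    \<comment> \<open>This criterion asks for two dominating sequences; the tail plays both
      parts.\<close>
    proof (rule tendsto_0_in_prob_AE_mono[OF prob _ _ _ rp rp])
      show "AE w in M. (int_err (es n) Y t w) \<le> ennreal 1 * (r n w + r n w)" for n
        using AE_X
      proof eventually_elim
        fix w assume X: "?P w"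
        have "ennreal (norm (?I n s w - Y s w)) \<le> r n w + r n w" if "s \<in> {0..t}" for s
          by (rule add_increasing2) (use good[OF X] that t in auto)
        then show "(int_err (es n) Y t w) \<le> ennreal 1 * (r n w + r n w)"
          unfolding ennreal_1 mult_1 by (rule SUP_least)
      qed
    qed measurable
    show "tendsto_0_in_prob M (\<lambda>n w. fun_err (es n) h t w)"
    proof (rule tendsto_0_in_prob_L2[OF prob])
      have pd: "predictable M F {0..T} (\<lambda>s w. elementary_fun (es n) s w - h s w)" for n
        by (intro predictable_diff predictable_elementary_fun T0 es h)
      show "(\<lambda>w. fun_err (es n) h t w) \<in> borel_measurable M" for n
        using t by (intro measurable_L2_time_norm[OF T0 pd]) auto
      have "(\<integral>\<^sup>+w. (fun_err (es n) h t w)\<^sup>2 \<partial>M) \<le> ennreal ((1/8) ^ n)" for n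
      proof -
        have "(\<integral>\<^sup>+w. (fun_err (es n) h t w)\<^sup>2 \<partial>M)
          \<le> (\<integral>\<^sup>+w. (fun_err (es n) h T w)\<^sup>2 \<partial>M)"
          unfolding L2_time_norm_power2 using t
          by (intro nn_integral_mono) (auto split: split_indicator)
        also have "\<dots> = sq_dist T (elementary_fun (es n)) h"
          by (intro sq_dist_eq_nn_integral_L2[symmetric] T0 predictable_elementary_fun es h)
        also have "\<dots> \<le> ennreal ((1/8) ^ n)" by (rule esh)
        finally show ?thesis .
      qed
      moreover have "(\<lambda>n. ennreal ((1/8) ^ n)) \<longlonglongrightarrow> 0"
        using tendsto_ennrealI[OF LIMSEQ_power_zero[of "1/8 :: real"]] by simp
      ultimately show "(\<lambda>n. \<integral>\<^sup>+w. (fun_err (es n) h t w)\<^sup>2 \<partial>M) \<longlonglongrightarrow> 0"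
        by (rule tendsto_0_le_ennreal)
    qed
  qed
  then show ?thesis by blast
qed

end

section \<open>Increments of the stochastic convolution\<close>

text \<open>The clock is the indefinite integral of d plus a linear term whose slope makes the total
  R. It is continuous, so the intermediate value theorem yields the inverse; strictness in
  \<open>fin\<close> makes the slope positive.\<close>

lemma time_change_exists:
  fixes d :: "real \<Rightarrow> ennreal"
  assumes T: "0 < T" and d: "(\<lambda>s. d s * indicator {0..T} s) \<in> borel_measurable lborel"
    and fin: "(\<integral>\<^sup>+s\<in>{0..T}. d s \<partial>lborel) < ennreal R"
  obtains \<sigma> \<tau> :: "real \<Rightarrow> real" and c where "0 < c" "\<sigma> 0 = 0" "\<sigma> T = 1"
    "\<And>u v. 0 \<le> u \<Longrightarrow> u \<le> v \<Longrightarrow> v \<le> T \<Longrightarrow> v - u \<le> c * (\<sigma> v - \<sigma> u)"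
    "\<And>x. x \<in> {0..1} \<Longrightarrow> \<tau> x \<in> {0..T}" "\<And>x. x \<in> {0..1} \<Longrightarrow> \<sigma> (\<tau> x) = x"
    "\<And>u v. 0 \<le> u \<Longrightarrow> u \<le> v \<Longrightarrow> v \<le> T \<Longrightarrow> (\<integral>\<^sup>+s\<in>{u..v}. d s \<partial>lborel) \<le> ennreal (R * (\<sigma> v - \<sigma> u))"
proof -
  \<comment> \<open>A real-valued copy of d: as the integral is finite, d is infinite on a null set
    only.\<close>
  define f where "f s = enn2real (d s * indicator {0..T} s)" for s
  have fm[measurable]: "f \<in> borel_measurable lborel"
    unfolding f_def using d by measurable
  have f0: "0 \<le> f s" for s by (simp add: f_def)
  have "(\<integral>\<^sup>+s. d s * indicator {0..T} s \<partial>lborel) \<noteq> \<infinity>" using fin by auto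
  then have AEw: "AE s in lborel. d s * indicator {0..T} s = ennreal (f s)"
    using nn_integral_PInf_AE[OF d] by (auto simp: f_def less_top elim!: eventually_mono)
  have nn: "(\<integral>\<^sup>+s\<in>{u..v}. d s \<partial>lborel) = (\<integral>\<^sup>+s. ennreal (indicator {u..v} s * f s) \<partial>lborel)"
    if "0 \<le> u" "v \<le> T" for u v
    using AEw by (intro nn_integral_cong_AE, eventually_elim) (use that in \<open>auto split: split_indicator\<close>)
  have int: "set_integrable lborel {u..v} f" if "0 \<le> u" "v \<le> T" for u v
    unfolding set_integrable_def
  proof (rule integrableI_nonneg)
    have "(\<integral>\<^sup>+s\<in>{u..v}. d s \<partial>lborel) \<le> (\<integral>\<^sup>+s\<in>{0..T}. d s \<partial>lborel)"
      using that by (intro nn_integral_mono) (auto split: split_indicator)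
    then show "(\<integral>\<^sup>+s. ennreal (indicat_real {u..v} s *\<^sub>R f s) \<partial>lborel) < \<infinity>"
      using fin nn[OF that] by (auto intro: le_less_trans order.strict_trans)
  qed (auto simp: f0)
  have nn_int: "(\<integral>\<^sup>+s\<in>{u..v}. d s \<partial>lborel) = ennreal (integral {u..v} f)" if "0 \<le> u" "v \<le> T" for u v
    using int[OF that] unfolding nn[OF that] set_borel_integral_eq_integral(2)[OF int[OF that], symmetric]
    by (subst nn_integral_eq_integral) (auto simp: set_integrable_def set_lebesgue_integral_def f0)
  have intg: "f integrable_on {0..T}"
    using set_borel_integral_eq_integral(1)[OF int] T by simp
  have comb: "integral {0..v} f - integral {0..u} f = integral {u..v} f" if "0 \<le> u" "u \<le> v" "v \<le> T" for u v
    using Henstock_Kurzweil_Integration.integral_combine[of 0 u v f] that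
      integrable_on_subinterval[OF intg, of 0 v] by auto
  have int0: "0 \<le> integral {u..v} f" if "0 \<le> u" "v \<le> T" for u v
    using set_borel_integral_eq_integral(1)[OF int[OF that]] f0
    by (intro Henstock_Kurzweil_Integration.integral_nonneg) auto
  define \<delta> where "\<delta> = (R - integral {0..T} f) / T"
  have "integral {0..T} f < R"
    using fin int0[of 0 T] unfolding nn_int[OF order_refl order_refl] by (simp add: ennreal_less_iff)
  then have \<delta>: "0 < \<delta>" and R: "0 < R" using T int0[of 0 T] by (auto simp: \<delta>_def)
  define a where "a t = integral {0..t} f + \<delta> * t" for t
  have a0: "a 0 = 0" and aT: "a T = R" using T by (auto simp: a_def \<delta>_def)
  have diff: "a v - a u = integral {u..v} f + \<delta> * (v - u)" if "0 \<le> u" "u \<le> v" "v \<le> T" for u v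
    using comb[OF that] by (simp add: a_def algebra_simps)
  have cont: "continuous_on {0..T} a"
    unfolding a_def by (intro continuous_intros indefinite_integral_continuous_1 intg)
  have "\<exists>t. t \<in> {0..T} \<and> a t = R * x" if "x \<in> {0..1}" for x
    using IVT'[of a 0 "R * x" T] that R T cont by (auto simp: a0 aT mult_left_le)
  then obtain \<tau> where \<tau>: "\<And>x. x \<in> {0..1} \<Longrightarrow> \<tau> x \<in> {0..T} \<and> a (\<tau> x) = R * x" by metis
  show thesis
  \<comment> \<open>The linear term gives a v - a u \<ge> \<delta> * (v - u), so the normalised
    clock a / R expands with constant R / \<delta>.\<close>
  proof (rule that[of "R / \<delta>" "\<lambda>t. a t / R" \<tau>])
    show "v - u \<le> R / \<delta> * (a v / R - a u / R)" if "0 \<le> u" "u \<le> v" "v \<le> T" for u v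
    proof -
      have "\<delta> * (v - u) \<le> a v - a u" using diff[OF that] int0[of u v] that by simp
      then have "v - u \<le> (a v - a u) / \<delta>" using \<delta> by (simp add: pos_le_divide_eq mult.commute)
      also have "\<dots> = R / \<delta> * (a v / R - a u / R)" using R \<delta> by (simp add: right_diff_distrib diff_divide_distrib)
      finally show ?thesis .
    qed
    show "(\<integral>\<^sup>+s\<in>{u..v}. d s \<partial>lborel) \<le> ennreal (R * (a v / R - a u / R))" if "0 \<le> u" "u \<le> v" "v \<le> T" for u v
    proof -
      have "R * (a v / R - a u / R) = a v - a u" using R by (simp add: right_diff_distrib)
      then show ?thesis
        using diff[OF that] that \<delta> nn_int[OF that(1,3)] by (simp add: ennreal_leI)
    qed
  qed (use \<delta> R a0 aT \<tau> in auto)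
qed

context stoch_basis begin

text \<open>Elementary integrals start at 0, so over the time set {0} the errors in the definition
  are \<open>norm (Y 0 w)\<close> itself, for every n. The probability that this exceeds a given
  level is constant in n and tends to 0.\<close>

lemma has_stoch_integral_at_0:
  fixes Y :: "real \<Rightarrow> 'w \<Rightarrow> 'h::{real_normed_vector, second_countable_topology}"
  assumes T: "0 \<le> T" and H: "ito T h Y"
  shows "AE w in M. Y 0 w = 0"
proof -
  from H obtain es where Y: "\<And>t. t \<in> {0..T} \<Longrightarrow> Y t \<in> borel_measurable (F t)"
    and es: "\<And>n. elem T (es n)"
    and l: "\<And>t. t \<in> {0..T} \<Longrightarrow> tendsto_0_in_prob M (\<lambda>n w. int_err (es n) Y t w)"
    by (rule has_stoch_integralE) blast
  have [measurable]: "Y 0 \<in> borel_measurable M" using measurable_F_M[OF Y[of 0]] T by simp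
  have "elem T fs \<Longrightarrow> el_int fs 0 w = 0" for fs :: "('w, 'h) elementary" and w
    by (induction fs rule: elementary_induct) (auto simp: min_absorb2)
  then have e0: "el_int (es n) 0 w = 0" for n w using es by blast
  have z: "emeasure M {w \<in> space M. e < ennreal (norm (Y 0 w))} = 0" if "0 < e" for e
    using l[of 0] T that by (simp add: tendsto_0_in_prob_def e0 LIMSEQ_const_iff)
  have "AE w in M. \<forall>n. ennreal (norm (Y 0 w)) \<le> ennreal (inverse (real (Suc n)))"
    unfolding AE_all_countable
  proof
    fix n
    show "AE w in M. ennreal (norm (Y 0 w)) \<le> ennreal (inverse (real (Suc n)))"
      using z[of "ennreal (inverse (real (Suc n)))"]
      by (subst AE_iff_measurable[OF _ refl]) (auto simp: not_le simp del: ennreal_le_iff)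
  qed
  then show ?thesis
  proof eventually_elim
    fix w assume *: "\<forall>n. ennreal (norm (Y 0 w)) \<le> ennreal (inverse (real (Suc n)))"
    have "norm (Y 0 w) \<le> 0"
    proof (rule LIMSEQ_le_const[OF LIMSEQ_inverse_real_of_nat])
      show "\<exists>N. \<forall>n\<ge>N. norm (Y 0 w) \<le> inverse (real (Suc n))"
        using * by (simp add: ennreal_le_iff)
    qed
    then show "Y 0 w = 0" by simp
  qed
qed

end

locale stoch_conv = stoch_basis M F \<beta>
  for M :: "'w measure" and F \<beta> +
  fixes S :: "real \<Rightarrow> 'a \<Rightarrow> 'a::{chilbert_space, second_countable_topology}"
    and T :: real and B :: "real \<Rightarrow> real" and g :: "real \<Rightarrow> 'w \<Rightarrow> 'a"
  assumes S: "C0_semigroup S" and T: "0 < T"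
    and bdg: "\<And>q. 0 < q \<Longrightarrow> BDG_constant TYPE('w) q (B q)"
    and g: "predictable M F {0..T} g"
    and fin: "(\<integral>\<^sup>+t\<in>{0..T}. (esssup M (\<lambda>w. ennreal (norm (g t w))))\<^sup>2 \<partial>lborel) < \<infinity>"
begin

section \<open>The integrand of the convolution and its deterministic bound\<close>

definition K :: real where "K = (SUP t\<in>{0..T}. onorm (S t))"

definition G :: "real \<Rightarrow> ennreal" where "G t = esssup M (\<lambda>w. ennreal (norm (g t w)))"

definition U :: "real \<Rightarrow> 'w \<Rightarrow> 'a" where "U t = stoch_convolution M F \<beta> S g t"

definition h :: "real \<Rightarrow> real \<Rightarrow> 'w \<Rightarrow> 'a" where "h t s w = S (t - s) (g s w)"

lemma K_nonneg: "0 \<le> K" and S_bound: "t \<in> {0..T} \<Longrightarrow> norm (S t x) \<le> K * norm x"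
  using C0_semigroup_onorm[OF S T] unfolding K_def by blast+

lemma T0: "0 \<le> T" using T by simp

abbreviation G2 :: "real set \<Rightarrow> ennreal" where
  "G2 A \<equiv> \<integral>\<^sup>+s\<in>A. (G s)\<^sup>2 \<partial>lborel"

lemma fin_G: "(\<integral>\<^sup>+t\<in>{0..T}. (G t)\<^sup>2 \<partial>lborel) < \<infinity>"
  using fin by (simp add: G_def)

lemma norm_g_measurable: "(\<lambda>z. ennreal (norm (g (fst z) (snd z)))) \<in> borel_measurable (time T \<Otimes>\<^sub>M M)"
proof -
  have [measurable]: "(\<lambda>z. g (fst z) (snd z)) \<in> borel_measurable (time T \<Otimes>\<^sub>M M)"
    using g T0 by (intro pred_measurable_imp_pair) (simp_all add: predictable_def case_prod_beta')
  show ?thesis by measurable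
qed

lemma G_measurable: "(\<lambda>s. (G s)\<^sup>2 * indicator {0..T} s) \<in> borel_measurable lborel"
proof -
  have "(\<lambda>s. esssup M (\<lambda>w. ennreal (norm (g (fst (s, w)) (snd (s, w)))))) \<in> borel_measurable (time T)"
    by (rule borel_measurable_esssup_section[OF sigma_finite_measure_axioms norm_g_measurable])
  then have [measurable]: "G \<in> borel_measurable (time T)" by (simp add: G_def[abs_def])
  have "(\<lambda>s. (G s)\<^sup>2) \<in> borel_measurable (time T)" by measurable
  then show ?thesis by (subst (asm) borel_measurable_restrict_space_iff_ennreal) auto
qed

lemma AE_g_le_G: "AE w in M. AE s in lborel. s \<in> {0..T} \<longrightarrow> ennreal (norm (g s w)) \<le> G s"
proof -
  have "AE w in M. AE s in time T. ennreal (norm (g (fst (s, w)) (snd (s, w))))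
      \<le> esssup M (\<lambda>w. ennreal (norm (g (fst (s, w)) (snd (s, w)))))"
    by (rule AE_le_esssup_section[OF sigma_finite_measure_axioms sigma_finite_time norm_g_measurable])
  then show ?thesis by (simp add: AE_restrict_space_iff G_def)
qed

lemma predictable_h: assumes t: "t \<in> {0..T}" shows "predictable M F {0..t} (h t)"
proof -
  \<comment> \<open>Clamping the time to [0, T] turns the joint continuity available there into
    continuity on the whole space, hence Borel measurability.\<close>
  let ?S = "\<lambda>(u, x). S (max 0 (min T u)) x"
  have "continuous_on UNIV (\<lambda>z. (max 0 (min T (fst z)), snd z) :: real \<times> 'a)"
    by (intro continuous_intros)
  then have "continuous_on UNIV (\<lambda>z. case (max 0 (min T (fst z)), snd z) of (u, x) \<Rightarrow> S u x)"
    by (rule continuous_on_compose2[OF C0_semigroup_continuous_on[OF S, of T]]) (use T0 in auto)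
  then have "continuous_on UNIV ?S" by (simp add: case_prod_beta')
  then have Sm: "?S \<in> borel_measurable (borel \<Otimes>\<^sub>M borel)"
    unfolding borel_prod by (rule borel_measurable_continuous_onI)
  have t0: "0 \<le> t" using t by simp
  have "(\<lambda>z. g (fst z) (snd z)) \<in> borel_measurable (pred t)"
    using predictable_mono[OF g, of t] t by (simp add: predictable_def case_prod_beta')
  moreover have "(\<lambda>z. t - fst z) \<in> borel_measurable (pred t)"
    using measurable_fst_pred[OF t0] by measurable
  ultimately have "(\<lambda>z. (t - fst z, g (fst z) (snd z))) \<in> measurable (pred t) (borel \<Otimes>\<^sub>M borel)"
    by (intro measurable_Pair)
  from measurable_compose[OF this Sm]
  have "(\<lambda>z. S (max 0 (min T (t - fst z))) (g (fst z) (snd z))) \<in> borel_measurable (pred t)" by simp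
  also have "?this \<longleftrightarrow> (\<lambda>z. h t (fst z) (snd z)) \<in> borel_measurable (pred t)"
    using t by (intro measurable_cong) (auto simp: space_pred[OF t0] h_def min_absorb2 max_absorb2)
  finally show ?thesis by (simp add: predictable_def case_prod_beta')
qed

abbreviation H2 :: "real \<Rightarrow> real set \<Rightarrow> 'w \<Rightarrow> ennreal" where
  "H2 t A w \<equiv> \<integral>\<^sup>+s\<in>{0..t}. (ennreal (norm (indicat_real A s *\<^sub>R h t s w)))\<^sup>2 \<partial>lborel"

text \<open>This is where the first power of \<open>K\<close> enters. The set \<open>A\<close> is
  the whole interval when the integral is constructed and {r<..t} when an increment is
  estimated.\<close>

lemma AE_h_bound:
  assumes t: "t \<in> {0..T}" and A: "A \<in> sets borel" "A \<subseteq> {0..t}"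
  shows "AE w in M. (\<integral>\<^sup>+s\<in>{0..t}. (ennreal (norm (indicat_real A s *\<^sub>R h t s w)))\<^sup>2 \<partial>lborel)
    \<le> ennreal (K\<^sup>2) * (\<integral>\<^sup>+s\<in>A. (G s)\<^sup>2 \<partial>lborel)"
  using AE_g_le_G
proof eventually_elim
  fix w assume *: "AE s in lborel. s \<in> {0..T} \<longrightarrow> ennreal (norm (g s w)) \<le> G s"
  have "(\<lambda>s. ((G s)\<^sup>2 * indicator {0..T} s) * indicator A s) \<in> borel_measurable lborel"
    using G_measurable by (rule borel_measurable_times_ennreal) (use A in measurable)
  also have "(\<lambda>s. ((G s)\<^sup>2 * indicator {0..T} s) * indicator A s) = (\<lambda>s. (G s)\<^sup>2 * indicator A s)"
    using A t by (auto simp: fun_eq_iff split: split_indicator)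
  finally have m[measurable]: "(\<lambda>s. (G s)\<^sup>2 * indicator A s) \<in> borel_measurable lborel" .
  have "(\<integral>\<^sup>+s\<in>{0..t}. (ennreal (norm (indicat_real A s *\<^sub>R h t s w)))\<^sup>2 \<partial>lborel)
    \<le> (\<integral>\<^sup>+s. ennreal (K\<^sup>2) * ((G s)\<^sup>2 * indicator A s) \<partial>lborel)"
  proof (rule nn_integral_mono_AE, rule AE_mp[OF *], intro AE_I2 impI)
    fix s assume le: "s \<in> {0..T} \<longrightarrow> ennreal (norm (g s w)) \<le> G s"
    show "(ennreal (norm (indicat_real A s *\<^sub>R h t s w)))\<^sup>2 * indicator {0..t} s \<le> ennreal (K\<^sup>2) * ((G s)\<^sup>2 * indicator A s)"
    proof (cases "s \<in> A")
      case True
      then have s: "s \<in> {0..t}" "s \<in> {0..T}" "t - s \<in> {0..T}" using A t by auto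
      have "ennreal (norm (h t s w)) \<le> ennreal (K * norm (g s w))"
        unfolding h_def by (intro ennreal_leI S_bound s)
      also have "\<dots> = ennreal K * ennreal (norm (g s w))" using K_nonneg by (simp add: ennreal_mult)
      also have "\<dots> \<le> ennreal K * G s" using le s by (intro mult_left_mono) auto
      finally have "(ennreal (norm (h t s w)))\<^sup>2 \<le> (ennreal K * G s)\<^sup>2" by (rule power_mono) simp
      then show ?thesis using True s K_nonneg by (simp add: power_mult_distrib ennreal_power)
    qed simp
  qed
  also have "\<dots> = ennreal (K\<^sup>2) * (\<integral>\<^sup>+s\<in>A. (G s)\<^sup>2 \<partial>lborel)"
    by (rule nn_integral_cmult) measurable
  finally show "(\<integral>\<^sup>+s\<in>{0..t}. (ennreal (norm (indicat_real A s *\<^sub>R h t s w)))\<^sup>2 \<partial>lborel)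
    \<le> ennreal (K\<^sup>2) * (\<integral>\<^sup>+s\<in>A. (G s)\<^sup>2 \<partial>lborel)" .
qed

text \<open>For each t a whole integral process with its own integrand, of which \<open>U t\<close>
  is the terminal value; comparing two of them requires the processes and not just these
  values.\<close>

definition Y :: "real \<Rightarrow> real \<Rightarrow> 'w \<Rightarrow> 'a" where "Y t = stoch_integral M F \<beta> {0..t} (h t)"

lemma U_eq: "U t = Y t t"
  by (simp add: U_def Y_def stoch_convolution_def h_def[abs_def])

lemma has_stoch_integral_Y:
  assumes t: "t \<in> {0..T}"
  shows "ito t (h t) (Y t)"
proof -
  have "\<exists>Z. ito t (h t) Z"
  proof (cases "t = 0")
    case True
    then show ?thesis using has_stoch_integral_zero_time predictable_h[OF t] by blast
  next
    case False
    then have t0: "0 < t" "0 \<le> t" using t by auto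
    have "sq_dist t (h t) (\<lambda>_ _. 0) = (\<integral>\<^sup>+w. (L2_time_norm {0..t} (\<lambda>s. h t s w - 0))\<^sup>2 \<partial>M)"
      by (rule sq_dist_eq_nn_integral_L2[OF t0(2) predictable_h[OF t]]) (simp add: predictable_def case_prod_beta')
    also have "\<dots> \<le> (\<integral>\<^sup>+w. ennreal (K\<^sup>2) * (\<integral>\<^sup>+s\<in>{0..T}. (G s)\<^sup>2 \<partial>lborel) \<partial>M)"
    proof (rule nn_integral_mono_AE)
      have A: "{0..t} \<in> sets borel" "{0..t} \<subseteq> {0..t}" by auto
      have le: "(\<integral>\<^sup>+s\<in>{0..t}. (G s)\<^sup>2 \<partial>lborel) \<le> (\<integral>\<^sup>+s\<in>{0..T}. (G s)\<^sup>2 \<partial>lborel)"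
        using t by (intro nn_integral_mono) (auto split: split_indicator)
      show "AE w in M. (L2_time_norm {0..t} (\<lambda>s. h t s w - 0))\<^sup>2 \<le> ennreal (K\<^sup>2) * (\<integral>\<^sup>+s\<in>{0..T}. (G s)\<^sup>2 \<partial>lborel)"
        using AE_h_bound[OF t A]
      proof eventually_elim
        fix w assume *: "(\<integral>\<^sup>+s\<in>{0..t}. (ennreal (norm (indicat_real {0..t} s *\<^sub>R h t s w)))\<^sup>2 \<partial>lborel)
          \<le> ennreal (K\<^sup>2) * (\<integral>\<^sup>+s\<in>{0..t}. (G s)\<^sup>2 \<partial>lborel)"
        have "(L2_time_norm {0..t} (\<lambda>s. h t s w - 0))\<^sup>2 = (\<integral>\<^sup>+s\<in>{0..t}. (ennreal (norm (indicat_real {0..t} s *\<^sub>R h t s w)))\<^sup>2 \<partial>lborel)"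
          unfolding L2_time_norm_power2 by (intro nn_integral_cong) (auto split: split_indicator)
        also have "\<dots> \<le> ennreal (K\<^sup>2) * (\<integral>\<^sup>+s\<in>{0..T}. (G s)\<^sup>2 \<partial>lborel)"
          by (rule order_trans[OF *]) (intro mult_left_mono le; simp)
        finally show "(L2_time_norm {0..t} (\<lambda>s. h t s w - 0))\<^sup>2 \<le> ennreal (K\<^sup>2) * (\<integral>\<^sup>+s\<in>{0..T}. (G s)\<^sup>2 \<partial>lborel)" .
      qed
    qed
    also have "\<dots> = ennreal (K\<^sup>2) * (\<integral>\<^sup>+s\<in>{0..T}. (G s)\<^sup>2 \<partial>lborel)" by (simp add: emeasure_space_1)
    also have "\<dots> < \<infinity>" using fin_G by (simp add: ennreal_mult_less_top)
    finally show ?thesis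
      using bdg[of 2] t0 by (intro has_stoch_integral_exists[OF _ t0(1) predictable_h[OF t]]) auto
  qed
  then show ?thesis unfolding Y_def stoch_integral_def by (rule someI_ex)
qed

lemma U_measurable: assumes t: "t \<in> {0..T}" shows "U t \<in> borel_measurable M"
proof -
  have "Y t t \<in> borel_measurable (F t)"
    using has_stoch_integral_Y[OF t] t by (auto simp: has_stoch_integral_def)
  then show ?thesis using t measurable_F_M by (auto simp: U_eq)
qed

lemma U_0: "AE w in M. U 0 w = 0"
  using has_stoch_integral_at_0[OF order_refl has_stoch_integral_Y[of 0]] T0 by (simp add: U_eq)

text \<open>The increment is the terminal value of the integral of \<open>h t\<close> restricted to
  times after r, whose energy is at most K^2 * a on almost every path.\<close>

lemma U_incr_bound:
  assumes rt: "0 \<le> r" "r \<le> t" "t \<le> T" and q: "0 < q" and a: "0 \<le> a"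
    and le: "(\<integral>\<^sup>+s\<in>{r..t}. (G s)\<^sup>2 \<partial>lborel) \<le> ennreal a"
  shows "(\<integral>\<^sup>+w. ennreal (norm (U t w - S (t - r) (U r w)) powr q) \<partial>M)
    \<le> ennreal ((max (B q) 0 * K * sqrt a) powr q)"
\<comment> \<open>The trivial case also disposes of t = 0, where no interval of positive length is
  available.\<close>
proof (cases "r = t")
  case True
  then show ?thesis using q by (simp add: C0_semigroupD(2)[OF S])
next
  case False
  then have t: "0 < t" "t \<in> {0..T}" and r: "r \<in> {0..T}" using rt by auto
  have bl: "bounded_linear (S (t - r))" using C0_semigroupD(1)[OF S] rt by simp
  have pr: "predictable M F {0..t} (\<lambda>s w. indicat_real {r<..} s *\<^sub>R h t s w)"
  proof -
    have "(\<lambda>z. indicat_real {r<..} (fst z)) \<in> borel_measurable (pred t)"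
      by (rule measurable_compose[OF measurable_fst_pred]) (use t in auto)
    then show ?thesis
      using predictable_h[OF t(2)] unfolding predictable_def case_prod_beta' by (rule borel_measurable_scaleR)
  qed
  \<comment> \<open>Up to time r the semigroup law \<open>S (t - s) = S (t - r)\<close> after
    \<open>S (r - s)\<close> makes the two integrands cancel.\<close>
  have eq: "indicat_real {r<..} s *\<^sub>R h t s w = h t s w - indicat_real {0..r} s *\<^sub>R S (t - r) (h r s w)"
    if "s \<in> {0..t}" for s w
    using C0_semigroupD(3)[OF S, of "t - r" "r - s" "g s w"] rt that by (cases "s \<le> r") (simp_all add: h_def)
  note H = has_stoch_integral_linear_diff[OF rt(1,2) bounded_linear_ident bl
      has_stoch_integral_Y[OF t(2)] has_stoch_integral_Y[OF r] pr eq]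
  have A: "{r<..t} \<in> sets borel" "{r<..t} \<subseteq> {0..t}" using rt by auto
  have "AE w in M. (\<integral>\<^sup>+s\<in>{0..t}. (ennreal (norm (indicat_real {r<..} s *\<^sub>R h t s w)))\<^sup>2 \<partial>lborel) \<le> ennreal (K\<^sup>2 * a)"
    using AE_h_bound[OF t(2) A]
  proof eventually_elim
    fix w assume *: "(\<integral>\<^sup>+s\<in>{0..t}. (ennreal (norm (indicat_real {r<..t} s *\<^sub>R h t s w)))\<^sup>2 \<partial>lborel)
      \<le> ennreal (K\<^sup>2) * (\<integral>\<^sup>+s\<in>{r<..t}. (G s)\<^sup>2 \<partial>lborel)"
    have "(\<integral>\<^sup>+s\<in>{r<..t}. (G s)\<^sup>2 \<partial>lborel) \<le> (\<integral>\<^sup>+s\<in>{r..t}. (G s)\<^sup>2 \<partial>lborel)"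
      by (intro nn_integral_mono) (auto split: split_indicator)
    then have le': "(\<integral>\<^sup>+s\<in>{r<..t}. (G s)\<^sup>2 \<partial>lborel) \<le> ennreal a" using le by (rule order_trans)
    have "(\<integral>\<^sup>+s\<in>{0..t}. (ennreal (norm (indicat_real {r<..} s *\<^sub>R h t s w)))\<^sup>2 \<partial>lborel)
      = (\<integral>\<^sup>+s\<in>{0..t}. (ennreal (norm (indicat_real {r<..t} s *\<^sub>R h t s w)))\<^sup>2 \<partial>lborel)"
      by (intro nn_integral_cong) (auto split: split_indicator)
    also have "\<dots> \<le> ennreal (K\<^sup>2) * ennreal a"
      by (rule order_trans[OF *]) (intro mult_left_mono le'; simp)
    finally show "(\<integral>\<^sup>+s\<in>{0..t}. (ennreal (norm (indicat_real {r<..} s *\<^sub>R h t s w)))\<^sup>2 \<partial>lborel) \<le> ennreal (K\<^sup>2 * a)"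
      using a by (simp add: ennreal_mult)
  qed
  from BDG_bounded[OF bdg[OF q] q t(1) H _ this, of t]
  have "(\<integral>\<^sup>+w. ennreal (norm (Y t t w - S (t - r) (Y r (min t r) w)) powr q) \<partial>M) \<le> ennreal ((max (B q) 0 * sqrt (K\<^sup>2 * a)) powr q)"
    using a t by simp
  then show ?thesis using rt K_nonneg by (simp add: U_eq min_absorb2 real_sqrt_mult mult.assoc)
qed

end

section \<open>The maximal inequality\<close>

text \<open>The sum over all levels: a geometric series of ratio 2^(-1/4), the source of the
  constant in the theorem.\<close>

lemma chaining_series:
  shows "summable (\<lambda>n. 2 powr (- real n / 4))"
    and "(\<Sum>n. 2 powr (- real n / 4)) = 2 powr (1/4) / (2 powr (1/4) - 1)"
proof -
  define x :: real where "x = 2 powr (- (1/4))"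
  have e: "2 powr (- real n / 4) = x ^ n" for n
    unfolding x_def by (simp add: powr_powr flip: powr_realpow)
  have x: "0 < x" "x < 1" unfolding x_def by (auto simp: powr_less_one)
  then show "summable (\<lambda>n. 2 powr (- real n / 4))" unfolding e by (intro summable_geometric) auto
  have gt: "1 < (2::real) powr (1/4)" by (simp add: gr_one_powr)
  have "(\<Sum>n. x ^ n) = 1 / (1 - x)" using x by (intro suminf_geometric) auto
  also have "1 / (1 - x) = (2::real) powr (1/4) / (2 powr (1/4) - 1)"
  proof -
    have "(2::real) powr (1/4) * (1 - x) = 2 powr (1/4) - 1"
      by (simp add: x_def powr_minus_divide right_diff_distrib)
    from this[symmetric] show ?thesis using gt by simp
  qed
  finally show "(\<Sum>n. 2 powr (- real n / 4)) = 2 powr (1/4) / (2 powr (1/4) - 1)" unfolding e .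
qed

locale stoch_conv_chain = stoch_conv M F \<beta> S T B g
  for M :: "'w measure" and F \<beta> and S :: "real \<Rightarrow> 'a \<Rightarrow> 'a::{chilbert_space, second_countable_topology}"
    and T B and g :: "real \<Rightarrow> 'w \<Rightarrow> 'a" +
  fixes R c :: real and \<sigma> \<tau> :: "real \<Rightarrow> real"
  assumes R: "0 < R" and dyadic: "dyadic_chain S T K c \<sigma> \<tau>"
    and G_incr: "0 \<le> u \<Longrightarrow> u \<le> v \<Longrightarrow> v \<le> T \<Longrightarrow> (\<integral>\<^sup>+s\<in>{u..v}. (G s)\<^sup>2 \<partial>lborel) \<le> ennreal (R * (\<sigma> v - \<sigma> u))"
begin

sublocale chain: dyadic_chain S T K c \<sigma> \<tau> by (rule dyadic)

lemma S_measurable: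
  assumes "t \<in> {0..T}" "f \<in> borel_measurable M"
  shows "(\<lambda>w. S t (f w)) \<in> borel_measurable M"
proof (rule measurable_compose[OF assms(2)])
  show "S t \<in> borel_measurable borel"
    using C0_semigroupD(1)[OF S] assms(1)
    by (intro borel_measurable_continuous_onI linear_continuous_on) auto
qed

section \<open>Moments of the largest increment of each level\<close>

definition incr :: "nat \<Rightarrow> nat \<Rightarrow> 'w \<Rightarrow> 'a" where
  "incr n k w = chain.chain_incr (\<lambda>t. U t w) n k"

definition D :: "nat \<Rightarrow> 'w \<Rightarrow> real" where
  "D n w = (SUP k\<in>{..<2 ^ n}. norm (incr n k w))"

lemma incr_measurable:
  assumes "k < 2 ^ n" shows "incr n k \<in> borel_measurable M"
proof -
  have p: "chain.pt n k \<in> {0..T}" "chain.pt n (Suc k) \<in> {0..T}" "chain.pt n k \<le> chain.pt n (Suc k)"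
    using assms by (auto intro!: chain.pt_range chain.pt_mono simp del: atLeastAtMost_iff)
  then show ?thesis
    unfolding incr_def[abs_def] chain.chain_incr_def
    by (intro borel_measurable_diff S_measurable U_measurable) auto
qed

lemma incr_le_D: "k < 2 ^ n \<Longrightarrow> norm (incr n k w) \<le> D n w"
  unfolding D_def by (rule cSUP_upper) auto

lemma D_nonneg: "0 \<le> D n w"
  using order_trans[OF norm_ge_zero incr_le_D[of 0 n w]] by simp

lemma D_measurable [measurable]: "D n \<in> borel_measurable M"
  unfolding D_def[abs_def]
  by (rule borel_measurable_cSUP) (auto intro!: measurable_compose[OF incr_measurable borel_measurable_norm])

lemma D_attained: obtains k where "k < 2 ^ n" "D n w = norm (incr n k w)"
proof -
  let ?A = "(\<lambda>k. norm (incr n k w)) ` {..<2 ^ n}"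
  have "finite ?A" "?A \<noteq> {}" by (auto simp: lessThan_empty_iff)
  then have "Sup ?A = Max ?A" "Max ?A \<in> ?A" by (rule cSup_eq_Max, rule Max_in)
  then have "Sup ?A \<in> ?A" by simp
  then show thesis using that unfolding D_def by auto
qed

lemma incr_bound:
  assumes k: "k < 2 ^ n" and q: "0 < q"
  shows "(\<integral>\<^sup>+w. ennreal (norm (incr n k w) powr q) \<partial>M)
    \<le> ennreal ((max (B q) 0 * K * sqrt (R / 2 ^ n)) powr q)"
proof -
  have p: "chain.pt n k \<in> {0..T}" "chain.pt n (Suc k) \<in> {0..T}" "chain.pt n k \<le> chain.pt n (Suc k)"
    using k by (auto intro!: chain.pt_range chain.pt_mono simp del: atLeastAtMost_iff)
  have "\<sigma> (chain.pt n (Suc k)) - \<sigma> (chain.pt n k) = 1 / 2 ^ n"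
    using k by (simp add: chain.\<sigma>_pt add_divide_distrib)
  then have "(\<integral>\<^sup>+s\<in>{chain.pt n k..chain.pt n (Suc k)}. (G s)\<^sup>2 \<partial>lborel) \<le> ennreal (R / 2 ^ n)"
    using G_incr[of "chain.pt n k" "chain.pt n (Suc k)"] p by simp
  then show ?thesis
    unfolding incr_def chain.chain_incr_def using p R by (intro U_incr_bound q) auto
qed

text \<open>The q-th power of a maximum is at most the sum of the q-th powers, which costs a factor
  2^n; n - n * q / 2 \<le> - n * q / 4 is where q \<ge> 4 enters. The bound \<open>L\<close> is an
  arbitrary positive majorant because the natural constant may be 0, whereas the summation lemma
  asks for a positive scale.\<close>

lemma D_bound:
  assumes q: "4 \<le> q" and L: "0 < L" "max (B q) 0 * K * sqrt R \<le> L"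
  shows "(\<integral>\<^sup>+w. ennreal (D n w powr q) \<partial>M) \<le> ennreal ((L * 2 powr (- real n / 4)) powr q)"
proof -
  have s2: "sqrt (2 ^ n) = 2 powr (real n / 2)"
    by (simp add: powr_half_sqrt[symmetric] powr_powr flip: powr_realpow)
  have le: "max (B q) 0 * K * sqrt (R / 2 ^ n) \<le> L * 2 powr (- real n / 2)"
    using mult_right_mono[OF L(2), of "2 powr (- real n / 2)"]
    by (simp add: real_sqrt_divide s2 powr_minus_divide)
  have nn: "0 \<le> max (B q) 0 * K * sqrt (R / 2 ^ n)" using K_nonneg R by simp
  have "(\<integral>\<^sup>+w. ennreal (D n w powr q) \<partial>M) \<le> (\<integral>\<^sup>+w. (\<Sum>k<2 ^ n. ennreal (norm (incr n k w) powr q)) \<partial>M)"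
  proof (rule nn_integral_mono)
    fix w
    obtain k where k: "k < 2 ^ n" "D n w = norm (incr n k w)" by (rule D_attained)
    show "ennreal (D n w powr q) \<le> (\<Sum>k<2 ^ n. ennreal (norm (incr n k w) powr q))"
      unfolding k(2) by (rule member_le_sum) (use k(1) in simp_all)
  qed
  also have "\<dots> = (\<Sum>k<2 ^ n. \<integral>\<^sup>+w. ennreal (norm (incr n k w) powr q) \<partial>M)"
  proof (rule nn_integral_sum)
    fix k :: nat assume "k \<in> {..<2 ^ n}"
    then have [measurable]: "incr n k \<in> borel_measurable M" by (simp add: incr_measurable)
    show "(\<lambda>w. ennreal (norm (incr n k w) powr q)) \<in> borel_measurable M" by measurable
  qed
  also have "\<dots> \<le> (\<Sum>k<(2::nat) ^ n. ennreal ((L * 2 powr (- real n / 2)) powr q))"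
    using q nn le by (intro sum_mono order_trans[OF incr_bound] ennreal_leI powr_mono2) auto
  also have "\<dots> = ennreal (2 ^ n * (L * 2 powr (- real n / 2)) powr q)"
    by (simp add: ennreal_mult ennreal_of_nat_eq_real_of_nat)
  also have "\<dots> \<le> ennreal ((L * 2 powr (- real n / 4)) powr q)"
  proof (rule ennreal_leI)
    have "(L * 2 powr (- real n / 2)) powr q = L powr q * 2 powr (- real n / 2 * q)"
      using L by (simp only: powr_mult powr_powr less_imp_le powr_ge_zero)
    moreover have "(2::real) ^ n = 2 powr real n" by (simp add: powr_realpow)
    ultimately have "2 ^ n * (L * 2 powr (- real n / 2)) powr q = L powr q * 2 powr (real n + - real n / 2 * q)"
      by (simp only: powr_add mult.left_commute)
    also have "\<dots> \<le> L powr q * 2 powr (- real n / 4 * q)"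
    proof (intro mult_left_mono powr_mono)
      have "real n * 4 \<le> real n * q" using q by (intro mult_left_mono) auto
      then show "real n + - real n / 2 * q \<le> - real n / 4 * q" by simp
    qed auto
    also have "\<dots> = (L * 2 powr (- real n / 4)) powr q" using L by (simp add: powr_mult powr_powr)
    finally show "2 ^ n * (L * 2 powr (- real n / 2)) powr q \<le> (L * 2 powr (- real n / 4)) powr q" .
  qed
  finally show ?thesis .
qed

lemma sum_D_bound:
  assumes q: "4 \<le> q" and L: "0 < L" "max (B q) 0 * K * sqrt R \<le> L"
  shows "AE w in M. summable (\<lambda>n. D n w)"
    and "(\<integral>\<^sup>+w. ennreal ((\<Sum>n. D n w) powr q) \<partial>M) \<le> ennreal ((L * (2 powr (1/4) / (2 powr (1/4) - 1))) powr q)"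
  using nn_integral_powr_suminf_le[OF prob D_measurable D_nonneg _ L(1) _ chaining_series(1) D_bound[OF q L]]
    q chaining_series(2) by auto

lemma AE_summable_D: "AE w in M. summable (\<lambda>n. D n w)"
  by (rule sum_D_bound(1)[of 4 "max 1 (max (B 4) 0 * K * sqrt R)"]) auto

text \<open>Summability is phrased through the extended series, so that the event is visibly
  measurable.\<close>

definition good :: "'w set" where
  "good = {w \<in> space M. U 0 w = 0 \<and> (\<Sum>n. ennreal (D n w)) < top}"

lemma good_sets [measurable]: "good \<in> sets M"
proof -
  have [measurable]: "U 0 \<in> borel_measurable M" using U_measurable[of 0] T0 by simp
  show ?thesis unfolding good_def by measurable
qed

lemma goodD:
  assumes "w \<in> good"
  shows "U 0 w = 0" "\<And>n k. k < 2 ^ n \<Longrightarrow> norm (chain.chain_incr (\<lambda>t. U t w) n k) \<le> D n w"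
    "summable (\<lambda>n. D n w)"
proof -
  show "U 0 w = 0" using assms by (simp add: good_def)
  show "norm (chain.chain_incr (\<lambda>t. U t w) n k) \<le> D n w" if "k < 2 ^ n" for n k
    using incr_le_D[OF that, of w] by (simp add: incr_def)
  have "(\<Sum>n. ennreal (D n w)) \<noteq> top" using assms by (auto simp: good_def)
  then show "summable (\<lambda>n. D n w)" by (rule summable_suminf_not_top[OF D_nonneg])
qed

lemma AE_good: "AE w in M. w \<in> good"
proof (rule AE_mp[OF AE_summable_D], rule AE_mp[OF U_0], intro AE_I2 impI)
  fix w assume s: "summable (\<lambda>n. D n w)" and 0: "U 0 w = 0" "w \<in> space M"
  have "(\<Sum>n. ennreal (D n w)) = ennreal (\<Sum>n. D n w)" by (rule suminf_ennreal2[OF D_nonneg s])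
  then show "w \<in> good" using 0 by (simp add: good_def)
qed

text \<open>The value 0 outside \<open>good\<close> makes every path continuous, as a continuous
  version requires, and not only almost every one.\<close>

definition V :: "real \<Rightarrow> 'w \<Rightarrow> 'a" where
  "V t w = (if w \<in> good then chain.chain_lim (\<lambda>t. U t w) t else 0)"

lemma chain_approx_measurable:
  assumes "t \<in> {0..T}"
  shows "(\<lambda>w. chain.chain_approx (\<lambda>t. U t w) n t) \<in> borel_measurable M"
  unfolding chain.chain_approx_def using assms chain.pt_idx_range[OF assms, of n] chain.pt_idx_le[OF assms, of n]
  by (intro S_measurable U_measurable) auto

lemma V_measurable: assumes t: "t \<in> {0..T}" shows "V t \<in> borel_measurable M"
proof (rule borel_measurable_LIMSEQ_metric)
  show "(\<lambda>w. if w \<in> good then chain.chain_approx (\<lambda>t. U t w) n t else 0) \<in> borel_measurable M" for n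
    using chain_approx_measurable[OF t] by measurable
  show "(\<lambda>n. if w \<in> good then chain.chain_approx (\<lambda>t. U t w) n t else 0) \<longlonglongrightarrow> V t w" for w
    using chain.chain_approx_tendsto[of "\<lambda>t. U t w" "\<lambda>n. D n w", OF goodD t] by (auto simp: V_def)
qed

text \<open>A time t that is not dyadic needs an argument, since the limit is built from dyadic
  values only. The increment from the last dyadic point to t has fourth moment at most a multiple of
  4^(-n), which is summable, so the approximations also converge to \<open>U t\<close> almost
  surely.\<close>

lemma V_eq_U: assumes t: "t \<in> {0..T}" shows "AE w in M. V t w = U t w"
proof -
  let ?a = "\<lambda>n w. chain.chain_approx (\<lambda>t. U t w) n t"
  define E where "E = max (B 4) 0 * K * sqrt R"
  have E: "0 \<le> E" unfolding E_def using K_nonneg R by simp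
  have [measurable]: "?a n \<in> borel_measurable M" "U t \<in> borel_measurable M" for n
    using chain_approx_measurable[OF t] U_measurable[OF t] by auto
  have le: "(\<integral>\<^sup>+w. ennreal (norm (U t w - ?a n w) powr 4) \<partial>M) \<le> ennreal (E powr 4 * (1/4) ^ n)" for n
  proof -
    let ?r = "chain.pt n (chain.idx n t)"
    have r: "0 \<le> ?r" "?r \<le> t" "t \<le> T" using chain.pt_idx_range[OF t, of n] chain.pt_idx_le[OF t, of n] t by auto
    have "\<sigma> t - \<sigma> ?r \<le> 1 / 2 ^ n"
      using chain.idx_bounds[OF t, of n] by (simp add: chain.\<sigma>_pt add_divide_distrib)
    then have "R * (\<sigma> t - \<sigma> ?r) \<le> R * (1 / 2 ^ n)" using R by (intro mult_left_mono) auto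
    then have "(\<integral>\<^sup>+s\<in>{?r..t}. (G s)\<^sup>2 \<partial>lborel) \<le> ennreal (R * (1 / 2 ^ n))"
      by (intro order_trans[OF G_incr[OF r]] ennreal_leI)
    then have "(\<integral>\<^sup>+w. ennreal (norm (U t w - S (t - ?r) (U ?r w)) powr 4) \<partial>M)
        \<le> ennreal ((max (B 4) 0 * K * sqrt (R * (1 / 2 ^ n))) powr 4)"
      using R by (intro U_incr_bound[OF r]) auto
    also have "max (B 4) 0 * K * sqrt (R * (1 / 2 ^ n)) = E * sqrt (1 / 2 ^ n)"
      by (simp only: E_def real_sqrt_mult mult.assoc)
    also have "(E * sqrt (1 / 2 ^ n)) powr 4 = E powr 4 * (1/4) ^ n"
    proof -
      have "sqrt (1 / 2 ^ n) powr 4 = (sqrt (1 / 2 ^ n)) ^ 4" by (simp add: powr_numeral)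
      also have "\<dots> = ((sqrt (1 / 2 ^ n))\<^sup>2)\<^sup>2" by (simp only: power4_eq_xxxx power2_eq_square mult.assoc)
      also have "\<dots> = (1 / 2 ^ n)\<^sup>2" by (subst real_sqrt_pow2) auto
      also have "\<dots> = ((1 / 2)\<^sup>2) ^ n" by (simp only: power_one_over[symmetric] power_mult[symmetric] mult.commute)
      also have "\<dots> = (1/4) ^ n" by (simp add: power2_eq_square)
      finally show ?thesis using E by (simp add: powr_mult)
    qed
    finally show ?thesis by (simp add: chain.chain_approx_def)
  qed
  have "(\<integral>\<^sup>+w. (\<Sum>n. ennreal (norm (U t w - ?a n w) powr 4)) \<partial>M) = (\<Sum>n. \<integral>\<^sup>+w. ennreal (norm (U t w - ?a n w) powr 4) \<partial>M)"
    by (rule nn_integral_suminf) measurable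
  also have "\<dots> \<le> (\<Sum>n. ennreal (E powr 4 * (1/4) ^ n))" by (intro suminf_le summableI le)
  also have "\<dots> = ennreal (\<Sum>n. E powr 4 * (1/4) ^ n)"
    by (rule suminf_ennreal2) (auto intro!: summable_mult summable_geometric)
  finally have "(\<integral>\<^sup>+w. (\<Sum>n. ennreal (norm (U t w - ?a n w) powr 4)) \<partial>M) \<noteq> \<infinity>"
    by (auto simp: top_unique)
  then have "AE w in M. (\<Sum>n. ennreal (norm (U t w - ?a n w) powr 4)) \<noteq> \<infinity>"
    by (intro nn_integral_PInf_AE) auto
  with AE_good show ?thesis
  proof eventually_elim
    fix w assume g: "w \<in> good" and s: "(\<Sum>n. ennreal (norm (U t w - ?a n w) powr 4)) \<noteq> \<infinity>"
    have 1: "(\<lambda>n. ?a n w) \<longlonglongrightarrow> V t w"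
      using chain.chain_approx_tendsto[of "\<lambda>t. U t w" "\<lambda>n. D n w", OF goodD[OF g] t] g by (simp add: V_def)
    have "summable (\<lambda>n. norm (U t w - ?a n w) powr 4)"
      using s by (intro summable_suminf_not_top) auto
    then have "(\<lambda>n. norm (U t w - ?a n w) powr 4) \<longlonglongrightarrow> 0" by (rule summable_LIMSEQ_zero)
    moreover have "(\<lambda>n. norm (U t w - ?a n w) powr 4) \<longlonglongrightarrow> norm (U t w - V t w) powr 4"
      by (intro tendsto_powr2 tendsto_norm tendsto_diff tendsto_const 1) auto
    ultimately have "norm (U t w - V t w) powr 4 = 0" using LIMSEQ_unique by blast
    then show "V t w = U t w" by simp
  qed
qed

lemma continuous_version_V: "continuous_version M {0..T} (stoch_convolution M F \<beta> S g) V"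
  unfolding continuous_version_def
proof (intro conjI ballI)
  show "V t \<in> borel_measurable M" if "t \<in> {0..T}" for t by (rule V_measurable[OF that])
  show "AE w in M. V t w = stoch_convolution M F \<beta> S g t w" if "t \<in> {0..T}" for t
    using V_eq_U[OF that] by (simp add: U_def)
  show "continuous_on {0..T} (\<lambda>t. V t w)" for w
    using chain.continuous_on_chain_lim[of "\<lambda>t. U t w" "\<lambda>n. D n w", OF goodD]
    by (cases "w \<in> good") (auto simp: V_def)
qed

text \<open>The estimate is made for an arbitrary continuous version because the constructed
  \<open>V\<close> depends on the clock, and R will vary. Exponents below 4 are reached from 4 by
  monotonicity of moments.\<close>

lemma maximal_bound:
  assumes V': "continuous_version M {0..T} (stoch_convolution M F \<beta> S g) V'"
    and p: "1 \<le> p" and L: "0 < L" "max (B (max p 4)) 0 * K * sqrt R \<le> L"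
  shows "Lp_norm M p (sup_norm T V')
    \<le> ennreal (K * (L * (2 powr (1/4) / (2 powr (1/4) - 1))))"
proof -
  define q where "q = max p 4"
  define C0 :: real where "C0 = 2 powr (1/4) / (2 powr (1/4) - 1)"
  have C0: "0 < C0" unfolding C0_def by (intro divide_pos_pos) (simp_all add: gr_one_powr)
  \<comment> \<open>The absolute value keeps \<open>Z\<close> nonnegative even where the series
    diverges and its sum has no meaning.\<close>
  define Z where "Z w = \<bar>\<Sum>n. D n w\<bar>" for w
  have [measurable]: "Z \<in> borel_measurable M" unfolding Z_def[abs_def] by measurable
  have "(\<integral>\<^sup>+w. ennreal (Z w powr q) \<partial>M) = (\<integral>\<^sup>+w. ennreal ((\<Sum>n. D n w) powr q) \<partial>M)"
    by (rule nn_integral_cong_AE, rule AE_mp[OF AE_summable_D], intro AE_I2 impI)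
      (simp add: Z_def suminf_nonneg D_nonneg)
  also have "\<dots> \<le> ennreal ((L * C0) powr q)"
    unfolding C0_def using L by (intro sum_D_bound(2)) (auto simp: q_def)
  finally have Zq: "(\<integral>\<^sup>+w. ennreal (Z w powr q) \<partial>M) \<le> ennreal ((L * C0) powr q)" .
  have Zp: "(\<integral>\<^sup>+w. ennreal (Z w powr p) \<partial>M) \<le> ennreal ((L * C0) powr p)"
  proof (rule nn_integral_powr_le_mono[OF prob _ _ _ _ _ Zq])
    show "0 \<le> Z w" for w by (simp add: Z_def)
    show "0 < p" "p \<le> q" using p by (simp_all add: q_def)
    show "0 < L * C0" using L C0 by simp
  qed measurable
  \<comment> \<open>There are countably many dyadic points, so one null set serves for all of them;
    continuity then extends the bound to all times.\<close>
  have pts: "AE w in M. \<forall>n. \<forall>k. k \<le> 2 ^ n \<longrightarrow> V' (chain.pt n k) w = U (chain.pt n k) w"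
    unfolding AE_all_countable
  proof (intro allI)
    fix n k :: nat
    show "AE w in M. k \<le> 2 ^ n \<longrightarrow> V' (chain.pt n k) w = U (chain.pt n k) w"
      using V' chain.pt_range[of k n] by (cases "k \<le> 2 ^ n") (auto simp: continuous_version_def U_def)
  qed
  have "(\<integral>\<^sup>+w. enn_powr (sup_norm T V' w) p \<partial>M) \<le> (\<integral>\<^sup>+w. ennreal (K powr p) * ennreal (Z w powr p) \<partial>M)"
  proof (rule nn_integral_mono_AE)
    show "AE w in M. enn_powr (sup_norm T V' w) p \<le> ennreal (K powr p) * ennreal (Z w powr p)"
      using pts AE_good AE_space
    proof eventually_elim
      fix w assume eq: "\<forall>n. \<forall>k. k \<le> 2 ^ n \<longrightarrow> V' (chain.pt n k) w = U (chain.pt n k) w"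
        and g: "w \<in> good" and w: "w \<in> space M"
      note G = goodD[OF g]
      have "norm (V' t w) \<le> K * Z w" if t: "t \<in> {0..T}" for t
      proof (rule chain.norm_le_on_pt_imp_norm_le[of "\<lambda>t. V' t w", OF _ t])
        show "continuous_on {0..T} (\<lambda>t. V' t w)" using V' w by (simp add: continuous_version_def)
        fix n k :: nat assume k: "k \<le> 2 ^ n"
        have "norm (chain.chain_lim (\<lambda>t. U t w) (chain.pt n k)) \<le> K * (\<Sum>n. D n w)"
          by (rule chain.norm_chain_lim[of "\<lambda>t. U t w" "\<lambda>n. D n w", OF G chain.pt_range[OF k]])
        also have "\<dots> \<le> K * Z w" unfolding Z_def by (intro mult_left_mono K_nonneg) simp
        finally show "norm (V' (chain.pt n k) w) \<le> K * Z w"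
          using chain.chain_lim_pt[of "\<lambda>t. U t w" "\<lambda>n. D n w", OF G k] eq k by simp
      qed
      then have "sup_norm T V' w \<le> ennreal (K * Z w)"
        by (intro SUP_least ennreal_leI)
      then have "enn_powr (sup_norm T V' w) p \<le> enn_powr (ennreal (K * Z w)) p"
        using p by (intro enn_powr_mono) auto
      also have "\<dots> = ennreal (K powr p) * ennreal (Z w powr p)"
      proof -
        have Z: "0 \<le> Z w" by (simp add: Z_def)
        have "enn_powr (ennreal (K * Z w)) p = ennreal ((K * Z w) powr p)"
          by (intro enn_powr_ennreal mult_nonneg_nonneg K_nonneg Z)
        then show ?thesis using K_nonneg Z by (simp only: powr_mult ennreal_mult powr_ge_zero)
      qed
      finally show "enn_powr (sup_norm T V' w) p \<le> ennreal (K powr p) * ennreal (Z w powr p)" .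
    qed
  qed
  also have "\<dots> = ennreal (K powr p) * (\<integral>\<^sup>+w. ennreal (Z w powr p) \<partial>M)"
    by (rule nn_integral_cmult) measurable
  also have "\<dots> \<le> ennreal (K powr p) * ennreal ((L * C0) powr p)"
    by (intro mult_left_mono Zp) simp
  also have "\<dots> = ennreal ((K * (L * C0)) powr p)"
    using K_nonneg L C0 by (simp add: powr_mult ennreal_mult)
  finally show ?thesis
    unfolding C0_def[symmetric] using p K_nonneg L C0 by (subst Lp_norm_le_iff) auto
qed

end

section \<open>Choice of the clock total and its limit\<close>

context stoch_conv begin

lemma chain_exists:
  assumes "(\<integral>\<^sup>+t\<in>{0..T}. (G t)\<^sup>2 \<partial>lborel) < ennreal R"
  shows "\<exists>c \<sigma> \<tau>. stoch_conv_chain M F \<beta> S T B g R c \<sigma> \<tau>"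
proof -
  have R: "0 < R" using assms by (cases "0 < R") (auto simp: ennreal_neg)
  obtain \<sigma> \<tau> c where *: "0 < c" "\<sigma> 0 = 0" "\<sigma> T = 1"
    "\<And>u v. 0 \<le> u \<Longrightarrow> u \<le> v \<Longrightarrow> v \<le> T \<Longrightarrow> v - u \<le> c * (\<sigma> v - \<sigma> u)"
    "\<And>x. x \<in> {0..1} \<Longrightarrow> \<tau> x \<in> {0..T}" "\<And>x. x \<in> {0..1} \<Longrightarrow> \<sigma> (\<tau> x) = x"
    "\<And>u v. 0 \<le> u \<Longrightarrow> u \<le> v \<Longrightarrow> v \<le> T \<Longrightarrow> (\<integral>\<^sup>+s\<in>{u..v}. (G s)\<^sup>2 \<partial>lborel) \<le> ennreal (R * (\<sigma> v - \<sigma> u))"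
    by (rule time_change_exists[OF T G_measurable assms]) blast
  have "linear (S t)" if "t \<in> {0..T}" for t
    using C0_semigroupD(1)[OF S] that by (intro bounded_linear.linear) auto
  then have "dyadic_chain S T K c \<sigma> \<tau>"
    by (intro dyadic_chain.intro) (use * T K_nonneg S_bound C0_semigroupD[OF S] C0_semigroup_continuous_on_orbit[OF S] in auto)
  then have "stoch_conv_chain M F \<beta> S T B g R c \<sigma> \<tau>"
    using R *(7) by (intro stoch_conv_chain.intro stoch_conv_axioms stoch_conv_chain_axioms.intro) auto
  then show ?thesis by blast
qed

lemma continuous_version_exists: "\<exists>V. continuous_version M {0..T} (stoch_convolution M F \<beta> S g) V"
proof -
  let ?A = "\<integral>\<^sup>+t\<in>{0..T}. (G t)\<^sup>2 \<partial>lborel"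
  have "?A = ennreal (enn2real ?A)" using fin_G by simp
  also have "\<dots> < ennreal (enn2real ?A + 1)" by (simp add: ennreal_less_iff)
  finally have "?A < ennreal (enn2real ?A + 1)" .
  then obtain c \<sigma> \<tau> where "stoch_conv_chain M F \<beta> S T B g (enn2real ?A + 1) c \<sigma> \<tau>"
    using chain_exists by blast
  then show ?thesis using stoch_conv_chain.continuous_version_V by blast
qed

text \<open>The version \<open>V\<close> is held fixed while the clock total A + e decreases to A,
  so the bounds obtained for different clocks concern the same process.\<close>

lemma maximal_inequality:
  assumes V: "continuous_version M {0..T} (stoch_convolution M F \<beta> S g) V" and p: "1 \<le> p"
    and A: "(\<integral>\<^sup>+t\<in>{0..T}. (G t)\<^sup>2 \<partial>lborel) = ennreal A" "0 \<le> A"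
  shows "Lp_norm M p (sup_norm T V)
    \<le> ennreal (2 powr (1/4) / (2 powr (1/4) - 1) * max (B (max p 4)) 0 * K\<^sup>2 * sqrt A)"
proof -
  define C0 :: real where "C0 = 2 powr (1/4) / (2 powr (1/4) - 1)"
  define b where "b = max (B (max p 4)) 0"
  have b: "0 \<le> b" by (simp add: b_def)
  have le: "Lp_norm M p (sup_norm T V) \<le> ennreal (K * ((b * K * sqrt (A + e) + e) * C0))"
    if e: "0 < e" for e
  proof -
    have "ennreal A < ennreal (A + e)" using A e by (simp add: ennreal_less_iff)
    then obtain c \<sigma> \<tau> where c: "stoch_conv_chain M F \<beta> S T B g (A + e) c \<sigma> \<tau>"
      using chain_exists[of "A + e"] A by auto
    show ?thesis
      unfolding C0_def b_def
    proof (rule stoch_conv_chain.maximal_bound[OF c V p])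
      \<comment> \<open>The second e keeps the majorant positive when the constant or
        \<open>K\<close> is 0; it disappears in the limit as well.\<close>
      show "0 < max (B (max p 4)) 0 * K * sqrt (A + e) + e"
        using e A K_nonneg by (intro add_nonneg_pos) auto
    qed (use e in auto)
  qed
  have lim: "((\<lambda>e. ennreal (K * ((b * K * sqrt (A + e) + e) * C0))) \<longlongrightarrow> ennreal (K * ((b * K * sqrt (A + 0) + 0) * C0))) (at_right 0)"
    by (intro tendsto_ennrealI tendsto_intros)
  have "Lp_norm M p (sup_norm T V) \<le> ennreal (K * ((b * K * sqrt (A + 0) + 0) * C0))"
    by (rule tendsto_lowerbound[OF lim])
      (auto simp: eventually_at_filter intro!: always_eventually le)
  also have "K * ((b * K * sqrt (A + 0) + 0) * C0) = C0 * b * K\<^sup>2 * sqrt A" by (simp add: power2_eq_square)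
  finally show ?thesis by (simp only: C0_def b_def)
qed

end

theorem theorem6p1:
  fixes S :: "real \<Rightarrow> 'a \<Rightarrow> 'a::{chilbert_space, second_countable_topology}"
    and T :: real
    and M :: "'w measure" and F :: "real \<Rightarrow> 'w measure" and \<beta> :: "real \<Rightarrow> 'w \<Rightarrow> real"
    and B :: "real \<Rightarrow> real"
    and g :: "real \<Rightarrow> 'w \<Rightarrow> 'a"
  assumes "C0_semigroup S"
    and "0 < T"
    and "stochastic_basis M F \<beta>"
    and "\<forall>q>0. BDG_constant TYPE('w) q (B q)"
    and "predictable M F {0..T} g"
    and "(\<integral>\<^sup>+t\<in>{0..T}. (esssup M (\<lambda>\<omega>. ennreal (norm (g t \<omega>))))\<^sup>2 \<partial>lborel) < \<infinity>"
  defines "M\<^sub>I \<equiv> SUP t\<in>{0..T}. onorm (S t)"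
    and "C \<equiv> \<lambda>p. 2 powr (3/4) * B (max p 4) / (2 powr (1/4) - 1)"
  shows "(\<exists>V. continuous_version M {0..T} (stoch_convolution M F \<beta> S g) V) \<and>
    (\<forall>V. continuous_version M {0..T} (stoch_convolution M F \<beta> S g) V \<longrightarrow>
      (\<forall>p\<ge>1. Lp_norm M p (\<lambda>\<omega>. SUP t\<in>{0..T}. ennreal (norm (V t \<omega>)))
        \<le> ennreal (C p * M\<^sub>I\<^sup>2) *
           enn_powr (\<integral>\<^sup>+s\<in>{0..T}. (esssup M (\<lambda>\<omega>. ennreal (norm (g s \<omega>))))\<^sup>2 \<partial>lborel) (1/2)))"
proof -
  interpret stoch_conv M F \<beta> S T B g
    using assms(1-6) by unfold_locales auto
  show ?thesis
  proof (intro conjI allI impI continuous_version_exists)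
    fix V and p :: real
    assume V: "continuous_version M {0..T} (stoch_convolution M F \<beta> S g) V" and p: "1 \<le> p"
    define A where "A = enn2real (\<integral>\<^sup>+t\<in>{0..T}. (G t)\<^sup>2 \<partial>lborel)"
    have A: "(\<integral>\<^sup>+t\<in>{0..T}. (G t)\<^sup>2 \<partial>lborel) = ennreal A" "0 \<le> A"
      using fin_G by (simp_all add: A_def)
    have gt: "1 < (2::real) powr (1/4)" by (simp add: gr_one_powr)
    \<comment> \<open>The stated numerator 2^(3/4) exceeds the one obtained by a factor sqrt 2,
      which is given away here. The maximum with 0 accounts for a possibly negative value of
      \<open>B\<close>.\<close>
    have "2 powr (1/4) / (2 powr (1/4) - 1) * max (B (max p 4)) 0 * K\<^sup>2 * sqrt A
      \<le> max (C p) 0 * K\<^sup>2 * sqrt A"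
    proof (intro mult_right_mono)
      have "2 powr (1/4) / (2 powr (1/4) - 1) * max (B (max p 4)) 0
        \<le> 2 powr (3/4) / (2 powr (1/4) - 1) * max (B (max p 4)) 0"
        using gt by (intro mult_right_mono divide_right_mono powr_mono) (auto simp: ge_one_powr_ge_zero)
      also have "\<dots> = max (C p) 0"
      proof -
        have "0 \<le> 2 powr (3/4) / ((2::real) powr (1/4) - 1)"
          using less_imp_le[OF gt] by (intro divide_nonneg_nonneg) auto
        then show ?thesis by (simp only: C_def max_mult_distrib_left if_True mult_zero_right times_divide_eq_left)
      qed
      finally show "2 powr (1/4) / (2 powr (1/4) - 1) * max (B (max p 4)) 0 \<le> max (C p) 0" .
    qed (use A in auto)
    then have "Lp_norm M p (\<lambda>w. SUP t\<in>{0..T}. ennreal (norm (V t w))) \<le> ennreal (max (C p) 0 * K\<^sup>2 * sqrt A)"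
      by (intro order_trans[OF maximal_inequality[OF V p A]] ennreal_leI)
    also have "max (C p) 0 * K\<^sup>2 = max (C p * M\<^sub>I\<^sup>2) 0"
      by (simp add: max_mult_distrib_right K_def M\<^sub>I_def)
    also have "ennreal (max (C p * M\<^sub>I\<^sup>2) 0 * sqrt A) = ennreal (max (C p * M\<^sub>I\<^sup>2) 0) * ennreal (sqrt A)"
      using A by (intro ennreal_mult'') simp
    also have "ennreal (max (C p * M\<^sub>I\<^sup>2) 0) = ennreal (C p * M\<^sub>I\<^sup>2)"
      by (simp add: max_def ennreal_neg)
    also have "ennreal (sqrt A) = enn_powr (\<integral>\<^sup>+t\<in>{0..T}. (G t)\<^sup>2 \<partial>lborel) (1/2)"
      using A by (simp add: enn_powr_ennreal powr_half_sqrt)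
    finally show "Lp_norm M p (\<lambda>w. SUP t\<in>{0..T}. ennreal (norm (V t w)))
        \<le> ennreal (C p * M\<^sub>I\<^sup>2) *
           enn_powr (\<integral>\<^sup>+s\<in>{0..T}. (esssup M (\<lambda>w. ennreal (norm (g s w))))\<^sup>2 \<partial>lborel) (1/2)"
      by (simp only: G_def)
  qed
qed

end
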